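(* Let $\mathcal H$ be a separable Hilbert space with norm $|\cdot|$ and let $\phi=\phi_1+\phi_2:\mathcal H\to(-\infty,+\infty]$, where $\phi_1:\mathcal H\to(-\infty,+\infty]$ is proper, lower semicontinuous and convex, and $\phi_2\in C^1(\mathcal H)$. Suppose that there is $\kappa\ge0$ such that $v\mapsto\phi(v)+\kappa|v|^2$ has compact sublevels in $\mathcal H$, that $\liminf_{|u|\to+\infty}\phi(u)=+\infty$, that $$\forall\,T>0:\quad v\in H^1(0,T;\mathcal H)\ \Rightarrow\ D\phi_2(v)\in L^2(0,T;\mathcal H),$$ and that the set $\{v\in\mathcal H:\partial\phi_1(v)+D\phi_2(v)\ni0\}$ is bounded in $(D(\phi_1),d_X)$, where $$d_X(u,v):=|u-v|+|\phi_1(u)-\phi_1(v)|,\qquad u,v\in D(\phi_1).$$ Then the set of all functions $u:[0,+\infty)\to\mathcal H$ with $u \in H^1(0,T;\mathcal H)$ for all $T>0$, $u(0)\in D(\phi_1)$, and $$u'(t)+\partial\phi_1(u(t))+D\phi_2(u(t))\ni0\quad\text{for a.e. }t\in(0,+\infty)$$ is a generalized semiflow on $(D(\phi_1),d_X)$ and possesses a unique global attractor. Moreover, the attractor is Lyapunov stable.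
   Context: $D(\phi_1)=\{u:\phi_1(u)<+\infty\}$; $\partial\phi_1$ is the subdifferential of convex analysis, $D\phi_2$ the (Fréchet) gradient. Generalized semiflow on a metric space $(X,d_X)$ (not necessarily complete): a family $G$ of maps $g:[0,+\infty)\to X$ such that (H1) for any $g_0\in X$ there is at least one $g\in G$ with $g(0)=g_0$; (H2) for any $g\in G$ and $\tau\ge0$ the translate $g^\tau(t):=g(t+\tau)$, $t\ge0$, belongs to $G$; (H3) for any $g,h\in G$ and $t\ge 0$ with $h(0)=g(t)$, the map $z$ with $z(\tau)=g(\tau)$ for $0\le\tau\le t$ and $z(\tau)=h(\tau-t)$ for $\tau>t$ belongs to $G$; (H4) if $\{g_n\}\subset G$ and $g_n(0)\to g_0$ in $X$, then there are a subsequence $\{g_{n_k}\}$ and $g\in G$ with $g(0)=g_0$ and $g_{n_k}(t)\to g(t)$ in $X$ for all $t\ge0$. For $E\subset X$, $t\ge0$: $T(t)E:=\{g(t):g\in G,\ g(0)\in E\}$; $e(E,B):=\sup_{a\in E}\inf_{b\in B}d_X(a,b)$. $U$ attracts $E$ if $e(T(t)E,U)\to0$ as $t\to+\infty$; $U$ is invariant if $T(t)U=U$ for all $t\ge0$. A global attractor is a compact, invariant set $A\subset X$ attracting all bounded subsets of $X$. It is Lyapunov stable if for every $\varepsilon>0$ there is $\delta>0$ such that $e(E,A)\le\delta$ implies $e(T(t)E,A)\le\varepsilon$ for all $t\ge0$, for every $E\subset X$. *)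

theory Defs
  imports "HOL-Analysis.Analysis"
begin

section \<open>Convex analysis\<close>

definition eff_dom :: "('a \<Rightarrow> ereal) \<Rightarrow> 'a set" where
  "eff_dom f = {u. f u < \<infinity>}"

definition proper_fun :: "('a \<Rightarrow> ereal) \<Rightarrow> bool" where
  "proper_fun f \<longleftrightarrow> (\<forall>u. f u \<noteq> -\<infinity>) \<and> eff_dom f \<noteq> {}"

definition lower_semicont :: "('a::topological_space \<Rightarrow> ereal) \<Rightarrow> bool" where
  "lower_semicont f \<longleftrightarrow> (\<forall>u. f u \<le> Liminf (at u) f)"

text \<open>The weight is taken in the open interval, so that the convention
  \<open>0 * \<infinity> = 0\<close> of \<^typ>\<open>ereal\<close> plays no role.\<close>

definition convex_fun :: "('a::real_vector \<Rightarrow> ereal) \<Rightarrow> bool" where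
  "convex_fun f \<longleftrightarrow> (\<forall>u v s. 0 < s \<and> s < 1 \<longrightarrow>
     f ((1 - s) *\<^sub>R u + s *\<^sub>R v) \<le> ereal (1 - s) * f u + ereal s * f v)"

definition subdifferential :: "('a::real_inner \<Rightarrow> ereal) \<Rightarrow> 'a \<Rightarrow> 'a set" where
  "subdifferential f u =
     {\<xi>. u \<in> eff_dom f \<and> (\<forall>w. f u + ereal (\<xi> \<bullet> (w - u)) \<le> f w)}"

text \<open>On \<^term>\<open>eff_dom f\<close> a proper \<open>f\<close> is finite, so \<^const>\<open>real_of_ereal\<close> loses nothing there.\<close>

definition dom_dist :: "('a::real_normed_vector \<Rightarrow> ereal) \<Rightarrow> 'a \<Rightarrow> 'a \<Rightarrow> real" where
  "dom_dist f u v = norm (u - v) + \<bar>real_of_ereal (f u) - real_of_ereal (f v)\<bar>"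

section \<open>Bochner and Sobolev spaces on an interval\<close>

text \<open>In the separable Banach spaces considered here, strong and Borel measurability agree.\<close>

definition L2_on :: "real \<Rightarrow> (real \<Rightarrow> 'a::{banach, second_countable_topology}) set" where
  "L2_on T = {f. f \<in> borel_measurable (lebesgue_on {0<..<T}) \<and>
     integrable (lebesgue_on {0<..<T}) (\<lambda>t. (norm (f t))\<^sup>2)}"

text \<open>\<open>is_test_function T \<eta> \<eta>'\<close>: \<open>\<eta>\<close> is continuously differentiable with derivative \<open>\<eta>'\<close> and
  has compact support in the open interval from 0 to \<open>T\<close>. Once-differentiable test functions
  give the same weak derivatives as smooth ones.\<close>

definition is_test_function :: "real \<Rightarrow> (real \<Rightarrow> real) \<Rightarrow> (real \<Rightarrow> real) \<Rightarrow> bool" where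
  "is_test_function T \<eta> \<eta>' \<longleftrightarrow>
     (\<forall>t. (\<eta> has_real_derivative \<eta>' t) (at t)) \<and> continuous_on UNIV \<eta>' \<and>
     (\<exists>K. compact K \<and> K \<subseteq> {0<..<T} \<and> (\<forall>t. t \<notin> K \<longrightarrow> \<eta> t = 0))"

definition has_L2_weak_derivative ::
  "real \<Rightarrow> (real \<Rightarrow> 'a::{banach, second_countable_topology}) \<Rightarrow> (real \<Rightarrow> 'a) \<Rightarrow> bool" where
  "has_L2_weak_derivative T u u' \<longleftrightarrow> u' \<in> L2_on T \<and>
     (\<forall>\<eta> \<eta>'. is_test_function T \<eta> \<eta>' \<longrightarrow>
        (LINT t|lebesgue_on {0<..<T}. \<eta>' t *\<^sub>R u t) =
        - (LINT t|lebesgue_on {0<..<T}. \<eta> t *\<^sub>R u' t))"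

text \<open>Elements of \<open>H\<^sup>1(0,T)\<close> are identified with their representatives that are continuous on
  \<open>[0,T]\<close>; this is what gives a meaning to point values such as \<open>u(0)\<close>.\<close>

definition H1_on :: "real \<Rightarrow> (real \<Rightarrow> 'a::{banach, second_countable_topology}) set" where
  "H1_on T = {u. u \<in> L2_on T \<and> continuous_on {0..T} u \<and> (\<exists>u'. has_L2_weak_derivative T u u')}"

section \<open>Generalized semiflows and their attractors\<close>

text \<open>A map from \<open>[0,\<infinity>)\<close> to \<open>X\<close> is represented by an extensional function, that is one equal to
  \<^const>\<open>undefined\<close> at negative arguments, so that equality is equality of maps on \<open>[0,\<infinity>)\<close>.
  The fourth to seventh conjuncts are existence, translation, concatenation and compactness.\<close>

definition generalized_semiflow ::
  "'a set \<Rightarrow> ('a \<Rightarrow> 'a \<Rightarrow> real) \<Rightarrow> (real \<Rightarrow> 'a) set \<Rightarrow> bool" where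
  "generalized_semiflow X d G \<longleftrightarrow>
     Metric_space X d \<and>
     G \<subseteq> {0..} \<rightarrow>\<^sub>E X \<and>
     (\<forall>x\<in>X. \<exists>g\<in>G. g 0 = x) \<and>
     (\<forall>g\<in>G. \<forall>\<tau>\<ge>0. restrict (\<lambda>t. g (t + \<tau>)) {0..} \<in> G) \<and>
     (\<forall>g\<in>G. \<forall>h\<in>G. \<forall>t\<ge>0. h 0 = g t \<longrightarrow>
        restrict (\<lambda>\<tau>. if \<tau> \<le> t then g \<tau> else h (\<tau> - t)) {0..} \<in> G) \<and>
     (\<forall>gs x. (\<forall>n::nat. gs n \<in> G) \<and>
        limitin (Metric_space.mtopology X d) (\<lambda>n. gs n 0) x sequentially \<longrightarrow>
        (\<exists>r g. strict_mono r \<and> g \<in> G \<and> g 0 = x \<and>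
          (\<forall>t\<ge>0. limitin (Metric_space.mtopology X d) (\<lambda>k. gs (r k) t) (g t) sequentially)))"

definition flow_image :: "(real \<Rightarrow> 'a) set \<Rightarrow> real \<Rightarrow> 'a set \<Rightarrow> 'a set" where
  "flow_image G t E = {g t |g. g \<in> G \<and> g 0 \<in> E}"

definition excess :: "('a \<Rightarrow> 'a \<Rightarrow> real) \<Rightarrow> 'a set \<Rightarrow> 'a set \<Rightarrow> ennreal" where
  "excess d E B = (SUP a\<in>E. INF b\<in>B. ennreal (d a b))"

definition attracts ::
  "('a \<Rightarrow> 'a \<Rightarrow> real) \<Rightarrow> (real \<Rightarrow> 'a) set \<Rightarrow> 'a set \<Rightarrow> 'a set \<Rightarrow> bool" where
  "attracts d G U E \<longleftrightarrow> ((\<lambda>t. excess d (flow_image G t E) U) \<longlongrightarrow> 0) at_top"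

definition flow_invariant :: "(real \<Rightarrow> 'a) set \<Rightarrow> 'a set \<Rightarrow> bool" where
  "flow_invariant G U \<longleftrightarrow> (\<forall>t\<ge>0. flow_image G t U = U)"

definition global_attractor ::
  "'a set \<Rightarrow> ('a \<Rightarrow> 'a \<Rightarrow> real) \<Rightarrow> (real \<Rightarrow> 'a) set \<Rightarrow> 'a set \<Rightarrow> bool" where
  "global_attractor X d G A \<longleftrightarrow>
     A \<subseteq> X \<and> compactin (Metric_space.mtopology X d) A \<and> flow_invariant G A \<and>
     (\<forall>E. Metric_space.mbounded X d E \<longrightarrow> attracts d G A E)"

definition Lyapunov_stable ::
  "'a set \<Rightarrow> ('a \<Rightarrow> 'a \<Rightarrow> real) \<Rightarrow> (real \<Rightarrow> 'a) set \<Rightarrow> 'a set \<Rightarrow> bool" where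
  "Lyapunov_stable X d G A \<longleftrightarrow>
     (\<forall>\<epsilon>>0. \<exists>\<delta>>0. \<forall>E\<subseteq>X. excess d E A \<le> ennreal \<delta> \<longrightarrow>
        (\<forall>t\<ge>0. excess d (flow_image G t E) A \<le> ennreal \<epsilon>))"

section \<open>The gradient flow\<close>

text \<open>\<open>F\<close> is the gradient of the smooth part. That \<open>u\<close> stays in \<^term>\<open>eff_dom f\<close> at all times is
  not required here. The function \<open>u'\<close> is determined by \<open>u\<close> up to null sets.\<close>

definition gradient_flow_solutions ::
  "('a::{real_inner, banach, second_countable_topology} \<Rightarrow> ereal) \<Rightarrow> ('a \<Rightarrow> 'a) \<Rightarrow> (real \<Rightarrow> 'a) set" where
  "gradient_flow_solutions f F =
     {u \<in> extensional {0..}. (\<forall>T>0. u \<in> H1_on T) \<and> u 0 \<in> eff_dom f \<and>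
       (\<exists>u'. (\<forall>T>0. has_L2_weak_derivative T u u') \<and>
         (AE t in lebesgue_on {0<..}. \<exists>\<xi>\<in>subdifferential f (u t). u' t + \<xi> + F (u t) = 0))}"

end

theory Submission
  imports Defs
begin

text \<open>A curve is a solution if and only if it satisfies, for all \<open>w\<close> in the domain and all
  \<open>a \<le> b\<close>, the integrated evolution variational inequality (EVI)
  \<open>1/2 |u b - w|\<^sup>2 - 1/2 |u a - w|\<^sup>2 + \<integral> (\<phi>\<^sub>1(u) + \<langle>D\<phi>\<^sub>2(u), u - w\<rangle>) \<le> (b - a) \<phi>\<^sub>1(w)\<close>
  together with \<open>|u b - u a|\<^sup>2 \<le> 2 (b - a) (\<phi>(u a) - \<phi>(u b))\<close>. In this form the set of solutions is
  visibly closed under translation, concatenation and pointwise limits, and existence follows by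
  passing to the limit in the implicit Euler scheme. Since the energy decreases along solutions,
  convergence in \<open>\<H>\<close> upgrades to convergence of \<open>\<phi>\<^sub>1\<close> at positive times. Hence the time-one map
  sends sublevels of \<open>\<phi>\<close> to precompact sets, \<open>\<phi>\<close> is a Lyapunov function whose rest points are
  bounded, and the attractor is the intersection of the images of a large sublevel.\<close>

section \<open>Integrals over intervals\<close>

text \<open>The EVI contains point values and a lower semicontinuous integrand, but no derivative
  and no choice of a subgradient; this is what makes it stable under pointwise limits. The price is
  the way back: a limit curve is at first only 1/2-Hoelder, and its derivative in
  \<open>L2_on\<close> has to be produced. It arises as the almost everywhere limit of dyadic
  difference quotients, which form a martingale whose boundedness follows from the energy estimate.
  In place of a chain rule for \<open>\<phi>1\<close>, the EVI is tested with
  \<open>w = u a\<close>: its integrand is then an energy difference up to a Taylor remainder of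
  \<open>\<phi>2\<close>, and both monotonicity and the energy estimate come out of it. A second
  obstacle is time 0, where an energy bound on the initial values gives convergence in norm but not
  of \<open>\<phi>1\<close>. Hence there are two compactness statements: one at positive times under
  an energy bound, used to build the attractor, and one at all times under convergence of the
  initial values in the metric, used for the semiflow property and for stability.\<close>

lemma set_integrable_interval_subset:
  fixes g :: "real \<Rightarrow> 'b::{banach, second_countable_topology}"
  assumes "set_integrable lebesgue {a..b} g" "a \<le> s" "t \<le> b"
  shows "set_integrable lebesgue {s..t} g"
  by (rule set_integrable_subset[OF assms(1)]) (use assms in auto)

lemma set_integral_interval_combine:
  fixes g :: "real \<Rightarrow> 'b::{banach, second_countable_topology}"
  assumes g: "set_integrable lebesgue {a..c} g" and "a \<le> b" "b \<le> c"
  shows "(LINT x:{a..c}|lebesgue. g x) = (LINT x:{a..b}|lebesgue. g x) + (LINT x:{b..c}|lebesgue. g x)"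
proof -
  have "{a..c} = {a..b} \<union> {b..c}" using assms by auto
  moreover have "AE x in lebesgue. \<not> (x \<in> {a..b} \<and> x \<in> {b..c})"
    by (rule AE_I[where N="{b}"]) auto
  ultimately show ?thesis
    using set_integral_Un_AE[of "{a..b}" "{b..c}" lebesgue g]
      set_integrable_interval_subset[OF g] assms by auto
qed

lemma set_integrable_const_interval:
  "set_integrable lebesgue {a..b::real} (\<lambda>x. c :: 'b::{banach, second_countable_topology})"
  unfolding set_integrable_def by (rule integrable_scaleR_left) (auto simp: emeasure_lborel_Icc_eq)

lemma set_integral_const_interval:
  fixes c :: "'b::{banach, second_countable_topology}"
  assumes "a \<le> b"
  shows "(LINT x:{a..b::real}|lebesgue. c) = (b - a) *\<^sub>R c"
  using assms unfolding set_lebesgue_integral_def by simp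

lemma set_integrable_bounded_interval:
  fixes g :: "real \<Rightarrow> 'b::{banach, second_countable_topology}"
  assumes m: "set_borel_measurable lebesgue {a..b} g"
    and b: "AE x in lebesgue. x \<in> {a..b} \<longrightarrow> norm (g x) \<le> B"
  shows "set_integrable lebesgue {a..b} g"
  unfolding set_integrable_def
proof (rule Bochner_Integration.integrable_bound)
  show "integrable lebesgue (\<lambda>x. indicator {a..b} x *\<^sub>R B)"
    using set_integrable_const_interval[of a b B] by (simp add: set_integrable_def)
  show "(\<lambda>x. indicator {a..b} x *\<^sub>R g x) \<in> borel_measurable lebesgue"
    using m by (simp add: set_borel_measurable_def)
  show "AE x in lebesgue. norm (indicator {a..b} x *\<^sub>R g x) \<le> norm (indicator {a..b} x *\<^sub>R B)"
    using b by eventually_elim (auto split: split_indicator)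
qed

lemma set_borel_measurable_continuous_interval:
  fixes g :: "real \<Rightarrow> 'b::{banach, second_countable_topology}"
  assumes "continuous_on {a..b} g"
  shows "set_borel_measurable lebesgue {a..b} g"
proof -
  have "(\<lambda>x. indicator {a..b} x *\<^sub>R g x) \<in> borel_measurable borel"
    by (rule borel_measurable_continuous_on_indicator) (use assms in auto)
  then show ?thesis unfolding set_borel_measurable_def
    by (simp add: measurable_completion)
qed

lemma set_integrable_continuous_interval:
  fixes g :: "real \<Rightarrow> 'b::{banach, second_countable_topology}"
  assumes "continuous_on {a..b} g"
  shows "set_integrable lebesgue {a..b} g"
proof -
  have "bounded (g ` {a..b})" using assms compact_continuous_image compact_imp_bounded by blast
  then obtain B where "\<forall>x\<in>{a..b}. norm (g x) \<le> B" by (auto simp: bounded_iff)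
  then show ?thesis
    by (intro set_integrable_bounded_interval[OF set_borel_measurable_continuous_interval[OF assms], of B]) auto
qed

lemma set_integral_bound_interval:
  fixes g :: "real \<Rightarrow> 'b::{banach, second_countable_topology}"
  assumes g: "set_integrable lebesgue {a..b} g" and "set_integrable lebesgue {a..b} h"
    and le: "AE x\<in>{a..b} in lebesgue. norm (g x) \<le> h x"
  shows "norm (LINT x:{a..b}|lebesgue. g x) \<le> (LINT x:{a..b}|lebesgue. h x)"
proof -
  have "norm (LINT x:{a..b}|lebesgue. g x) \<le> (LINT x:{a..b}|lebesgue. norm (g x))"
    by (rule set_integral_norm_bound[OF g])
  also have "\<dots> \<le> (LINT x:{a..b}|lebesgue. h x)"
    by (rule set_integral_mono_AE) (use assms set_integrable_norm in auto)
  finally show ?thesis .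
qed

lemma set_integral_inner_left:
  fixes g :: "real \<Rightarrow> 'b::{real_inner, banach, second_countable_topology}"
  assumes "set_integrable lebesgue A g"
  shows "set_integrable lebesgue A (\<lambda>x. g x \<bullet> c)"
    "(LINT x:A|lebesgue. g x \<bullet> c) = (LINT x:A|lebesgue. g x) \<bullet> c"
  using integrable_inner_left[of c lebesgue "\<lambda>x. indicator A x *\<^sub>R g x"]
    integral_inner_left[of c lebesgue "\<lambda>x. indicator A x *\<^sub>R g x"] assms
  by (auto simp: set_integrable_def set_lebesgue_integral_def)

lemma set_borel_measurable_scaleR:
  fixes f :: "real \<Rightarrow> real" and g :: "real \<Rightarrow> 'b::{banach, second_countable_topology}"
  assumes "set_borel_measurable M A f" "set_borel_measurable M A g"
  shows "set_borel_measurable M A (\<lambda>x. f x *\<^sub>R g x)"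
proof -
  have "(\<lambda>x. (indicator A x *\<^sub>R f x) *\<^sub>R (indicator A x *\<^sub>R g x)) \<in> borel_measurable M"
    using assms unfolding set_borel_measurable_def by measurable
  then show ?thesis unfolding set_borel_measurable_def
    by (rule measurable_cong[THEN iffD1, rotated]) (auto split: split_indicator)
qed

lemma set_borel_measurable_inner:
  fixes f g :: "real \<Rightarrow> 'b::{real_inner, banach, second_countable_topology}"
  assumes "set_borel_measurable M A f" "set_borel_measurable M A g"
  shows "set_borel_measurable M A (\<lambda>x. f x \<bullet> g x)"
proof -
  have "(\<lambda>x. (indicator A x *\<^sub>R f x) \<bullet> (indicator A x *\<^sub>R g x)) \<in> borel_measurable M"
    using assms unfolding set_borel_measurable_def by measurable
  then show ?thesis unfolding set_borel_measurable_def
    by (rule measurable_cong[THEN iffD1, rotated]) (auto split: split_indicator)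
qed

lemma set_integrable_imp_measurable:
  "set_integrable M A g \<Longrightarrow> set_borel_measurable M A g"
  unfolding set_integrable_def set_borel_measurable_def by (rule borel_measurable_integrable)

lemma set_integrable_inner_continuous:
  fixes g h :: "real \<Rightarrow> 'b::{real_inner, banach, second_countable_topology}"
  assumes g: "set_integrable lebesgue {a..b} g" and h: "continuous_on {a..b} h"
  shows "set_integrable lebesgue {a..b} (\<lambda>x. g x \<bullet> h x)"
proof -
  have "bounded (h ` {a..b})" using h compact_continuous_image compact_imp_bounded by blast
  then obtain B where B: "\<And>x. x \<in> {a..b} \<Longrightarrow> norm (h x) \<le> B" unfolding bounded_iff by blast
  have "set_borel_measurable lebesgue {a..b} (\<lambda>x. g x \<bullet> h x)"
    by (intro set_borel_measurable_inner set_integrable_imp_measurable g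
        set_borel_measurable_continuous_interval h)
  moreover have bd: "integrable lebesgue (\<lambda>x. B * norm (indicator {a..b} x *\<^sub>R g x))"
    using g unfolding set_integrable_def by (intro integrable_mult_right integrable_norm)
  ultimately show ?thesis unfolding set_integrable_def set_borel_measurable_def
  proof (intro Bochner_Integration.integrable_bound[OF bd])
    show "AE x in lebesgue. norm (indicator {a..b} x *\<^sub>R (g x \<bullet> h x)) \<le> norm (B * norm (indicator {a..b} x *\<^sub>R g x))"
    proof (rule AE_I2)
      fix x
      have "x \<in> {a..b} \<Longrightarrow> \<bar>g x \<bullet> h x\<bar> \<le> \<bar>B\<bar> * norm (g x)"
        using Cauchy_Schwarz_ineq2[of "g x" "h x"] B[of x]
          mult_right_mono[of "norm (h x)" "\<bar>B\<bar>" "norm (g x)"]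
        by (smt (verit) mult.commute norm_ge_zero)
      then show "norm (indicator {a..b} x *\<^sub>R (g x \<bullet> h x)) \<le> norm (B * norm (indicator {a..b} x *\<^sub>R g x))"
        by (auto simp: abs_mult split: split_indicator)
    qed
  qed
qed

lemma set_integrable_scaleR_continuous:
  fixes g :: "real \<Rightarrow> 'b::{banach, second_countable_topology}"
  assumes g: "set_integrable lebesgue {a..b} g" and h: "continuous_on {a..b} h"
  shows "set_integrable lebesgue {a..b} (\<lambda>x. h x *\<^sub>R g x)"
proof -
  have "bounded (h ` {a..b})" using h compact_continuous_image compact_imp_bounded by blast
  then obtain B where B: "\<And>x. x \<in> {a..b} \<Longrightarrow> norm (h x) \<le> B" unfolding bounded_iff by blast
  have "set_borel_measurable lebesgue {a..b} (\<lambda>x. h x *\<^sub>R g x)"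
    by (intro set_borel_measurable_scaleR set_integrable_imp_measurable g
        set_borel_measurable_continuous_interval h)
  moreover have bd: "integrable lebesgue (\<lambda>x. B * norm (indicator {a..b} x *\<^sub>R g x))"
    using g unfolding set_integrable_def by (intro integrable_mult_right integrable_norm)
  ultimately show ?thesis unfolding set_integrable_def set_borel_measurable_def
  proof (intro Bochner_Integration.integrable_bound[OF bd])
    show "AE x in lebesgue. norm (indicator {a..b} x *\<^sub>R (h x *\<^sub>R g x)) \<le> norm (B * norm (indicator {a..b} x *\<^sub>R g x))"
    proof (rule AE_I2)
      fix x
      have "x \<in> {a..b} \<Longrightarrow> \<bar>h x\<bar> * norm (g x) \<le> \<bar>B\<bar> * norm (g x)"
        using B[of x] by (intro mult_right_mono) auto
      then show "norm (indicator {a..b} x *\<^sub>R (h x *\<^sub>R g x)) \<le> norm (B * norm (indicator {a..b} x *\<^sub>R g x))"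
        by (auto simp: abs_mult split: split_indicator)
    qed
  qed
qed

section \<open>Gluing local estimates; the chain rule for the squared distance\<close>

text \<open>Finitely many steps of length \<open>\<delta>/2\<close> lead from \<open>a\<close> to
  \<open>b\<close>, and transitivity of \<open>R\<close> composes them. \<open>R\<close> will be an
  estimate on increments, with \<open>\<delta>\<close> supplied by uniform continuity.\<close>

lemma interval_local_to_global:
  fixes a b :: real
  assumes "a \<le> b" "\<delta> > 0"
    and loc: "\<And>x y. a \<le> x \<Longrightarrow> x \<le> y \<Longrightarrow> y \<le> b \<Longrightarrow> y - x < \<delta> \<Longrightarrow> R x y"
    and trans: "\<And>x y z. a \<le> x \<Longrightarrow> x \<le> y \<Longrightarrow> y \<le> z \<Longrightarrow> z \<le> b \<Longrightarrow> R x y \<Longrightarrow> R y z \<Longrightarrow> R x z"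
  shows "R a b"
proof -
  have "\<forall>y. a \<le> y \<and> y \<le> b \<and> y - a \<le> real n * (\<delta>/2) \<longrightarrow> R a y" for n
  proof (induction n)
    case 0 then show ?case using loc[of a a] \<open>\<delta> > 0\<close> \<open>a \<le> b\<close> by auto
  next
    case (Suc n)
    show ?case
    proof (intro allI impI)
      fix y assume y: "a \<le> y \<and> y \<le> b \<and> y - a \<le> real (Suc n) * (\<delta>/2)"
      \<comment> \<open>One step back from \<open>y\<close>, cut off at \<open>a\<close>: the
        induction hypothesis applies up to \<open>m\<close>, locality from \<open>m\<close> to
        \<open>y\<close>.\<close>
      define m where "m = max a (y - \<delta>/2)"
      have m: "a \<le> m" "m \<le> y" "y - m < \<delta>" using y \<open>\<delta> > 0\<close> by (auto simp: m_def)
      have "m - a \<le> real n * (\<delta>/2)" using y \<open>\<delta> > 0\<close> by (auto simp: m_def algebra_simps max_def)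
      then have "R a m" using Suc m y by auto
      moreover have "R m y" using m y by (intro loc) auto
      ultimately show "R a y" using trans m y by blast
    qed
  qed
  moreover obtain n where "(b - a) / (\<delta>/2) < real n" using reals_Archimedean2 by blast
  then have "b - a \<le> real n * (\<delta>/2)" using \<open>\<delta> > 0\<close> by (simp add: field_simps)
  ultimately show ?thesis using \<open>a \<le> b\<close> by blast
qed

text \<open>The increments of \<open>M\<close> telescope, so the local errors add up to
  \<open>\<epsilon> * (M b - M a)\<close> with \<open>\<epsilon>\<close> arbitrary. Product and
  chain rules for indefinite integrals are derived this way from approximate identities on short
  intervals.\<close>

lemma constant_if_small_increments:
  fixes P :: "real \<Rightarrow> 'b::real_normed_vector"
  assumes "a \<le> b"
    and small: "\<And>\<epsilon>. \<epsilon> > 0 \<Longrightarrow> \<exists>\<delta>>0. \<forall>x y. a \<le> x \<and> x \<le> y \<and> y \<le> b \<and> y - x < \<delta> \<longrightarrow>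
        norm (P y - P x) \<le> \<epsilon> * (M y - M x)"
  shows "P a = P b"
proof -
  have *: "norm (P b - P a) \<le> \<epsilon> * (M b - M a)" if e: "\<epsilon> > 0" for \<epsilon>
  proof -
    obtain \<delta> where "\<delta> > 0" and
      \<delta>: "\<And>x y. a \<le> x \<and> x \<le> y \<and> y \<le> b \<and> y - x < \<delta> \<Longrightarrow> norm (P y - P x) \<le> \<epsilon> * (M y - M x)"
      using small[OF e] by metis
    show ?thesis
    proof (rule interval_local_to_global[OF \<open>a \<le> b\<close> \<open>\<delta> > 0\<close>, of "\<lambda>x y. norm (P y - P x) \<le> \<epsilon> * (M y - M x)"])
      fix x y z assume "norm (P y - P x) \<le> \<epsilon> * (M y - M x)" "norm (P z - P y) \<le> \<epsilon> * (M z - M y)"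
      then show "norm (P z - P x) \<le> \<epsilon> * (M z - M x)"
        using norm_triangle_ineq[of "P z - P y" "P y - P x"] by (simp add: algebra_simps)
    qed (use \<delta> in auto)
  qed
  have "norm (P b - P a) \<le> 0"
  proof (rule field_le_epsilon)
    fix e :: real assume "e > 0"
    \<comment> \<open>\<open>M\<close> need not be monotone, hence the absolute value; the added 1
      keeps the denominator positive.\<close>
    define \<epsilon> where "\<epsilon> = e / (\<bar>M b - M a\<bar> + 1)"
    have "\<epsilon> > 0" using \<open>e > 0\<close> by (simp add: \<epsilon>_def add_nonneg_pos)
    have "norm (P b - P a) \<le> \<epsilon> * (\<bar>M b - M a\<bar> + 1)"
      using *[OF \<open>\<epsilon> > 0\<close>] mult_left_mono[of "M b - M a" "\<bar>M b - M a\<bar> + 1" \<epsilon>] \<open>\<epsilon> > 0\<close> by linarith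
    also have "\<dots> = e" by (simp add: \<epsilon>_def add_nonneg_pos[THEN less_imp_neq, symmetric])
    finally show "norm (P b - P a) \<le> 0 + e" by simp
  qed
  then show ?thesis by simp
qed

text \<open>A representation as an indefinite integral is all that is ever used of weak derivatives.\<close>

definition has_integral_derivative ::
  "(real \<Rightarrow> 'b::{banach, second_countable_topology}) \<Rightarrow> (real \<Rightarrow> 'b) \<Rightarrow> real \<Rightarrow> bool" where
  "has_integral_derivative u g T \<longleftrightarrow> set_integrable lebesgue {0..T} g \<and>
     (\<forall>s t. 0 \<le> s \<longrightarrow> s \<le> t \<longrightarrow> t \<le> T \<longrightarrow> u t - u s = (LINT x:{s..t}|lebesgue. g x))"

lemma has_integral_derivative_norm_le:
  assumes "has_integral_derivative u g T" "0 \<le> s" "s \<le> t" "t \<le> T"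
  shows "norm (u t - u s) \<le> (LINT x:{s..t}|lebesgue. norm (g x))"
  using assms set_integral_norm_bound[of lebesgue "{s..t}" g]
    set_integrable_interval_subset[of 0 T g s t]
  by (auto simp: has_integral_derivative_def)

text \<open>On a short interval the increment of half the squared distance is exactly the increment
  of \<open>u\<close> paired with the midpoint value \<open>c\<close>. Replacing \<open>c\<close> by
  \<open>u r - w\<close> under the integral costs at most \<open>\<epsilon>\<close> times the
  integral of \<open>norm (g r)\<close>, because \<open>u\<close> is uniformly continuous.\<close>

lemma half_norm_sq_integral:
  fixes u :: "real \<Rightarrow> 'b::{real_inner, banach, second_countable_topology}"
  assumes d: "has_integral_derivative u g T" and cont: "continuous_on {0..T} u"
    and ab: "0 \<le> a" "a \<le> b" "b \<le> T"
  shows "(norm (u b - w))\<^sup>2 / 2 - (norm (u a - w))\<^sup>2 / 2 = (LINT x:{a..b}|lebesgue. g x \<bullet> (u x - w))"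
proof -
  have gi: "set_integrable lebesgue {s..t} g" if "0 \<le> s" "t \<le> T" for s t
    using d that set_integrable_interval_subset by (auto simp: has_integral_derivative_def)
  have ii: "set_integrable lebesgue {s..t} (\<lambda>x. g x \<bullet> (u x - w))" if "0 \<le> s" "t \<le> T" for s t
    using that by (intro set_integrable_inner_continuous gi continuous_intros continuous_on_subset[OF cont]) auto
  define M where "M t = (LINT x:{a..t}|lebesgue. norm (g x))" for t
  define P where "P t = (norm (u t - w))\<^sup>2 / 2 - (LINT x:{a..t}|lebesgue. g x \<bullet> (u x - w))" for t
  have "P a = P b"
  proof (rule constant_if_small_increments[OF ab(2), of _ M])
    fix \<epsilon> :: real assume "\<epsilon> > 0"
    have "uniformly_continuous_on {0..T} u" using cont compact_uniformly_continuous by blast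
    then obtain \<delta> where "\<delta> > 0" and
      \<delta>: "\<And>x y. x \<in> {0..T} \<Longrightarrow> y \<in> {0..T} \<Longrightarrow> dist x y < \<delta> \<Longrightarrow> dist (u x) (u y) < \<epsilon>"
      using \<open>\<epsilon> > 0\<close> unfolding uniformly_continuous_on_def by metis
    show "\<exists>\<delta>>0. \<forall>x y. a \<le> x \<and> x \<le> y \<and> y \<le> b \<and> y - x < \<delta> \<longrightarrow> norm (P y - P x) \<le> \<epsilon> * (M y - M x)"
    proof (intro exI[of _ \<delta>] conjI allI impI \<open>\<delta> > 0\<close>)
      fix x y assume xy: "a \<le> x \<and> x \<le> y \<and> y \<le> b \<and> y - x < \<delta>"
      define c where "c = (1/2) *\<^sub>R (u y + u x) - w"
      have A: "(norm (u y - w))\<^sup>2 / 2 - (norm (u x - w))\<^sup>2 / 2 = (u y - u x) \<bullet> c"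
        unfolding power2_norm_eq_inner c_def by (simp add: algebra_simps inner_commute diff_divide_distrib add_divide_distrib)
      also have "\<dots> = (LINT r:{x..y}|lebesgue. g r \<bullet> c)"
        using d xy ab set_integral_inner_left(2)[OF gi[of x y], of c] by (auto simp: has_integral_derivative_def)
      finally have "P y - P x = (LINT r:{x..y}|lebesgue. g r \<bullet> c) - (LINT r:{x..y}|lebesgue. g r \<bullet> (u r - w))"
        unfolding P_def using set_integral_interval_combine[OF ii[of a y], of x] xy ab by simp
      also have "\<dots> = (LINT r:{x..y}|lebesgue. g r \<bullet> c - g r \<bullet> (u r - w))"
        using xy ab by (intro set_integral_diff(2)[symmetric] set_integral_inner_left gi ii) auto
      also have "norm \<dots> \<le> (LINT r:{x..y}|lebesgue. \<epsilon> * norm (g r))"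
      proof (rule set_integral_bound_interval)
        show "set_integrable lebesgue {x..y} (\<lambda>r. g r \<bullet> c - g r \<bullet> (u r - w))"
          using xy ab by (intro set_integral_diff(1) set_integral_inner_left gi ii) auto
        show "set_integrable lebesgue {x..y} (\<lambda>r. \<epsilon> * norm (g r))"
          using xy ab by (intro set_integrable_mult_right set_integrable_norm gi) auto
        show "AE r\<in>{x..y} in lebesgue. norm (g r \<bullet> c - g r \<bullet> (u r - w)) \<le> \<epsilon> * norm (g r)"
        proof (intro AE_I2 impI)
          fix r assume r: "r \<in> {x..y}"
          have "dist (u y) (u r) < \<epsilon>" "dist (u x) (u r) < \<epsilon>"
            using r xy ab by (auto intro!: \<delta> simp: dist_real_def)
          then have "norm (u y - u r) < \<epsilon>" "norm (u x - u r) < \<epsilon>" by (auto simp: dist_norm)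
          moreover have "c - (u r - w) = (1/2) *\<^sub>R ((u y - u r) + (u x - u r))"
            unfolding c_def by (simp add: algebra_simps flip: scaleR_2 scaleR_left_distrib)
          then have "norm (c - (u r - w)) = norm ((u y - u r) + (u x - u r)) / 2" by simp
          ultimately have "norm (c - (u r - w)) \<le> \<epsilon>"
            using norm_triangle_ineq[of "u y - u r" "u x - u r"] by simp
          moreover have "g r \<bullet> c - g r \<bullet> (u r - w) = g r \<bullet> (c - (u r - w))" by (simp add: inner_diff_right)
          ultimately show "norm (g r \<bullet> c - g r \<bullet> (u r - w)) \<le> \<epsilon> * norm (g r)"
            using Cauchy_Schwarz_ineq2[of "g r" "c - (u r - w)"]
              mult_right_mono[of "norm (c - (u r - w))" \<epsilon> "norm (g r)"] by (simp add: mult.commute)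
        qed
      qed
      also have "\<dots> = \<epsilon> * (M y - M x)"
        unfolding M_def using set_integral_interval_combine[of a y "\<lambda>x. norm (g x)" x] gi[of a y] xy ab
        by (simp add: set_integrable_norm)
      finally show "norm (P y - P x) \<le> \<epsilon> * (M y - M x)" .
    qed
  qed
  moreover have "(LINT x:{a..a}|lebesgue. g x \<bullet> (u x - w)) = 0"
    using set_integral_interval_combine[OF ii[of a a], of a] ab by simp
  ultimately show ?thesis unfolding P_def by (simp add: field_simps)
qed

section \<open>Weak derivatives and indefinite integrals\<close>

lemma set_integrable_open_closed:
  fixes g :: "real \<Rightarrow> 'b::{banach, second_countable_topology}"
  shows "set_integrable lebesgue {a<..<b} g \<longleftrightarrow> set_integrable lebesgue {a..b} g"
    and "(LINT x:{a<..<b}|lebesgue. g x) = (LINT x:{a..b}|lebesgue. g x)"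
  by (rule set_integrable_discrete_difference[where X="{a,b}"]
      set_integral_discrete_difference[where X="{a,b}"]; auto)+

lemma integrable_lebesgue_on_open:
  fixes g :: "real \<Rightarrow> 'b::{banach, second_countable_topology}"
  shows "integrable (lebesgue_on {0<..<T}) g \<longleftrightarrow> set_integrable lebesgue {0..T} g"
    and "(LINT x|lebesgue_on {0<..<T}. g x) = (LINT x:{0..T}|lebesgue. g x)"
  using set_integrable_open_closed[of 0 T g]
  by (simp_all add: integrable_restrict_space integral_restrict_space set_integrable_def set_lebesgue_integral_def)

lemma measurable_lebesgue_on_open:
  fixes g :: "real \<Rightarrow> 'b::{banach, second_countable_topology}"
  shows "g \<in> borel_measurable (lebesgue_on {0<..<T}) \<longleftrightarrow> set_borel_measurable lebesgue {0..T} g"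
proof -
  have "g \<in> borel_measurable (lebesgue_on {0<..<T}) \<longleftrightarrow> (\<lambda>x. indicator {0<..<T} x *\<^sub>R g x) \<in> borel_measurable lebesgue"
    by (simp add: borel_measurable_restrict_space_iff)
  also have "\<dots> \<longleftrightarrow> (\<lambda>x. indicator {0..T} x *\<^sub>R g x) \<in> borel_measurable lebesgue"
    by (rule iffI; erule measurable_discrete_difference[where X="{0,T}"]; auto split: split_indicator)
  finally show ?thesis by (simp add: set_borel_measurable_def)
qed

lemma L2_on_iff:
  "f \<in> L2_on T \<longleftrightarrow> set_borel_measurable lebesgue {0..T} f \<and> set_integrable lebesgue {0..T} (\<lambda>t. (norm (f t))\<^sup>2)"
  by (simp add: L2_on_def measurable_lebesgue_on_open integrable_lebesgue_on_open)

lemma set_integrable_bound: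
  fixes f :: "real \<Rightarrow> 'b::{banach, second_countable_topology}" and h :: "real \<Rightarrow> real"
  assumes f: "set_borel_measurable lebesgue A f" and h: "set_integrable lebesgue A h"
    and "AE x\<in>A in lebesgue. norm (f x) \<le> h x"
  shows "set_integrable lebesgue A f"
  unfolding set_integrable_def
proof (rule Bochner_Integration.integrable_bound)
  show "integrable lebesgue (\<lambda>x. indicator A x *\<^sub>R h x)" using h by (simp add: set_integrable_def)
  show "(\<lambda>x. indicator A x *\<^sub>R f x) \<in> borel_measurable lebesgue"
    using f by (simp add: set_borel_measurable_def)
  show "AE x in lebesgue. norm (indicator A x *\<^sub>R f x) \<le> norm (indicator A x *\<^sub>R h x)"
    using assms(3) by eventually_elim (auto split: split_indicator)
qed

lemma L2_on_integrable:
  assumes "f \<in> L2_on T"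
  shows "set_integrable lebesgue {0..T} f"
proof (rule set_integrable_bound)
  show "set_integrable lebesgue {0..T} (\<lambda>t. 1 + (norm (f t))\<^sup>2)"
    using assms by (intro set_integral_add set_integrable_const_interval) (simp add: L2_on_iff)
  have "x \<le> 1 + x\<^sup>2" for x :: real
    using sum_power2_ge_zero[of "x - 1" x] zero_le_power2[of x] by (simp add: power2_eq_square algebra_simps)
  then show "AE x\<in>{0..T} in lebesgue. norm (f x) \<le> 1 + (norm (f x))\<^sup>2" by simp
qed (use assms in \<open>simp add: L2_on_iff\<close>)

text \<open>Cauchy-Schwarz in time, written as the nonnegativity of the variance of
  \<open>norm (g x)\<close> about its mean \<open>m\<close> over \<open>[s, t]\<close>.\<close>

lemma interval_norm_sq_le:
  assumes d: "has_integral_derivative u g T" and g: "g \<in> L2_on T" and st: "0 \<le> s" "s \<le> t" "t \<le> T"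
  shows "(norm (u t - u s))\<^sup>2 \<le> (t - s) * (LINT x:{s..t}|lebesgue. (norm (g x))\<^sup>2)"
proof (cases "s = t")
  case False
  define m where "m = (LINT x:{s..t}|lebesgue. norm (g x)) / (t - s)"
  define Q where "Q = (LINT x:{s..t}|lebesgue. (norm (g x))\<^sup>2)"
  have i1: "set_integrable lebesgue {s..t} (\<lambda>x. norm (g x))"
    using d st set_integrable_interval_subset by (intro set_integrable_norm) (auto simp: has_integral_derivative_def)
  have i2: "set_integrable lebesgue {s..t} (\<lambda>x. (norm (g x))\<^sup>2)"
    using g st by (auto simp: L2_on_iff intro: set_integrable_interval_subset[where a=0 and b=T])
  have "0 \<le> (LINT x:{s..t}|lebesgue. (norm (g x) - m)\<^sup>2)"
    unfolding set_lebesgue_integral_def by (rule integral_nonneg_AE) simp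
  also have "\<dots> = (LINT x:{s..t}|lebesgue. (norm (g x))\<^sup>2 - (2 * m) * norm (g x) + m\<^sup>2)"
    by (simp add: power2_eq_square algebra_simps)
  also have "\<dots> = Q - 2 * m * ((t - s) * m) + (t - s) * m\<^sup>2"
  proof -
    have "(LINT x:{s..t}|lebesgue. norm (g x)) = (t - s) * m" using st False by (simp add: m_def)
    moreover have "(LINT x:{s..t}|lebesgue. (norm (g x))\<^sup>2 - (2 * m) * norm (g x) + m\<^sup>2)
      = (LINT x:{s..t}|lebesgue. (norm (g x))\<^sup>2 - (2 * m) * norm (g x)) + (LINT x:{s..t}|lebesgue. m\<^sup>2)"
      by (intro set_integral_add(2) set_integral_diff(1) set_integrable_mult_right set_integrable_const_interval i1 i2)
    moreover have "(LINT x:{s..t}|lebesgue. (norm (g x))\<^sup>2 - (2 * m) * norm (g x))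
      = Q - (LINT x:{s..t}|lebesgue. (2 * m) * norm (g x))" unfolding Q_def
      by (intro set_integral_diff(2) set_integrable_mult_right i1 i2)
    moreover have "(LINT x:{s..t}|lebesgue. m\<^sup>2) = (t - s) * m\<^sup>2" using set_integral_const_interval[OF st(2), of "m\<^sup>2"] by simp
    ultimately show ?thesis by simp
  qed
  also have "\<dots> = Q - (t - s) * m\<^sup>2" by (simp add: power2_eq_square algebra_simps)
  finally have "(t - s) * ((t - s) * m\<^sup>2) \<le> (t - s) * Q" using st by (intro mult_left_mono) auto
  moreover have "norm (u t - u s) \<le> (t - s) * m"
    using has_integral_derivative_norm_le[OF d st] st False by (simp add: m_def)
  then have "(norm (u t - u s))\<^sup>2 \<le> ((t - s) * m)\<^sup>2" by (intro power_mono) auto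
  ultimately show ?thesis unfolding Q_def by (simp add: power2_eq_square algebra_simps)
qed (simp add: set_lebesgue_integral_def)

text \<open>Dominated convergence: off the point \<open>t\<close> the indicators vanish eventually.
  Both orientations are stated since \<open>X n\<close> may lie on either side of \<open>t\<close>;
  on the wrong side the interval is empty.\<close>

lemma set_integral_interval_tendsto_0:
  fixes g :: "real \<Rightarrow> 'b::{banach, second_countable_topology}"
  assumes g: "set_integrable lebesgue {a..b} g" and X: "\<And>n. X n \<in> {a..b}" "X \<longlonglongrightarrow> t" "t \<in> {a..b}"
  shows "(\<lambda>n. (LINT x:{X n..t}|lebesgue. g x)) \<longlonglongrightarrow> 0" "(\<lambda>n. (LINT x:{t..X n}|lebesgue. g x)) \<longlonglongrightarrow> 0"
proof -
  have gm: "(\<lambda>x. indicator {a..b} x *\<^sub>R g x) \<in> borel_measurable lebesgue"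
    using set_integrable_imp_measurable[OF g] by (simp add: set_borel_measurable_def)
  have m: "(\<lambda>x. indicator {s..r} x *\<^sub>R g x) \<in> borel_measurable lebesgue" if "s \<in> {a..b}" "r \<in> {a..b}" for s r
  proof -
    have "(\<lambda>x. indicator {s..r} x *\<^sub>R (indicator {a..b} x *\<^sub>R g x)) \<in> borel_measurable lebesgue"
      by (intro borel_measurable_scaleR borel_measurable_indicator gm) simp
    then show ?thesis
      by (rule measurable_cong[THEN iffD1, rotated]) (use that in \<open>auto split: split_indicator\<close>)
  qed
  have w: "integrable lebesgue (\<lambda>x. norm (indicator {a..b} x *\<^sub>R g x))"
    using g unfolding set_integrable_def by (rule integrable_norm)
  have "(\<lambda>n. integral\<^sup>L lebesgue (\<lambda>x. indicator {X n..t} x *\<^sub>R g x)) \<longlonglongrightarrow> integral\<^sup>L lebesgue (\<lambda>x::real. 0 :: 'b)"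
  proof (rule integral_dominated_convergence[where w="\<lambda>x. norm (indicator {a..b} x *\<^sub>R g x)"])
    show "integrable lebesgue (\<lambda>x. norm (indicator {a..b} x *\<^sub>R g x))" by (rule w)
    show "AE x in lebesgue. (\<lambda>n. indicator {X n..t} x *\<^sub>R g x) \<longlonglongrightarrow> 0"
    proof (rule AE_I[where N="{t}"], rule subsetI, rule ccontr)
      fix x assume *: "x \<in> {x \<in> space lebesgue. \<not> (\<lambda>n. indicator {X n..t} x *\<^sub>R g x) \<longlonglongrightarrow> 0}" "x \<notin> {t}"
      have "eventually (\<lambda>n. indicator {X n..t} x *\<^sub>R g x = 0) sequentially"
      proof (cases "x < t")
        case True
        then have "eventually (\<lambda>n. X n > x) sequentially" using X order_tendstoD by blast
        then show ?thesis by eventually_elim auto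
      qed (use * in auto)
      from tendsto_eventually[OF this] show False using * by simp
    qed auto
    show "(\<lambda>x. indicator {X n..t} x *\<^sub>R g x) \<in> borel_measurable lebesgue" for n
      by (rule m) (rule X)+
    show "AE x in lebesgue. norm (indicator {X n..t} x *\<^sub>R g x) \<le> norm (indicator {a..b} x *\<^sub>R g x)" for n
      using X(1)[of n] X(3) by (intro AE_I2) (auto split: split_indicator)
  qed simp
  then show "(\<lambda>n. (LINT x:{X n..t}|lebesgue. g x)) \<longlonglongrightarrow> 0" by (simp add: set_lebesgue_integral_def)
  have "(\<lambda>n. integral\<^sup>L lebesgue (\<lambda>x. indicator {t..X n} x *\<^sub>R g x)) \<longlonglongrightarrow> integral\<^sup>L lebesgue (\<lambda>x::real. 0 :: 'b)"
  proof (rule integral_dominated_convergence[where w="\<lambda>x. norm (indicator {a..b} x *\<^sub>R g x)"])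
    show "integrable lebesgue (\<lambda>x. norm (indicator {a..b} x *\<^sub>R g x))" by (rule w)
    show "AE x in lebesgue. (\<lambda>n. indicator {t..X n} x *\<^sub>R g x) \<longlonglongrightarrow> 0"
    proof (rule AE_I[where N="{t}"], rule subsetI, rule ccontr)
      fix x assume *: "x \<in> {x \<in> space lebesgue. \<not> (\<lambda>n. indicator {t..X n} x *\<^sub>R g x) \<longlonglongrightarrow> 0}" "x \<notin> {t}"
      have "eventually (\<lambda>n. indicator {t..X n} x *\<^sub>R g x = 0) sequentially"
      proof (cases "x > t")
        case True
        then have "eventually (\<lambda>n. X n < x) sequentially" using X order_tendstoD by blast
        then show ?thesis by eventually_elim auto
      qed (use * in auto)
      from tendsto_eventually[OF this] show False using * by simp
    qed auto
    show "(\<lambda>x. indicator {t..X n} x *\<^sub>R g x) \<in> borel_measurable lebesgue" for n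
      by (rule m) (rule X)+
    show "AE x in lebesgue. norm (indicator {t..X n} x *\<^sub>R g x) \<le> norm (indicator {a..b} x *\<^sub>R g x)" for n
      using X(1)[of n] X(3) by (intro AE_I2) (auto split: split_indicator)
  qed simp
  then show "(\<lambda>n. (LINT x:{t..X n}|lebesgue. g x)) \<longlonglongrightarrow> 0" by (simp add: set_lebesgue_integral_def)
qed

section \<open>Integration by parts, and the passage from increments to weak derivatives\<close>

text \<open>Again by small increments: in the discrete product rule \<open>\<eta>\<close> is frozen
  at the right end and \<open>u\<close> at the left end of a short interval, and the two errors are
  dominated by \<open>\<epsilon>\<close> times the integrals of \<open>norm (g r)\<close> and of
  \<open>\<bar>\<eta>' r\<bar>\<close>.\<close>

lemma integration_by_parts_scaleR:
  fixes u :: "real \<Rightarrow> 'b::{banach, second_countable_topology}" and \<eta> :: "real \<Rightarrow> real"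
  assumes d: "has_integral_derivative u g T" and cont: "continuous_on {0..T} u" and T: "0 \<le> T"
    and e: "\<And>t. (\<eta> has_real_derivative \<eta>' t) (at t)" and e': "continuous_on UNIV \<eta>'"
  shows "\<eta> T *\<^sub>R u T - \<eta> 0 *\<^sub>R u 0 = (LINT x:{0..T}|lebesgue. \<eta>' x *\<^sub>R u x) + (LINT x:{0..T}|lebesgue. \<eta> x *\<^sub>R g x)"
proof -
  have ce: "continuous_on S \<eta>" for S
    using e by (meson DERIV_isCont continuous_at_imp_continuous_on)
  have ce': "continuous_on S \<eta>'" for S using e' continuous_on_subset by blast
  have gi: "set_integrable lebesgue {s..t} g" if "0 \<le> s" "t \<le> T" for s t
    using d that set_integrable_interval_subset by (auto simp: has_integral_derivative_def)
  have i1: "set_integrable lebesgue {s..t} (\<lambda>x. \<eta>' x *\<^sub>R u x)" if "0 \<le> s" "t \<le> T" for s t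
    using that by (intro set_integrable_continuous_interval continuous_intros ce' continuous_on_subset[OF cont]) auto
  have i2: "set_integrable lebesgue {s..t} (\<lambda>x. \<eta> x *\<^sub>R g x)" if "0 \<le> s" "t \<le> T" for s t
    using that by (intro set_integrable_scaleR_continuous gi ce) auto
  have ftc: "\<eta> y - \<eta> x = (LINT r:{x..y}|lebesgue. \<eta>' r)" if "x \<le> y" for x y
  proof -
    have "(\<eta>' has_integral \<eta> y - \<eta> x) {x..y}"
      using that e by (intro fundamental_theorem_of_calculus)
        (auto simp: has_real_derivative_iff_has_vector_derivative[symmetric] intro: has_field_derivative_at_within)
    then show ?thesis using set_lebesgue_integral_eq_integral(2)[OF set_integrable_continuous_interval[OF ce']]
      by (metis integral_unique)
  qed
  define w where "w r = norm (g r) + \<bar>\<eta>' r\<bar>" for r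
  have wi: "set_integrable lebesgue {s..t} w" if "0 \<le> s" "t \<le> T" for s t unfolding w_def
    using that by (intro set_integral_add set_integrable_norm gi set_integrable_continuous_interval continuous_intros ce') auto
  define M where "M t = (LINT x:{0..t}|lebesgue. w x)" for t
  define P where "P t = \<eta> t *\<^sub>R u t - (LINT x:{0..t}|lebesgue. \<eta>' x *\<^sub>R u x) - (LINT x:{0..t}|lebesgue. \<eta> x *\<^sub>R g x)" for t
  have "P 0 = P T"
  proof (rule constant_if_small_increments[OF T, of _ M])
    fix \<epsilon> :: real assume "\<epsilon> > 0"
    have "uniformly_continuous_on {0..T} u" using cont compact_uniformly_continuous by blast
    then obtain \<delta>1 where "\<delta>1 > 0" and
      \<delta>1: "\<And>x y. x \<in> {0..T} \<Longrightarrow> y \<in> {0..T} \<Longrightarrow> dist x y < \<delta>1 \<Longrightarrow> dist (u x) (u y) < \<epsilon>"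
      using \<open>\<epsilon> > 0\<close> unfolding uniformly_continuous_on_def by metis
    have "uniformly_continuous_on {0..T} \<eta>" using ce compact_uniformly_continuous by blast
    then obtain \<delta>2 where "\<delta>2 > 0" and
      \<delta>2: "\<And>x y. x \<in> {0..T} \<Longrightarrow> y \<in> {0..T} \<Longrightarrow> dist x y < \<delta>2 \<Longrightarrow> dist (\<eta> x) (\<eta> y) < \<epsilon>"
      using \<open>\<epsilon> > 0\<close> unfolding uniformly_continuous_on_def by metis
    show "\<exists>\<delta>>0. \<forall>x y. 0 \<le> x \<and> x \<le> y \<and> y \<le> T \<and> y - x < \<delta> \<longrightarrow> norm (P y - P x) \<le> \<epsilon> * (M y - M x)"
    proof (intro exI[of _ "min \<delta>1 \<delta>2"] conjI allI impI)
      fix x y assume xy: "0 \<le> x \<and> x \<le> y \<and> y \<le> T \<and> y - x < min \<delta>1 \<delta>2"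
      have gxy: "set_integrable lebesgue {x..y} g" using gi xy by auto
      have sm: "set_integrable lebesgue {x..y} (\<lambda>r. \<eta> y *\<^sub>R g r)" "set_integrable lebesgue {x..y} (\<lambda>r. \<eta>' r *\<^sub>R u x)"
        by (intro set_integrable_scaleR_continuous gxy continuous_intros, intro set_integrable_continuous_interval continuous_intros ce')
      have "\<eta> y *\<^sub>R u y - \<eta> x *\<^sub>R u x = \<eta> y *\<^sub>R (u y - u x) + (\<eta> y - \<eta> x) *\<^sub>R u x" by (simp add: algebra_simps)
      also have "\<eta> y *\<^sub>R (u y - u x) = (LINT r:{x..y}|lebesgue. \<eta> y *\<^sub>R g r)"
        using d xy by (simp add: has_integral_derivative_def)
      also have "(\<eta> y - \<eta> x) *\<^sub>R u x = (LINT r:{x..y}|lebesgue. \<eta>' r *\<^sub>R u x)"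
        using ftc[of x y] xy set_integrable_continuous_interval[OF ce', of x y]
        by (simp add: set_lebesgue_integral_def set_integrable_def flip: integral_scaleR_left)
      finally have "P y - P x = ((LINT r:{x..y}|lebesgue. \<eta> y *\<^sub>R g r) - (LINT x:{x..y}|lebesgue. \<eta> x *\<^sub>R g x))
          + ((LINT r:{x..y}|lebesgue. \<eta>' r *\<^sub>R u x) - (LINT x:{x..y}|lebesgue. \<eta>' x *\<^sub>R u x))"
        unfolding P_def using set_integral_interval_combine[OF i1[of 0 y], of x]
          set_integral_interval_combine[OF i2[of 0 y], of x] xy by (simp add: algebra_simps)
      also have "\<dots> = (LINT r:{x..y}|lebesgue. (\<eta> y *\<^sub>R g r - \<eta> r *\<^sub>R g r) + (\<eta>' r *\<^sub>R u x - \<eta>' r *\<^sub>R u r))"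
        using xy sm i1 i2 by (simp add: set_integral_add(2) set_integral_diff)
      also have "norm \<dots> \<le> (LINT r:{x..y}|lebesgue. \<epsilon> * w r)"
      proof (rule set_integral_bound_interval)
        show "set_integrable lebesgue {x..y} (\<lambda>r. (\<eta> y *\<^sub>R g r - \<eta> r *\<^sub>R g r) + (\<eta>' r *\<^sub>R u x - \<eta>' r *\<^sub>R u r))"
          using xy sm by (intro set_integral_diff(1) set_integral_add(1) i1 i2) auto
        show "set_integrable lebesgue {x..y} (\<lambda>r. \<epsilon> * w r)"
          using xy by (intro set_integrable_mult_right wi) auto
        show "AE r\<in>{x..y} in lebesgue. norm ((\<eta> y *\<^sub>R g r - \<eta> r *\<^sub>R g r) + (\<eta>' r *\<^sub>R u x - \<eta>' r *\<^sub>R u r)) \<le> \<epsilon> * w r"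
        proof (intro AE_I2 impI)
          fix r assume r: "r \<in> {x..y}"
          have "dist (\<eta> y) (\<eta> r) < \<epsilon>" using r xy by (intro \<delta>2) (auto simp: dist_real_def)
          moreover have "dist (u x) (u r) < \<epsilon>" using r xy by (intro \<delta>1) (auto simp: dist_real_def)
          ultimately have "\<bar>\<eta> y - \<eta> r\<bar> \<le> \<epsilon>" "norm (u x - u r) \<le> \<epsilon>" by (auto simp: dist_norm)
          then have "norm ((\<eta> y - \<eta> r) *\<^sub>R g r) \<le> \<epsilon> * norm (g r)" "norm (\<eta>' r *\<^sub>R (u x - u r)) \<le> \<epsilon> * \<bar>\<eta>' r\<bar>"
            by (auto intro: mult_right_mono mult_left_mono simp: mult.commute[of _ "\<bar>\<eta>' r\<bar>"] mult.commute[of "norm _" \<epsilon>])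
          then show "norm ((\<eta> y *\<^sub>R g r - \<eta> r *\<^sub>R g r) + (\<eta>' r *\<^sub>R u x - \<eta>' r *\<^sub>R u r)) \<le> \<epsilon> * w r"
            unfolding w_def using norm_triangle_ineq[of "(\<eta> y - \<eta> r) *\<^sub>R g r" "\<eta>' r *\<^sub>R (u x - u r)"]
            by (simp add: algebra_simps)
        qed
      qed
      also have "\<dots> = \<epsilon> * (M y - M x)"
        unfolding M_def using set_integral_interval_combine[OF wi[of 0 y], of x] xy by simp
      finally show "norm (P y - P x) \<le> \<epsilon> * (M y - M x)" .
    qed (use \<open>\<delta>1 > 0\<close> \<open>\<delta>2 > 0\<close> in auto)
  qed
  moreover have "(LINT x:{0..0}|lebesgue. \<eta>' x *\<^sub>R u x) = 0" "(LINT x:{0..0}|lebesgue. \<eta> x *\<^sub>R g x) = 0"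
    using set_integral_interval_combine[OF i1[of 0 0], of 0] set_integral_interval_combine[OF i2[of 0 0], of 0] T by auto
  ultimately show ?thesis unfolding P_def by simp
qed

lemma has_integral_derivative_imp_weak:
  assumes "has_integral_derivative u g T" "continuous_on {0..T} u" "0 \<le> T" "g \<in> L2_on T"
  shows "has_L2_weak_derivative T u g"
  unfolding has_L2_weak_derivative_def
proof (intro conjI allI impI)
  fix \<eta> \<eta>' assume "is_test_function T \<eta> \<eta>'"
  then have e: "\<And>t. (\<eta> has_real_derivative \<eta>' t) (at t)" "continuous_on UNIV \<eta>'" "\<eta> 0 = 0" "\<eta> T = 0"
    unfolding is_test_function_def by (auto simp: subset_iff)
  show "(LINT t|lebesgue_on {0<..<T}. \<eta>' t *\<^sub>R u t) = - (LINT t|lebesgue_on {0<..<T}. \<eta> t *\<^sub>R g t)"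
    using integration_by_parts_scaleR[OF assms(1-3) e(1,2)] e(3,4)
    by (simp add: integrable_lebesgue_on_open eq_neg_iff_add_eq_0)
qed (rule assms)


text \<open>The test functions are trapezoids with corners rounded by this quadratic spline step.\<close>

definition smooth_step :: "real \<Rightarrow> real" where
  "smooth_step x = 2 * ((max 0 x)\<^sup>2 - 2 * (max 0 (x - 1/2))\<^sup>2 + (max 0 (x - 1))\<^sup>2)"

text \<open>The derivative of \<open>smooth_step\<close>: a hat on \<open>[0, 1]\<close> of height 2
  and hence of mass one. Rescaled to \<open>[s, s + h]\<close>, it averages over a short interval to
  the right of \<open>s\<close>.\<close>

definition tent :: "real \<Rightarrow> real" where
  "tent x = 4 * (max 0 x - 2 * max 0 (x - 1/2) + max 0 (x - 1))"

lemma has_real_derivative_pos_part_sq: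
  "((\<lambda>x::real. (max 0 x)\<^sup>2) has_real_derivative 2 * max 0 x) (at x)"
proof -
  consider "x > 0" | "x < 0" | "x = 0" by linarith
  then show ?thesis
  proof cases
    case 1
    have "((\<lambda>x::real. x\<^sup>2) has_real_derivative 2 * max 0 x) (at x)"
      using 1 by (auto intro!: derivative_eq_intros)
    then show ?thesis
      by (rule has_field_derivative_transform_within_open[of _ _ _ "{0<..}"]) (use 1 in auto)
  next
    case 2
    have "((\<lambda>x::real. 0) has_real_derivative 2 * max 0 x) (at x)"
      using 2 by (auto intro!: derivative_eq_intros)
    then show ?thesis
      by (rule has_field_derivative_transform_within_open[of _ _ _ "{..<0}"]) (use 2 in auto)
  next
    case 3
    have "((\<lambda>y::real. (max 0 y)\<^sup>2 / y) \<longlongrightarrow> 0) (at 0)"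
    proof (rule tendsto_rabs_zero_cancel, rule tendsto_sandwich[where f="\<lambda>_. 0" and h="\<lambda>y. \<bar>y\<bar>"])
      show "\<forall>\<^sub>F y in at 0. \<bar>(max 0 y)\<^sup>2 / y\<bar> \<le> \<bar>y::real\<bar>"
        by (rule always_eventually) (auto simp: max_def power2_eq_square abs_mult)
      show "((\<lambda>y::real. \<bar>y\<bar>) \<longlongrightarrow> 0) (at 0)" by (intro tendsto_rabs_zero tendsto_ident_at)
    qed (auto intro!: always_eventually)
    then show ?thesis using 3 by (simp add: has_field_derivative_iff)
  qed
qed

lemma smooth_step_derivative:
  assumes "(f has_real_derivative D) (at x)"
  shows "((\<lambda>x. smooth_step (f x)) has_real_derivative tent (f x) * D) (at x)"
proof -
  have "((\<lambda>x. (max 0 (x - c))\<^sup>2) has_real_derivative 2 * max 0 (y - c)) (at y)" for c y :: real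
    using DERIV_chain2[where f="\<lambda>x. (max 0 x)\<^sup>2" and g="\<lambda>x. x - c" and x=y, OF has_real_derivative_pos_part_sq, of 1 UNIV]
      DERIV_diff[OF DERIV_ident DERIV_const, of c y UNIV] by simp
  then have "(smooth_step has_real_derivative tent y) (at y)" for y
  proof -
    have "((\<lambda>x. 2 * ((max 0 (x - 0))\<^sup>2 - 2 * (max 0 (x - 1/2))\<^sup>2 + (max 0 (x - 1))\<^sup>2)) has_real_derivative
        2 * (2 * max 0 (y - 0) - 2 * (2 * max 0 (y - 1/2)) + 2 * max 0 (y - 1))) (at y)"
      by (intro DERIV_cmult DERIV_add DERIV_diff \<open>\<And>c y. ((\<lambda>x. (max 0 (x - c))\<^sup>2) has_real_derivative 2 * max 0 (y - c)) (at y)\<close>)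
    then show ?thesis unfolding smooth_step_def[abs_def] tent_def by (simp add: algebra_simps)
  qed
  from DERIV_chain2[OF this assms] show ?thesis .
qed

lemma smooth_step_affine_derivative:
  "((\<lambda>x. smooth_step ((x - s) / c)) has_real_derivative tent ((x - s) / c) / c) (at x)"
proof -
  have "((\<lambda>x. (x - s) / c) has_real_derivative (1 - 0) / c) (at x)"
    by (intro DERIV_cdivide DERIV_diff DERIV_ident DERIV_const)
  from smooth_step_derivative[OF this] show ?thesis by simp
qed

lemma tent_nonneg: "0 \<le> tent x" by (auto simp: tent_def max_def)
lemma tent_zero: "x \<le> 0 \<or> 1 \<le> x \<Longrightarrow> tent x = 0" by (auto simp: tent_def max_def)
lemma continuous_tent: "continuous_on UNIV tent" unfolding tent_def[abs_def] by (intro continuous_intros)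
lemma smooth_step_0: "x \<le> 0 \<Longrightarrow> smooth_step x = 0" by (auto simp: smooth_step_def max_def)
lemma smooth_step_1: "1 \<le> x \<Longrightarrow> smooth_step x = 1"
  by (auto simp: smooth_step_def max_def power2_eq_square algebra_simps)

lemma smooth_step_mono: "x \<le> y \<Longrightarrow> smooth_step x \<le> smooth_step y"
proof (rule DERIV_nonneg_imp_nondecreasing[of x y])
  fix z
  show "\<exists>D. (smooth_step has_real_derivative D) (at z) \<and> 0 \<le> D"
    using smooth_step_derivative[OF DERIV_ident, of z] tent_nonneg[of z] by auto
qed

lemma smooth_step_bounds: "0 \<le> smooth_step x" "smooth_step x \<le> 1"
  using smooth_step_mono[of "min x 0" x] smooth_step_mono[of x "max x 1"] by (auto simp: smooth_step_0 smooth_step_1)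

section \<open>Recovery of increments from weak derivatives\<close>

text \<open>An approximate identity: the kernel is nonnegative and lives on
  \<open>[s, s + h n]\<close>, which the condition \<open>s + h n \<le> T\<close> keeps inside the
  interval, so its mass there is exactly one.\<close>

lemma tent_average_tendsto:
  fixes u :: "real \<Rightarrow> 'b::{banach, second_countable_topology}"
  assumes cont: "continuous_on {0..T} u" and s: "0 \<le> s" "s < T"
    and h: "\<And>n. h n > 0" "\<And>n. s + h n \<le> T" "h \<longlonglongrightarrow> 0"
  shows "(\<lambda>n. LINT x:{0..T}|lebesgue. (tent ((x - s) / h n) / h n) *\<^sub>R u x) \<longlonglongrightarrow> u s"
proof (rule LIMSEQ_I)
  fix e :: real assume "e > 0"
  have "continuous (at s within {0..T}) u" using cont s by (auto simp: continuous_on_eq_continuous_within)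
  then obtain \<delta> where \<delta>: "\<delta> > 0" "\<And>x. x \<in> {0..T} \<Longrightarrow> dist x s < \<delta> \<Longrightarrow> dist (u x) (u s) < e/2"
    using half_gt_zero[OF \<open>e > 0\<close>] unfolding continuous_within_eps_delta by metis
  obtain N where N: "\<And>n. n \<ge> N \<Longrightarrow> norm (h n - 0) < \<delta>" using LIMSEQ_D[OF h(3) \<delta>(1)] by blast
  show "\<exists>no. \<forall>n\<ge>no. norm ((LINT x:{0..T}|lebesgue. (tent ((x - s) / h n) / h n) *\<^sub>R u x) - u s) < e"
  proof (intro exI allI impI)
    fix n assume "n \<ge> N"
    define \<theta> where "\<theta> x = tent ((x - s) / h n) / h n" for x
    have c\<theta>: "continuous_on S \<theta>" for S unfolding \<theta>_def
      using h(1)[of n] by (intro continuous_intros continuous_on_compose2[OF continuous_tent]) auto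
    have "(\<theta> has_integral smooth_step ((T - s) / h n) - smooth_step ((0 - s) / h n)) {0..T}"
    proof (rule fundamental_theorem_of_calculus)
      fix x assume "x \<in> {0..T}"
      have "((\<lambda>x. smooth_step ((x - s) / h n)) has_real_derivative \<theta> x) (at x)"
        unfolding \<theta>_def by (rule smooth_step_affine_derivative)
      then show "((\<lambda>x. smooth_step ((x - s) / h n)) has_vector_derivative \<theta> x) (at x within {0..T})"
        by (simp add: has_real_derivative_iff_has_vector_derivative[symmetric] has_field_derivative_at_within)
    qed (use s in auto)
    moreover have "smooth_step ((T - s) / h n) = 1" using h(1,2)[of n] by (intro smooth_step_1) (simp add: field_simps)
    moreover have "smooth_step ((0 - s) / h n) = 0" using h(1)[of n] s by (intro smooth_step_0) (simp add: field_simps)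
    ultimately have int1: "(LINT x:{0..T}|lebesgue. \<theta> x) = 1"
      using set_lebesgue_integral_eq_integral(2)[OF set_integrable_continuous_interval[OF c\<theta>, of 0 T]]
      by (simp add: integral_unique)
    have i1: "set_integrable lebesgue {0..T} (\<lambda>x. \<theta> x *\<^sub>R u x)" and i2: "set_integrable lebesgue {0..T} (\<lambda>x. \<theta> x *\<^sub>R u s)"
      by (intro set_integrable_continuous_interval continuous_intros c\<theta> cont)+
    have "u s = (LINT x:{0..T}|lebesgue. \<theta> x) *\<^sub>R u s" using int1 by simp
    also have "\<dots> = (LINT x:{0..T}|lebesgue. \<theta> x *\<^sub>R u s)"
      using set_integrable_continuous_interval[OF c\<theta>, of 0 T]
      by (simp add: set_lebesgue_integral_def set_integrable_def flip: integral_scaleR_left)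
    finally have "(LINT x:{0..T}|lebesgue. \<theta> x *\<^sub>R u x) - u s = (LINT x:{0..T}|lebesgue. \<theta> x *\<^sub>R u x - \<theta> x *\<^sub>R u s)"
      using i1 i2 by (simp add: set_integral_diff)
    also have "norm \<dots> \<le> (LINT x:{0..T}|lebesgue. e/2 * \<theta> x)"
    proof (rule set_integral_bound_interval)
      show "set_integrable lebesgue {0..T} (\<lambda>x. \<theta> x *\<^sub>R u x - \<theta> x *\<^sub>R u s)" by (rule set_integral_diff(1)[OF i1 i2])
      show "set_integrable lebesgue {0..T} (\<lambda>x. e/2 * \<theta> x)"
        by (intro set_integrable_continuous_interval continuous_intros c\<theta>)
      show "AE x\<in>{0..T} in lebesgue. norm (\<theta> x *\<^sub>R u x - \<theta> x *\<^sub>R u s) \<le> e/2 * \<theta> x"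
      proof (intro AE_I2 impI)
        fix x assume x: "x \<in> {0..T}"
        have \<theta>0: "0 \<le> \<theta> x" using h(1)[of n] tent_nonneg by (simp add: \<theta>_def)
        show "norm (\<theta> x *\<^sub>R u x - \<theta> x *\<^sub>R u s) \<le> e/2 * \<theta> x"
        proof (cases "\<theta> x = 0")
          case False
          then have "0 < (x - s) / h n" "(x - s) / h n < 1" unfolding \<theta>_def using tent_zero[of "(x - s) / h n"] by (force simp: not_le)+
          then have "dist x s < \<delta>" using h(1)[of n] N[OF \<open>n \<ge> N\<close>]
            by (auto simp: field_simps dist_real_def zero_less_divide_iff)
          then have "norm (u x - u s) \<le> e/2" using \<delta>(2)[OF x] by (simp add: dist_norm)
          then show ?thesis using \<theta>0 mult_left_mono[of "norm (u x - u s)" "e/2" "\<theta> x"]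
            by (simp add: scaleR_diff_right[symmetric] mult.commute)
        qed simp
      qed
    qed
    also have "\<dots> = e/2" using int1 set_integrable_continuous_interval[OF c\<theta>, of 0 T] by simp
    finally show "norm ((LINT x:{0..T}|lebesgue. (tent ((x - s) / h n) / h n) *\<^sub>R u x) - u s) < e"
      using \<open>e > 0\<close> by (simp add: \<theta>_def)
  qed
qed

text \<open>Tested with a rounded indicator of \<open>[s, t]\<close>, the weak derivative relation
  has on one side a difference of two averages of \<open>u\<close>, tending to
  \<open>u s - u t\<close>, and on the other a dominated integral of \<open>g\<close>. The strict
  inequalities leave room for a compact support in the open interval.\<close>

lemma weak_derivative_increment:
  fixes u :: "real \<Rightarrow> 'b::{banach, second_countable_topology}"
  assumes w: "has_L2_weak_derivative T u g" and cont: "continuous_on {0..T} u"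
    and st: "0 < s" "s \<le> t" "t < T"
  shows "u t - u s = (LINT x:{s..t}|lebesgue. g x)"
proof -
  have gi: "set_integrable lebesgue {0..T} g" using w L2_on_integrable by (auto simp: has_L2_weak_derivative_def)
  define h where "h n = (T - t) / (real n + 2)" for n
  have hlim: "h \<longlonglongrightarrow> 0" unfolding h_def
    using LIMSEQ_ignore_initial_segment[OF lim_const_over_n[of "T - t"], of 2] by (simp add: add.commute)
  have h: "h n > 0" "t + h n < T" "s + h n \<le> T" for n
  proof -
    have "(T - t) / (real n + 2) < (T - t) / 1" using st by (intro divide_strict_left_mono) auto
    then show "h n > 0" "t + h n < T" "s + h n \<le> T" using st by (auto simp: h_def)
  qed
  define \<eta> where "\<eta> n x = smooth_step ((x - s) / h n) - smooth_step ((x - t) / h n)" for n x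
  define \<eta>' where "\<eta>' n x = tent ((x - s) / h n) / h n - tent ((x - t) / h n) / h n" for n x
  have der: "(\<eta> n has_real_derivative \<eta>' n x) (at x)" for n x
    unfolding \<eta>_def[abs_def] \<eta>'_def
    by (intro DERIV_diff smooth_step_affine_derivative)
  have ct: "continuous_on S (\<lambda>x. tent ((x - r) / h n) / h n)" for S r n
    using h(1)[of n] by (intro continuous_intros continuous_on_compose2[OF continuous_tent]) auto
  have test: "is_test_function T (\<eta> n) (\<eta>' n)" for n
    unfolding is_test_function_def
  proof (intro conjI allI)
    show "continuous_on UNIV (\<eta>' n)" unfolding \<eta>'_def[abs_def] by (intro continuous_intros ct)
    show "\<exists>K. compact K \<and> K \<subseteq> {0<..<T} \<and> (\<forall>x. x \<notin> K \<longrightarrow> \<eta> n x = 0)"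
    proof (intro exI[of _ "{s..t + h n}"] conjI allI impI)
      fix x assume "x \<notin> {s..t + h n}"
      then consider "x < s" | "x > t + h n" by fastforce
      then show "\<eta> n x = 0"
      proof cases
        case 1
        then show ?thesis using h(1)[of n] st unfolding \<eta>_def by (simp add: smooth_step_0 divide_le_0_iff)
      next
        case 2
        then have "1 \<le> (x - s) / h n" "1 \<le> (x - t) / h n" using h(1)[of n] st by (auto simp: field_simps)
        then show ?thesis unfolding \<eta>_def by (simp add: smooth_step_1)
      qed
    next
      show "{s..t + h n} \<subseteq> {0<..<T}" using st h(2)[of n] by auto
    qed simp
  qed (rule der)
  have eq: "(LINT x:{0..T}|lebesgue. \<eta>' n x *\<^sub>R u x) = - (LINT x:{0..T}|lebesgue. \<eta> n x *\<^sub>R g x)" for n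
    using w test[of n] unfolding has_L2_weak_derivative_def by (auto simp: integrable_lebesgue_on_open)
  have "(LINT x:{0..T}|lebesgue. \<eta>' n x *\<^sub>R u x) = (LINT x:{0..T}|lebesgue. (tent ((x - s) / h n) / h n) *\<^sub>R u x)
      - (LINT x:{0..T}|lebesgue. (tent ((x - t) / h n) / h n) *\<^sub>R u x)" for n
  proof -
    have i: "set_integrable lebesgue {0..T} (\<lambda>x. (tent ((x - r) / h n) / h n) *\<^sub>R u x)" for r
      by (intro set_integrable_continuous_interval continuous_on_scaleR ct cont)
    show ?thesis unfolding \<eta>'_def scaleR_diff_left by (rule set_integral_diff(2)[OF i i])
  qed
  then have L: "(\<lambda>n. LINT x:{0..T}|lebesgue. \<eta>' n x *\<^sub>R u x) \<longlonglongrightarrow> u s - u t"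
    using tendsto_diff[OF tent_average_tendsto[OF cont _ _ h(1) h(3) hlim] tent_average_tendsto[OF cont _ _ h(1) less_imp_le[OF h(2)] hlim]] st
    by simp
  have "(\<lambda>n. integral\<^sup>L lebesgue (\<lambda>x. indicator {0..T} x *\<^sub>R (\<eta> n x *\<^sub>R g x))) \<longlonglongrightarrow> integral\<^sup>L lebesgue (\<lambda>x::real. indicator {s..t} x *\<^sub>R g x)"
  proof (rule integral_dominated_convergence[where w="\<lambda>x. norm (indicator {0..T} x *\<^sub>R g x)"])
    show "integrable lebesgue (\<lambda>x. norm (indicator {0..T} x *\<^sub>R g x))"
      using gi unfolding set_integrable_def by (rule integrable_norm)
    have "set_integrable lebesgue {s..t} g" using gi st set_integrable_interval_subset by fastforce
    then show "(\<lambda>x. indicator {s..t} x *\<^sub>R g x) \<in> borel_measurable lebesgue"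
      unfolding set_integrable_def by (rule borel_measurable_integrable)
    show "(\<lambda>x. indicator {0..T} x *\<^sub>R (\<eta> n x *\<^sub>R g x)) \<in> borel_measurable lebesgue" for n
    proof -
      have "continuous_on {0..T} (\<eta> n)" using der by (meson DERIV_isCont continuous_at_imp_continuous_on)
      then show ?thesis using set_integrable_scaleR_continuous[OF gi]
        unfolding set_integrable_def by (blast intro: borel_measurable_integrable)
    qed
    show "AE x in lebesgue. norm (indicator {0..T} x *\<^sub>R (\<eta> n x *\<^sub>R g x)) \<le> norm (indicator {0..T} x *\<^sub>R g x)" for n
    proof (rule AE_I2)
      fix x
      have "(x - t) / h n \<le> (x - s) / h n" using h(1)[of n] st by (simp add: divide_right_mono)
      from smooth_step_mono[OF this] have "\<bar>\<eta> n x\<bar> \<le> 1"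
        using smooth_step_bounds[of "(x - s) / h n"] smooth_step_bounds[of "(x - t) / h n"] unfolding \<eta>_def by linarith
      then show "norm (indicator {0..T} x *\<^sub>R (\<eta> n x *\<^sub>R g x)) \<le> norm (indicator {0..T} x *\<^sub>R g x)"
        using mult_right_mono[of "\<bar>\<eta> n x\<bar>" 1 "norm (g x)"] by (auto split: split_indicator)
    qed
    show "AE x in lebesgue. (\<lambda>n. indicator {0..T} x *\<^sub>R (\<eta> n x *\<^sub>R g x)) \<longlonglongrightarrow> indicator {s..t} x *\<^sub>R g x"
    proof (rule AE_I[where N="{s,t}"], rule subsetI, rule ccontr)
      fix x assume *: "x \<in> {x \<in> space lebesgue. \<not> (\<lambda>n. indicator {0..T} x *\<^sub>R (\<eta> n x *\<^sub>R g x)) \<longlonglongrightarrow> indicator {s..t} x *\<^sub>R g x}" "x \<notin> {s,t}"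
      have low: "eventually (\<lambda>n. smooth_step ((x - r) / h n) = (if x < r then 0 else 1)) sequentially" if "x \<noteq> r" for r
      proof (cases "x < r")
        case True
        then show ?thesis using h(1) by (intro always_eventually allI) (simp add: smooth_step_0 divide_nonpos_pos)
      next
        case False
        then have "eventually (\<lambda>n. h n < x - r) sequentially" using that hlim by (intro order_tendstoD(2)[OF hlim]) auto
        then show ?thesis
        proof eventually_elim
          case (elim n)
          then have "1 \<le> (x - r) / h n" using h(1)[of n] by (simp add: field_simps)
          then show ?case using False by (simp add: smooth_step_1)
        qed
      qed
      have "eventually (\<lambda>n. indicator {0..T} x *\<^sub>R (\<eta> n x *\<^sub>R g x) = indicator {s..t} x *\<^sub>R g x) sequentially"
      proof -
        have "x \<noteq> s" "x \<noteq> t" using * by auto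
        show ?thesis using low[OF \<open>x \<noteq> s\<close>] low[OF \<open>x \<noteq> t\<close>]
        proof eventually_elim
          case (elim n)
          then show ?case using * st by (auto simp: \<eta>_def split: split_indicator)
        qed
      qed
      from tendsto_eventually[OF this] show False using * by simp
    qed (auto simp: emeasure_lborel_countable)
  qed
  then have "(\<lambda>n. - (LINT x:{0..T}|lebesgue. \<eta> n x *\<^sub>R g x)) \<longlonglongrightarrow> - (LINT x:{s..t}|lebesgue. g x)"
    unfolding set_lebesgue_integral_def by (rule tendsto_minus)
  with L have "u s - u t = - (LINT x:{s..t}|lebesgue. g x)" unfolding eq by (rule LIMSEQ_unique)
  then show ?thesis by (simp add: algebra_simps)
qed

text \<open>The right end is harmless because the weak derivative is known beyond it, on
  \<open>(0, t + 1)\<close>. The left end 0 is reached by continuity along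
  \<open>t / (n + 1)\<close>.\<close>

lemma weak_imp_has_integral_derivative:
  fixes u :: "real \<Rightarrow> 'b::{banach, second_countable_topology}"
  assumes w: "\<And>T. T > 0 \<Longrightarrow> has_L2_weak_derivative T u g" and cont: "\<And>T. T > 0 \<Longrightarrow> continuous_on {0..T} u"
    and T: "T > 0"
  shows "has_integral_derivative u g T"
  unfolding has_integral_derivative_def
proof (intro conjI allI impI)
  show gi: "set_integrable lebesgue {0..T} g" using w[OF T] L2_on_integrable by (auto simp: has_L2_weak_derivative_def)
  fix s t :: real assume st: "0 \<le> s" "s \<le> t" "t \<le> T"
  have *: "u t - u s = (LINT x:{s..t}|lebesgue. g x)" if "0 < s" "s \<le> t" for s t
    using weak_derivative_increment[OF w[of "t + 1"] cont[of "t + 1"], of s t] that by simp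
  show "u t - u s = (LINT x:{s..t}|lebesgue. g x)"
  proof (cases "s = 0")
    case s0: True
    show ?thesis
    proof (cases "t = 0")
      case False
      define X where "X n = t / (real n + 1)" for n
      have Xlim: "X \<longlonglongrightarrow> 0" unfolding X_def
        using LIMSEQ_ignore_initial_segment[OF lim_const_over_n[of t], of 1] by (simp add: add.commute)
      have X: "0 < X n" "X n \<le> t" for n using False st by (auto simp: X_def field_simps)
      have Xin: "X n \<in> {0..t}" for n using X[of n] by auto
      have git: "set_integrable lebesgue {0..t} g" using set_integrable_interval_subset[OF gi] st by auto
      have "(\<lambda>n. u (X n)) \<longlonglongrightarrow> u 0"
        using cont[OF T] Xlim X st by (intro continuous_on_tendsto_compose[of "{0..T}" u X]) (auto intro!: always_eventually order_trans[OF X(2)] less_imp_le[OF X(1)])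
      then have "(\<lambda>n. u t - u (X n)) \<longlonglongrightarrow> u t - u 0" by (intro tendsto_intros)
      moreover have "u t - u (X n) = (LINT x:{0..t}|lebesgue. g x) - (LINT x:{0..X n}|lebesgue. g x)" for n
        using *[of "X n" t] X[of n] set_integral_interval_combine[OF git, of "X n"] by simp
      moreover have "(\<lambda>n. (LINT x:{0..t}|lebesgue. g x) - (LINT x:{0..X n}|lebesgue. g x)) \<longlonglongrightarrow> (LINT x:{0..t}|lebesgue. g x) - 0"
        by (intro tendsto_intros set_integral_interval_tendsto_0(2)[OF git Xin Xlim]) (use st s0 in auto)
      ultimately have "u t - u 0 = (LINT x:{0..t}|lebesgue. g x) - 0" by (simp add: LIMSEQ_unique)
      then show ?thesis using s0 by simp
    qed (use s0 set_integral_interval_combine[OF gi, of 0] set_integral_interval_combine[OF set_integrable_interval_subset[OF gi, of 0 0], of 0] T in simp)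
  qed (use * st in auto)
qed

section \<open>Curves of bounded dyadic energy\<close>

text \<open>\<open>f\<close> is prescribed only inside the cells, so the formula serves the
  left-closed dyadic cells as well as the Euler interpolants, whose cells are closed on the
  right.\<close>

lemma step_function_integral:
  fixes f :: "real \<Rightarrow> 'b::{banach, second_countable_topology}" and h :: "nat \<Rightarrow> 'b"
  assumes \<tau>: "\<tau> > 0" and f: "\<And>k x. real k * \<tau> < x \<Longrightarrow> x < real (Suc k) * \<tau> \<Longrightarrow> f x = h k"
    and ij: "i \<le> j"
  shows "set_integrable lebesgue {real i * \<tau>..real j * \<tau>} f"
    "(LINT x:{real i * \<tau>..real j * \<tau>}|lebesgue. f x) = \<tau> *\<^sub>R (\<Sum>k=i..<j. h k)"
proof -
  have one: "set_integrable lebesgue {real k * \<tau>..real (Suc k) * \<tau>} f \<and>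
     (LINT x:{real k * \<tau>..real (Suc k) * \<tau>}|lebesgue. f x) = \<tau> *\<^sub>R h k" for k
  proof -
    let ?I = "{real k * \<tau><..<real (Suc k) * \<tau>}" and ?J = "{real k * \<tau>..real (Suc k) * \<tau>}"
    have c: "(\<lambda>x. indicator ?I x *\<^sub>R f x) = (\<lambda>x. indicator ?I x *\<^sub>R h k)"
      using f[of k] by (auto split: split_indicator)
    have "set_integrable lebesgue ?I (\<lambda>x. h k)" "(LINT x:?I|lebesgue. h k) = \<tau> *\<^sub>R h k"
      unfolding set_integrable_open_closed
      using set_integral_const_interval[of "real k * \<tau>" "real (Suc k) * \<tau>" "h k"] \<tau>
      by (auto simp: set_integrable_const_interval algebra_simps)
    then have "set_integrable lebesgue ?I f" "(LINT x:?I|lebesgue. f x) = \<tau> *\<^sub>R h k"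
      unfolding set_integrable_def set_lebesgue_integral_def c by auto
    then show ?thesis unfolding set_integrable_open_closed by auto
  qed
  have "set_integrable lebesgue {real i * \<tau>..real j * \<tau>} f \<and>
    (LINT x:{real i * \<tau>..real j * \<tau>}|lebesgue. f x) = \<tau> *\<^sub>R (\<Sum>k=i..<j. h k)"
    using ij
  proof (induction j rule: dec_induct)
    case base
    have i: "set_integrable lebesgue {real i * \<tau>..real i * \<tau>} f"
      by (rule set_integrable_interval_subset[of "real i * \<tau>" "real (Suc i) * \<tau>"]) (use one \<tau> in auto)
    show ?case using i set_integral_interval_combine[OF i, of "real i * \<tau>"] by simp
  next
    case (step j)
    let ?a = "real i * \<tau>" and ?b = "real j * \<tau>" and ?c = "real (Suc j) * \<tau>"
    have le: "?a \<le> ?b" "?b \<le> ?c" using step \<tau> by (auto intro: mult_right_mono)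
    have "{?a..?c} = {?a..?b} \<union> {?b..?c}" using le by auto
    then have *: "set_integrable lebesgue {?a..?c} f"
      using step.IH one[of j] by (auto intro: set_integrable_Un)
    show ?case
      using * set_integral_interval_combine[OF * le] step.IH step.hyps one[of j] by (simp add: scaleR_add_right)
  qed
  then show "set_integrable lebesgue {real i * \<tau>..real j * \<tau>} f"
    "(LINT x:{real i * \<tau>..real j * \<tau>}|lebesgue. f x) = \<tau> *\<^sub>R (\<Sum>k=i..<j. h k)" by auto
qed

section \<open>Dyadic difference quotients\<close>

definition dyadic_slope :: "(real \<Rightarrow> 'b::real_normed_vector) \<Rightarrow> nat \<Rightarrow> nat \<Rightarrow> 'b" where
  "dyadic_slope u n k = 2^n *\<^sub>R (u ((real k + 1) / 2^n) - u (real k / 2^n))"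

text \<open>The squared L2 norm on \<open>[0, N]\<close> of the step function formed by the slopes
  of level \<open>n\<close>. As a finite sum of point values it passes to pointwise limits of
  curves.\<close>

definition dyadic_energy :: "(real \<Rightarrow> 'b::real_normed_vector) \<Rightarrow> nat \<Rightarrow> nat \<Rightarrow> real" where
  "dyadic_energy u N n = (\<Sum>k<N * 2^n. (norm (dyadic_slope u n k))\<^sup>2) / 2^n"

definition dyadic_index :: "nat \<Rightarrow> real \<Rightarrow> nat" where
  "dyadic_index n t = nat \<lfloor>2^n * t\<rfloor>"

lemma dyadic_slope_refine:
  "dyadic_slope u n k = (1/2) *\<^sub>R (dyadic_slope u (Suc n) (2*k) + dyadic_slope u (Suc n) (2*k + 1))"
proof -
  have "(real (2 * k) + 1) / 2 ^ Suc n = (2 * real k + 1) / (2 * 2^n)"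
    "real (2 * k) / 2 ^ Suc n = real k / 2^n"
    "(real (2 * k + 1) + 1) / 2 ^ Suc n = (real k + 1) / 2^n"
    "real (2 * k + 1) / 2 ^ Suc n = (2 * real k + 1) / (2 * 2^n)" by (auto simp: field_simps)
  then show ?thesis unfolding dyadic_slope_def by (simp add: algebra_simps)
qed

lemma sum_pairs: "(\<Sum>k<2 * M. F k) = (\<Sum>k<M::nat. F (2*k) + F (2*k + 1))" for F :: "nat \<Rightarrow> 'b::comm_monoid_add"
  by (induction M) (auto simp: add.assoc)

text \<open>Slopes on successive dyadic levels form a martingale, whence this Pythagorean identity.\<close>

lemma dyadic_energy_diff:
  fixes u :: "real \<Rightarrow> 'b::real_inner"
  assumes "n \<le> m"
  shows "(\<Sum>k<N * 2^m. (norm (dyadic_slope u m k - dyadic_slope u n (k div 2^(m - n))))\<^sup>2) / 2^m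
    = dyadic_energy u N m - dyadic_energy u N n"
  using assms
proof (induction m rule: dec_induct)
  case (step m)
  define e where "e k = dyadic_slope u n (k div 2^(m - n))" for k
  have e: "dyadic_slope u n ((2*k) div 2^(Suc m - n)) = e k" "dyadic_slope u n ((2*k+1) div 2^(Suc m - n)) = e k" for k
    using step.hyps by (simp_all add: e_def Suc_diff_le div_mult2_eq)
  let ?c = "dyadic_slope u"
  \<comment> \<open>Parallelogram identity for two slopes x, y with mean c: both |x - e|^2 + |y -
    e|^2 - 2 |c - e|^2 and |x|^2 + |y|^2 - 2 |c|^2 equal |x - y|^2 / 2.\<close>
  have p: "(norm (?c (Suc m) (2*k) - e k))\<^sup>2 + (norm (?c (Suc m) (2*k+1) - e k))\<^sup>2
      = 2 * (norm (?c m k - e k))\<^sup>2 + ((norm (?c (Suc m) (2*k)))\<^sup>2 + (norm (?c (Suc m) (2*k+1)))\<^sup>2) - 2 * (norm (?c m k))\<^sup>2" for k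
    unfolding dyadic_slope_refine[of u m k] power2_norm_eq_inner
    by (simp add: inner_add_left inner_add_right inner_diff_left inner_diff_right inner_commute algebra_simps)
  have "(\<Sum>k<N * 2^Suc m. (norm (?c (Suc m) k - ?c n (k div 2^(Suc m - n))))\<^sup>2)
    = (\<Sum>k<N * 2^m. (norm (?c (Suc m) (2*k) - e k))\<^sup>2 + (norm (?c (Suc m) (2*k+1) - e k))\<^sup>2)"
    using sum_pairs[of "\<lambda>k. (norm (?c (Suc m) k - ?c n (k div 2^(Suc m - n))))\<^sup>2" "N * 2^m"] e
    by (simp add: mult.left_commute)
  also have "\<dots> = 2 * (\<Sum>k<N * 2^m. (norm (?c m k - e k))\<^sup>2)
      + (\<Sum>k<N * 2^m. (norm (?c (Suc m) (2*k)))\<^sup>2 + (norm (?c (Suc m) (2*k+1)))\<^sup>2) - 2 * (\<Sum>k<N * 2^m. (norm (?c m k))\<^sup>2)"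
    unfolding p sum_subtractf sum.distrib[symmetric] sum_distrib_left by simp
  also have "(\<Sum>k<N * 2^m. (norm (?c (Suc m) (2*k)))\<^sup>2 + (norm (?c (Suc m) (2*k+1)))\<^sup>2) = (\<Sum>k<N * 2^Suc m. (norm (?c (Suc m) k))\<^sup>2)"
    using sum_pairs[of "\<lambda>k. (norm (?c (Suc m) k))\<^sup>2" "N * 2^m"] by (simp add: mult.left_commute)
  finally show ?case using step.IH unfolding e_def[symmetric] dyadic_energy_def
    by (simp add: add_divide_distrib diff_divide_distrib)
qed simp

lemma dyadic_index_bounds:
  assumes "0 \<le> t"
  shows "real (dyadic_index n t) / 2^n \<le> t" "t < (real (dyadic_index n t) + 1) / 2^n"
proof -
  have "real (dyadic_index n t) = of_int \<lfloor>2^n * t\<rfloor>" using assms by (simp add: dyadic_index_def)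
  then show "real (dyadic_index n t) / 2^n \<le> t" "t < (real (dyadic_index n t) + 1) / 2^n"
    using floor_correct[of "2^n * t"] by (simp_all add: field_simps)
qed

lemma dyadic_index_eq:
  assumes "real k / 2^n \<le> t" "t < (real k + 1) / 2^n"
  shows "dyadic_index n t = k"
proof -
  have "\<lfloor>2^n * t\<rfloor> = int k" using assms by (intro floor_unique) (auto simp: field_simps)
  then show ?thesis by (simp add: dyadic_index_def)
qed

lemma dyadic_index_coarsen:
  assumes "n \<le> m" "0 \<le> t"
  shows "dyadic_index n t = dyadic_index m t div 2^(m - n)"
proof -
  have "(2::real)^m = 2^n * 2^(m - n)" using assms by (simp flip: power_add)
  then have "2^n * t = 2^m * t / real_of_int (2^(m - n))" by simp
  then have "\<lfloor>2^n * t\<rfloor> = \<lfloor>2^m * t\<rfloor> div 2^(m - n)" using floor_divide_real_eq_div[of "2^(m - n)" "2^m * t"] by simp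
  then show ?thesis using assms by (simp add: dyadic_index_def nat_div_distrib nat_power_eq)
qed

lemma dyadic_left_tendsto:
  assumes "0 \<le> t"
  shows "(\<lambda>n. real (dyadic_index n t) / 2^n) \<longlonglongrightarrow> t" "(\<lambda>n. (real (dyadic_index n t) + 1) / 2^n) \<longlonglongrightarrow> t"
proof -
  have z: "(\<lambda>n. 1 / 2^n :: real) \<longlonglongrightarrow> 0"
    using LIMSEQ_power_zero[of "1/2::real"] by (simp add: power_one_over)
  have "norm (real (dyadic_index n t) / 2^n - t) \<le> 1 / 2^n" for n
    using dyadic_index_bounds[OF assms, of n] by (simp add: add_divide_distrib)
  then have "(\<lambda>n. real (dyadic_index n t) / 2^n - t) \<longlonglongrightarrow> 0"
    by (intro Lim_null_comparison[OF _ z]) (auto intro: always_eventually)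
  then show *: "(\<lambda>n. real (dyadic_index n t) / 2^n) \<longlonglongrightarrow> t" by (simp add: LIM_zero_iff)
  show "(\<lambda>n. (real (dyadic_index n t) + 1) / 2^n) \<longlonglongrightarrow> t"
    using tendsto_add[OF * z] by (simp add: add_divide_distrib)
qed

lemma dyadic_step_integral:
  fixes h :: "nat \<Rightarrow> 'b::{banach, second_countable_topology}"
  assumes "i \<le> j"
  shows "set_integrable lebesgue {real i / 2^n..real j / 2^n} (\<lambda>t. h (dyadic_index n t))"
    "(LINT t:{real i / 2^n..real j / 2^n}|lebesgue. h (dyadic_index n t)) = (1 / 2^n) *\<^sub>R (\<Sum>k=i..<j. h k)"
proof -
  have f: "h (dyadic_index n x) = h k" if "real k * (1/2^n) < x" "x < real (Suc k) * (1/2^n)" for k x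
    using dyadic_index_eq[of k n x] that by (simp add: add.commute)
  show "set_integrable lebesgue {real i / 2^n..real j / 2^n} (\<lambda>t. h (dyadic_index n t))"
    "(LINT t:{real i / 2^n..real j / 2^n}|lebesgue. h (dyadic_index n t)) = (1 / 2^n) *\<^sub>R (\<Sum>k=i..<j. h k)"
    using step_function_integral[where \<tau>="1/2^n" and h=h and f="\<lambda>t. h (dyadic_index n t)", OF _ f assms] by auto
qed

lemma dyadic_step_integral_nat:
  fixes h :: "nat \<Rightarrow> 'b::{banach, second_countable_topology}"
  shows "set_integrable lebesgue {0..real N} (\<lambda>t. h (dyadic_index n t))"
    "(LINT t:{0..real N}|lebesgue. h (dyadic_index n t)) = (1 / 2^n) *\<^sub>R (\<Sum>k<N * 2^n. h k)"
  using dyadic_step_integral[of 0 "N * 2^n" n h] by (simp_all add: atLeast0LessThan)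

text \<open>By telescoping, the slopes of every level from \<open>m\<close> on reproduce the
  increments of \<open>u\<close> between points of level \<open>m\<close> exactly; the limit of the
  slopes inherits this.\<close>

lemma dyadic_slope_integral:
  fixes u :: "real \<Rightarrow> 'b::{banach, second_countable_topology}"
  assumes "m \<le> n"
  shows "(LINT t:{0..real j / 2^m}|lebesgue. dyadic_slope u n (dyadic_index n t)) = u (real j / 2^m) - u 0"
proof -
  have e: "real j / 2^m = real (j * 2^(n - m)) / 2^n"
  proof -
    have "(2::real)^n = 2^m * 2^(n - m)" using assms by (simp flip: power_add)
    then show ?thesis by simp
  qed
  have "(LINT t:{0..real j / 2^m}|lebesgue. dyadic_slope u n (dyadic_index n t))
    = (1 / 2^n) *\<^sub>R (\<Sum>k<j * 2^(n - m). dyadic_slope u n k)"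
    unfolding e using dyadic_step_integral(2)[of 0 "j * 2^(n - m)" n "dyadic_slope u n"] by (simp add: atLeast0LessThan)
  also have "\<dots> = (\<Sum>k<j * 2^(n - m). u (real (Suc k) / 2^n) - u (real k / 2^n))"
    by (simp add: dyadic_slope_def scaleR_sum_right add.commute)
  also have "\<dots> = u (real j / 2^m) - u 0"
    unfolding e using sum_lessThan_telescope[of "\<lambda>k. u (real k / 2^n)" "j * 2^(n - m)"] by simp
  finally show ?thesis .
qed

lemma measurable_dyadic_index [measurable]: "dyadic_index n \<in> borel \<rightarrow>\<^sub>M count_space UNIV"
  unfolding dyadic_index_def[abs_def] by measurable

lemma measurable_dyadic_step:
  fixes h :: "nat \<Rightarrow> 'b::topological_space"
  shows "(\<lambda>t. h (dyadic_index n t)) \<in> borel_measurable lebesgue"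
proof -
  have "(\<lambda>t. h (dyadic_index n t)) \<in> borel_measurable lborel"
    by measurable
  then show ?thesis by (rule measurable_completion)
qed


text \<open>The slopes form a martingale bounded in L2. By the Pythagorean identity the energy gaps
  are squared L2 distances, so a fast subsequence converges almost everywhere, and its limit is the
  derivative. This takes the place of a Radon-Nikodym theorem for Hilbert space valued functions.
  The pointwise convergence of the slopes is recorded because the subdifferential inclusion is
  obtained from it.\<close>

theorem bounded_dyadic_energy_imp_integral_derivative:
  fixes u :: "real \<Rightarrow> 'b::{real_inner, banach, second_countable_topology}"
  assumes cont: "continuous_on {0..} u" and bound: "\<And>N n. dyadic_energy u N n \<le> C"
  shows "\<exists>g. (\<forall>T. g \<in> L2_on T) \<and> (\<forall>T. has_integral_derivative u g T) \<and>
    (AE t in lebesgue. 0 \<le> t \<longrightarrow>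
      (\<exists>r. strict_mono r \<and> (\<lambda>k. dyadic_slope u (r k) (dyadic_index (r k) t)) \<longlonglongrightarrow> g t))"
proof -
  define S where "S = dyadic_energy u"
  define D where "D n t = dyadic_slope u n (dyadic_index n t)" for n t
  have Dm [measurable]: "D n \<in> borel_measurable lebesgue" for n
    unfolding D_def[abs_def] by (rule measurable_dyadic_step)
  have Smono: "S N n \<le> S N m" if "n \<le> m" for N n m
  proof -
    have "0 \<le> (\<Sum>k<N * 2^m. (norm (dyadic_slope u m k - dyadic_slope u n (k div 2^(m - n))))\<^sup>2) / 2^m"
      by (intro divide_nonneg_nonneg sum_nonneg) auto
    then show ?thesis using dyadic_energy_diff[OF that, where N=N and u=u] by (simp add: S_def)
  qed
  have D2: "set_integrable lebesgue {0..real N} (\<lambda>t. (norm (D n t))\<^sup>2)"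
    "(LINT t:{0..real N}|lebesgue. (norm (D n t))\<^sup>2) = S N n" for N n
    using dyadic_step_integral_nat[of N "\<lambda>k. (norm (dyadic_slope u n k))\<^sup>2" n]
    by (auto simp: D_def S_def dyadic_energy_def)
  have Dd: "set_integrable lebesgue {0..real N} (\<lambda>t. (norm (D m t - D n t))\<^sup>2)"
    "(LINT t:{0..real N}|lebesgue. (norm (D m t - D n t))\<^sup>2) = S N m - S N n" if "n \<le> m" for N n m
  proof -
    define h where "h k = (norm (dyadic_slope u m k - dyadic_slope u n (k div 2^(m - n))))\<^sup>2" for k
    have e: "(norm (D m t - D n t))\<^sup>2 = h (dyadic_index m t)" if "t \<in> {0..real N}" for t
      using dyadic_index_coarsen[OF \<open>n \<le> m\<close>, of t] that by (simp add: D_def h_def)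
    have e': "(\<lambda>t. indicator {0..real N} t *\<^sub>R (norm (D m t - D n t))\<^sup>2) = (\<lambda>t. indicator {0..real N} t *\<^sub>R h (dyadic_index m t))"
      using e by (auto split: split_indicator)
    show "set_integrable lebesgue {0..real N} (\<lambda>t. (norm (D m t - D n t))\<^sup>2)"
      using dyadic_step_integral_nat(1)[of N h m] unfolding set_integrable_def e' .
    have "(LINT t:{0..real N}|lebesgue. h (dyadic_index m t)) = S N m - S N n"
      using dyadic_step_integral_nat(2)[of N h m] dyadic_energy_diff[OF that, where N=N and u=u] by (simp add: h_def S_def)
    then show "(LINT t:{0..real N}|lebesgue. (norm (D m t - D n t))\<^sup>2) = S N m - S N n"
      unfolding set_lebesgue_integral_def e' .
  qed
  \<comment> \<open>Energies increase with the level and are bounded, so on each horizon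
    \<open>[0, N]\<close> with \<open>N \<le> k\<close> the remaining gap falls below
    \<open>(1/4)^k\<close>; finitely many horizons are treated at once.\<close>
  have "\<exists>n0. \<forall>n\<ge>n0. \<forall>m\<ge>n. \<forall>N\<le>k. S N m - S N n \<le> (1/4)^k" for k :: nat
  proof -
    have ev: "\<forall>\<^sub>F n in sequentially. \<forall>m\<ge>n. S N m - S N n \<le> (1/4)^k" for N
    proof -
      have "incseq (S N)" using Smono by (simp add: incseq_def)
      moreover have "\<forall>n. S N n \<le> C" using bound by (simp add: S_def)
      ultimately obtain L where L: "S N \<longlonglongrightarrow> L" "\<forall>n. S N n \<le> L" using incseq_convergent by metis
      have "\<forall>\<^sub>F n in sequentially. L - (1/4)^k < S N n" using L(1) by (rule order_tendstoD(1)) simp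
      then show ?thesis
      proof eventually_elim
        case (elim n)
        show ?case
        proof (intro allI impI)
          fix m show "S N m - S N n \<le> (1/4)^k" using elim L(2)[rule_format, of m] by linarith
        qed
      qed
    qed
    have "\<forall>\<^sub>F n in sequentially. \<forall>N\<in>{..k}. \<forall>m\<ge>n. S N m - S N n \<le> (1/4)^k"
      by (rule eventually_ball_finite) (use ev in auto)
    then show ?thesis unfolding eventually_sequentially by (meson atMost_iff)
  qed
  then obtain n0 where n0: "\<And>k n m N. n \<ge> n0 k \<Longrightarrow> m \<ge> n \<Longrightarrow> N \<le> k \<Longrightarrow> S N m - S N n \<le> (1/4)^k"
    by metis
  define r where "r k = (\<Sum>i\<le>k. Suc (n0 i))" for k
  have rmono: "strict_mono r" unfolding strict_mono_Suc_iff r_def by simp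
  have r0: "r k \<ge> n0 k" for k unfolding r_def by (cases k) auto
  have rS: "S N (r (Suc k)) - S N (r k) \<le> (1/4)^k" if "N \<le> k" for N k
    using n0[OF r0 _ that] rmono by (simp add: strict_mono_less_eq)
  define d where "d k t = norm (D (r (Suc k)) t - D (r k) t)" for k t
  have dm [measurable]: "d k \<in> borel_measurable lebesgue" for k unfolding d_def[abs_def] by measurable
  have rle: "r k \<le> r (Suc k)" for k using rmono by (simp add: strict_mono_less_eq)
  have di: "set_integrable lebesgue {0..real N} (d k)" for N k
  proof -
    have "set_integrable lebesgue {0..real N} (D n)" for n
      unfolding D_def[abs_def] by (rule dyadic_step_integral_nat)
    then show ?thesis unfolding d_def[abs_def] by (intro set_integrable_norm set_integral_diff(1))
  qed
  have dle: "(LINT t:{0..real N}|lebesgue. d k t) \<le> (real N + 1) * (1/2)^k" if "N \<le> k" for N k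
  proof -
    have i2: "set_integrable lebesgue {0..real N} (\<lambda>t. (d k t)\<^sup>2)" unfolding d_def using Dd(1)[OF rle] .
    \<comment> \<open>Weighted Young inequality: the factor \<open>2^k\<close> turns the squared L2
      gap \<open>(1/4)^k\<close> into \<open>(1/2)^k\<close>, which is summable.\<close>
    have "(LINT t:{0..real N}|lebesgue. d k t) \<le> (LINT t:{0..real N}|lebesgue. (1/2)^k + 2^k * (d k t)\<^sup>2)"
    proof (rule set_integral_mono[OF di])
      show "set_integrable lebesgue {0..real N} (\<lambda>t. (1/2)^k + 2^k * (d k t)\<^sup>2)"
        by (intro set_integral_add(1) set_integrable_const_interval set_integrable_mult_right i2)
      fix t
      have "0 \<le> (1/2)^k * (2^k * d k t - 1)\<^sup>2 + d k t" by (simp add: d_def)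
      also have "\<dots> = (1/2)^k + 2^k * (d k t)\<^sup>2 - d k t"
        by (simp add: power2_eq_square algebra_simps power_one_over)
      finally show "d k t \<le> (1/2)^k + 2^k * (d k t)\<^sup>2" by simp
    qed
    also have "\<dots> = (LINT t:{0..real N}|lebesgue. (1/2)^k) + (LINT t:{0..real N}|lebesgue. 2^k * (d k t)\<^sup>2)"
      by (intro set_integral_add(2) set_integrable_const_interval set_integrable_mult_right i2)
    also have "\<dots> = real N * (1/2)^k + 2^k * (S N (r (Suc k)) - S N (r k))"
      using Dd(2)[OF rle, of N k] set_integral_const_interval[of 0 "real N" "(1/2)^k::real"] by (simp add: d_def)
    also have "\<dots> \<le> real N * (1/2)^k + 2^k * (1/4)^k" using rS[OF that] by simp
    also have "\<dots> = (real N + 1) * (1/2)^k" by (simp add: algebra_simps flip: power_mult_distrib)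
    finally show ?thesis .
  qed
  have dnn: "0 \<le> (LINT t:{0..real N}|lebesgue. d k t)" for k N
    unfolding set_lebesgue_integral_def by (rule integral_nonneg_AE) (simp add: d_def)
  have dsum: "summable (\<lambda>k. LINT t:{0..real N}|lebesgue. d k t)" for N
  proof (rule summable_comparison_test)
    show "summable (\<lambda>k. (real N + 1) * (1/2)^k)" by (intro summable_mult summable_geometric) simp
    show "\<exists>M. \<forall>k\<ge>M. norm (LINT t:{0..real N}|lebesgue. d k t) \<le> (real N + 1) * (1/2)^k"
      using dle dnn by auto
  qed
  have AEd: "AE t in lebesgue. summable (\<lambda>k. indicator {0..real N} t *\<^sub>R d k t)" for N
  proof -
    have "(\<integral>\<^sup>+t. (\<Sum>k. ennreal (indicator {0..real N} t *\<^sub>R d k t)) \<partial>lebesgue)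
        = (\<Sum>k. \<integral>\<^sup>+t. ennreal (indicator {0..real N} t *\<^sub>R d k t) \<partial>lebesgue)"
      using di by (intro nn_integral_suminf measurable_compose[OF _ measurable_ennreal] borel_measurable_integrable)
        (simp add: set_integrable_def)
    also have "\<dots> = (\<Sum>k. ennreal (LINT t:{0..real N}|lebesgue. d k t))"
      unfolding set_lebesgue_integral_def
      using di by (intro suminf_cong nn_integral_eq_integral) (auto simp: set_integrable_def d_def)
    also have "\<dots> \<noteq> \<infinity>"
      using ennreal_suminf_neq_top[OF dsum[of N] dnn] by (simp add: infinity_ennreal_def)
    finally have "AE t in lebesgue. (\<Sum>k. ennreal (indicator {0..real N} t *\<^sub>R d k t)) \<noteq> \<infinity>"
      using di by (intro nn_integral_PInf_AE borel_measurable_suminf_order measurable_compose[OF _ measurable_ennreal] borel_measurable_integrable)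
        (simp_all add: set_integrable_def)
    then show ?thesis
    proof eventually_elim
      case (elim t)
      then show ?case by (intro summable_suminf_not_top) (simp_all add: d_def infinity_ennreal_def)
    qed
  qed
  \<comment> \<open>The value of \<open>lim\<close> is unspecified where the slopes diverge; on
    \<open>[0, \<infinity>)\<close> this happens on a null set only.\<close>
  define g where "g t = lim (\<lambda>k. D (r k) t)" for t
  have gm [measurable]: "g \<in> borel_measurable lebesgue"
    unfolding g_def[abs_def] by (rule borel_measurable_lim_metric) measurable
  have conv: "(\<lambda>k. D (r k) t) \<longlonglongrightarrow> g t" if "summable (\<lambda>k. d k t)" for t
  proof -
    have "summable (\<lambda>k. D (r (Suc k)) t - D (r k) t)"
      using that unfolding d_def by (rule summable_norm_cancel)
    then have "convergent (\<lambda>n. \<Sum>k<n. D (r (Suc k)) t - D (r k) t)" by (simp add: summable_iff_convergent)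
    then have "convergent (\<lambda>n. D (r n) t - D (r 0) t)"
      unfolding sum_lessThan_telescope[of "\<lambda>k. D (r k) t"] .
    then have "convergent (\<lambda>n. D (r n) t)" using convergent_add[OF _ convergent_const[of "D (r 0) t"]] by fastforce
    then show ?thesis unfolding g_def by (simp add: convergent_LIMSEQ_iff)
  qed
  have AEconv: "AE t in lebesgue. 0 \<le> t \<longrightarrow> (\<lambda>k. D (r k) t) \<longlonglongrightarrow> g t"
  proof -
    have "AE t in lebesgue. \<forall>N. summable (\<lambda>k. indicator {0..real N} t *\<^sub>R d k t)"
      unfolding AE_all_countable using AEd by blast
    then show ?thesis
    proof eventually_elim
      case (elim t)
      obtain N where "t \<le> real N" using real_arch_simple by blast
      then show ?case using elim[rule_format, of N] conv[of t] by (auto simp: indicator_def)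
    qed
  qed
  have g2: "set_integrable lebesgue {0..real N} (\<lambda>t. (norm (g t))\<^sup>2)" for N
    unfolding set_integrable_def
  proof (rule integrableI_bounded)
    show "(\<lambda>t. indicator {0..real N} t *\<^sub>R (norm (g t))\<^sup>2) \<in> borel_measurable lebesgue"
      by (intro borel_measurable_scaleR borel_measurable_indicator borel_measurable_power measurable_compose[OF gm borel_measurable_norm]) simp
    have "(\<integral>\<^sup>+t. ennreal (norm (indicator {0..real N} t *\<^sub>R (norm (g t))\<^sup>2)) \<partial>lebesgue)
        = (\<integral>\<^sup>+t. liminf (\<lambda>k. ennreal (indicator {0..real N} t *\<^sub>R (norm (D (r k) t))\<^sup>2)) \<partial>lebesgue)"
    proof (rule nn_integral_cong_AE, use AEconv in eventually_elim)
      case (elim t)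
      show ?case
      proof (cases "t \<in> {0..real N}")
        case True
        then have "(\<lambda>k. ennreal (indicator {0..real N} t *\<^sub>R (norm (D (r k) t))\<^sup>2)) \<longlonglongrightarrow> ennreal (indicator {0..real N} t *\<^sub>R (norm (g t))\<^sup>2)"
          using elim by (intro tendsto_ennrealI tendsto_intros) auto
        from lim_imp_Liminf[OF _ this] show ?thesis by simp
      qed (simp add: Liminf_const)
    qed
    also have "\<dots> \<le> liminf (\<lambda>k. \<integral>\<^sup>+t. ennreal (indicator {0..real N} t *\<^sub>R (norm (D (r k) t))\<^sup>2) \<partial>lebesgue)"
      by (intro nn_integral_liminf measurable_compose[OF _ measurable_ennreal] borel_measurable_scaleR
          borel_measurable_indicator borel_measurable_power measurable_compose[OF Dm borel_measurable_norm]) simp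
    also have "\<dots> \<le> liminf (\<lambda>k. ennreal C)"
    proof (intro Liminf_mono always_eventually allI)
      fix k
      have "(\<integral>\<^sup>+t. ennreal (indicator {0..real N} t *\<^sub>R (norm (D (r k) t))\<^sup>2) \<partial>lebesgue) = ennreal (S N (r k))"
        unfolding D2(2)[symmetric] set_lebesgue_integral_def
        using D2(1) by (intro nn_integral_eq_integral) (auto simp: set_integrable_def)
      then show "(\<integral>\<^sup>+t. ennreal (indicator {0..real N} t *\<^sub>R (norm (D (r k) t))\<^sup>2) \<partial>lebesgue) \<le> ennreal C"
        using bound by (simp add: S_def ennreal_leI)
    qed
    also have "\<dots> < \<infinity>" by (simp add: Liminf_const)
    finally show "(\<integral>\<^sup>+t. ennreal (norm (indicator {0..real N} t *\<^sub>R (norm (g t))\<^sup>2)) \<partial>lebesgue) < \<infinity>" .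
  qed
  have gIm: "(\<lambda>t. indicator {0..T} t *\<^sub>R g t) \<in> borel_measurable lebesgue" for T :: real
    by (intro borel_measurable_scaleR borel_measurable_indicator gm) simp
  have gL2: "g \<in> L2_on T" for T
  proof -
    obtain N where N: "T \<le> real N" using real_arch_simple by blast
    have "set_integrable lebesgue {0..T} (\<lambda>t. (norm (g t))\<^sup>2)"
      by (rule set_integrable_interval_subset[OF g2]) (use N in auto)
    then show ?thesis using gIm unfolding L2_on_iff set_borel_measurable_def by auto
  qed
  have gi: "set_integrable lebesgue {a..b} g" if "0 \<le> a" for a b
    by (rule set_integrable_interval_subset[OF L2_on_integrable[OF gL2[of b]]]) (use that in auto)
  have wi: "integrable lebesgue (\<lambda>t. \<Sum>k. indicator {0..real N} t *\<^sub>R d k t)" for N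
  proof (rule integrable_suminf)
    show "integrable lebesgue (\<lambda>t. indicator {0..real N} t *\<^sub>R d k t)" for k using di[of N k] by (simp add: set_integrable_def)
    have "norm (indicator {0..real N} t *\<^sub>R d k t) = indicator {0..real N} t *\<^sub>R d k t" for t k by (simp add: d_def)
    then show "AE t in lebesgue. summable (\<lambda>k. norm (indicator {0..real N} t *\<^sub>R d k t))"
      "summable (\<lambda>k. LINT t|lebesgue. norm (indicator {0..real N} t *\<^sub>R d k t))"
      using AEd[of N] dsum[of N] by (simp_all only: set_lebesgue_integral_def)
  qed
  have dy: "(LINT t:{0..real j / 2^m}|lebesgue. g t) = u (real j / 2^m) - u 0" for j m
  proof -
    let ?A = "{0..real j / 2^m}"
    have sub: "?A \<subseteq> {0..real j}" by (auto simp: field_simps intro: order_trans[OF _ mult_left_mono[of 1 "2^m"], rotated])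
    have "(\<lambda>k. integral\<^sup>L lebesgue (\<lambda>t. indicator ?A t *\<^sub>R D (r k) t)) \<longlonglongrightarrow> integral\<^sup>L lebesgue (\<lambda>t. indicator ?A t *\<^sub>R g t)"
    \<comment> \<open>The majorant is the telescoping bound: the first slope function plus all later
      differences.\<close>
    proof (rule integral_dominated_convergence[where w="\<lambda>t. norm (indicator {0..real j} t *\<^sub>R D (r 0) t) + (\<Sum>k. indicator {0..real j} t *\<^sub>R d k t)"])
      have "set_integrable lebesgue {0..real j} (D (r 0))" unfolding D_def[abs_def] by (rule dyadic_step_integral_nat)
      then show "integrable lebesgue (\<lambda>t. norm (indicator {0..real j} t *\<^sub>R D (r 0) t) + (\<Sum>k. indicator {0..real j} t *\<^sub>R d k t))"
        unfolding set_integrable_def by (intro Bochner_Integration.integrable_add integrable_norm wi)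
      show "AE t in lebesgue. (\<lambda>k. indicator ?A t *\<^sub>R D (r k) t) \<longlonglongrightarrow> indicator ?A t *\<^sub>R g t"
        using AEconv by eventually_elim (auto split: split_indicator)
      show "AE t in lebesgue. norm (indicator ?A t *\<^sub>R D (r k) t) \<le> norm (indicator {0..real j} t *\<^sub>R D (r 0) t) + (\<Sum>k. indicator {0..real j} t *\<^sub>R d k t)" for k
        using AEd[of j]
      proof eventually_elim
        case (elim t)
        have nn: "0 \<le> indicator {0..real j} t *\<^sub>R d k t" for k by (simp add: d_def)
        show ?case
        proof (cases "t \<in> ?A")
          case True
          then have t: "t \<in> {0..real j}" using sub by blast
          have "D (r k) t = D (r 0) t + (\<Sum>i<k. D (r (Suc i)) t - D (r i) t)"
            unfolding sum_lessThan_telescope[of "\<lambda>i. D (r i) t"] by simp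
          then have "norm (D (r k) t) \<le> norm (D (r 0) t) + norm (\<Sum>i<k. D (r (Suc i)) t - D (r i) t)"
            using norm_triangle_ineq by metis
          also have "norm (\<Sum>i<k. D (r (Suc i)) t - D (r i) t) \<le> (\<Sum>i<k. indicator {0..real j} t *\<^sub>R d i t)"
            using t by (intro order_trans[OF norm_sum]) (simp add: d_def)
          also have "\<dots> \<le> (\<Sum>k. indicator {0..real j} t *\<^sub>R d k t)"
            using elim nn by (intro sum_le_suminf) auto
          finally show ?thesis using True t by simp
        next
          case False
          then show ?thesis using suminf_nonneg[OF elim nn] by simp
        qed
      qed
    qed (intro borel_measurable_scaleR borel_measurable_indicator gm Dm; simp)+
    then have "(\<lambda>k. LINT t:?A|lebesgue. D (r k) t) \<longlonglongrightarrow> (LINT t:?A|lebesgue. g t)" by (simp add: set_lebesgue_integral_def)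
    moreover have "(\<lambda>k. LINT t:?A|lebesgue. D (r k) t) \<longlonglongrightarrow> u (real j / 2^m) - u 0"
    proof (rule tendsto_eventually)
      show "\<forall>\<^sub>F k in sequentially. (LINT t:?A|lebesgue. D (r k) t) = u (real j / 2^m) - u 0"
        using eventually_ge_at_top[of m]
      proof eventually_elim
        case (elim k)
        then have "m \<le> r k" using seq_suble[OF rmono, of k] by linarith
        then show ?case unfolding D_def by (rule dyadic_slope_integral)
      qed
    qed
    ultimately show ?thesis by (rule LIMSEQ_unique)
  qed
  have u0: "u t - u 0 = (LINT x:{0..t}|lebesgue. g x)" if t: "0 \<le> t" for t
  proof -
    define X where "X n = real (dyadic_index n t) / 2^n" for n
    have X: "X n \<in> {0..t}" for n using dyadic_index_bounds(1)[OF t, of n] by (simp add: X_def)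
    have Xl: "X \<longlonglongrightarrow> t" unfolding X_def by (rule dyadic_left_tendsto[OF t])
    have "(\<lambda>n. u (X n)) \<longlonglongrightarrow> u t"
      using X t by (intro continuous_on_tendsto_compose[OF cont Xl]) (auto intro!: always_eventually)
    then have "(\<lambda>n. u t - u 0 - (u t - u (X n))) \<longlonglongrightarrow> u t - u 0 - (u t - u t)" by (intro tendsto_intros)
    moreover have "u t - u 0 - (u t - u (X n)) = (LINT x:{0..t}|lebesgue. g x) - (LINT x:{X n..t}|lebesgue. g x)" for n
      using dy[of "dyadic_index n t" n] set_integral_interval_combine[OF gi[of 0 t], of "X n"] X[of n] by (simp add: X_def)
    moreover have "(\<lambda>n. (LINT x:{0..t}|lebesgue. g x) - (LINT x:{X n..t}|lebesgue. g x)) \<longlonglongrightarrow> (LINT x:{0..t}|lebesgue. g x) - 0"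
      by (intro tendsto_intros set_integral_interval_tendsto_0(1)[OF gi X Xl]) (use t in auto)
    ultimately show ?thesis by (simp add: LIMSEQ_unique)
  qed
  have "has_integral_derivative u g T" for T
    unfolding has_integral_derivative_def
  proof (intro conjI allI impI gi)
    fix s t :: real assume "0 \<le> s" "s \<le> t" "t \<le> T"
    then show "u t - u s = (LINT x:{s..t}|lebesgue. g x)"
      using u0[of s] u0[of t] set_integral_interval_combine[OF gi[of 0 t], of s] by (simp add: algebra_simps)
  qed simp
  moreover have "AE t in lebesgue. 0 \<le> t \<longrightarrow>
      (\<exists>r. strict_mono r \<and> (\<lambda>k. dyadic_slope u (r k) (dyadic_index (r k) t)) \<longlonglongrightarrow> g t)"
    using AEconv by eventually_elim (use rmono in \<open>auto simp: D_def\<close>)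
  ultimately show ?thesis using gL2 by blast
qed

section \<open>Attractors of semiflows with a Lyapunov function\<close>

lemma excess_le:
  assumes "\<And>y. y \<in> E \<Longrightarrow> \<exists>a\<in>A. d y a \<le> e"
  shows "excess d E A \<le> ennreal e"
  unfolding excess_def
proof (rule SUP_least)
  fix y assume "y \<in> E"
  then obtain a where "a \<in> A" "d y a \<le> e" using assms by blast
  then show "(INF b\<in>A. ennreal (d y b)) \<le> ennreal e"
    by (intro INF_lower2[of a]) (auto intro: ennreal_leI)
qed

lemma excess_lessD:
  assumes "excess d E A < ennreal e" "y \<in> E"
  shows "\<exists>a\<in>A. d y a < e"
proof -
  have "(INF b\<in>A. ennreal (d y b)) \<le> excess d E A"
    unfolding excess_def using assms(2) by (rule SUP_upper)
  then have "(INF b\<in>A. ennreal (d y b)) < ennreal e" using assms(1) by (rule order_le_less_trans)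
  then show ?thesis by (auto simp: INF_less_iff ennreal_less_iff dest: ennreal_leI leD[rotated] intro: ccontr) (meson ennreal_leI leD leI)
qed

lemma flow_imageI: "g \<in> G \<Longrightarrow> g 0 \<in> E \<Longrightarrow> g t \<in> flow_image G t E"
  by (auto simp: flow_image_def)

lemma flow_image_mono: "E \<subseteq> E' \<Longrightarrow> flow_image G t E \<subseteq> flow_image G t E'"
  by (auto simp: flow_image_def)

text \<open>\<open>V_compact\<close> asks for convergence at positive times only: initial values merely satisfy a bound
  on \<open>V\<close>, which does not make them precompact.\<close>

locale lyapunov_semiflow = Metric_space X d for X :: "'x set" and d +
  fixes G :: "(real \<Rightarrow> 'x) set" and V :: "'x \<Rightarrow> real"
  assumes maps: "G \<subseteq> {0..} \<rightarrow>\<^sub>E X"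
    and exist: "x \<in> X \<Longrightarrow> \<exists>g\<in>G. g 0 = x"
    and shift: "g \<in> G \<Longrightarrow> 0 \<le> \<tau> \<Longrightarrow> restrict (\<lambda>t. g (t + \<tau>)) {0..} \<in> G"
    and concat: "g \<in> G \<Longrightarrow> h \<in> G \<Longrightarrow> 0 \<le> t \<Longrightarrow> h 0 = g t \<Longrightarrow>
        restrict (\<lambda>\<tau>. if \<tau> \<le> t then g \<tau> else h (\<tau> - t)) {0..} \<in> G"
    and V_bounded_below: "\<exists>m. \<forall>x\<in>X. m \<le> V x"
    and V_mbounded: "mbounded B \<Longrightarrow> \<exists>C. \<forall>x\<in>B. V x \<le> C"
    and V_mono: "g \<in> G \<Longrightarrow> 0 \<le> s \<Longrightarrow> s \<le> t \<Longrightarrow> V (g t) \<le> V (g s)"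
    and V_cont: "(\<And>n. xs n \<in> X) \<Longrightarrow> y \<in> X \<Longrightarrow> (\<lambda>n. d (xs n) y) \<longlonglongrightarrow> 0 \<Longrightarrow> (\<lambda>n. V (xs n)) \<longlonglongrightarrow> V y"
    and V_compact: "(\<And>n. gs n \<in> G) \<Longrightarrow> (\<And>n. V (gs n 0) \<le> C) \<Longrightarrow>
        \<exists>r g. strict_mono r \<and> g \<in> G \<and> V (g 0) \<le> C \<and>
          (\<forall>t \<tau>. 0 < t \<and> (\<forall>n. 0 \<le> \<tau> n) \<and> \<tau> \<longlonglongrightarrow> t \<longrightarrow> (\<lambda>n. d (gs (r n) (\<tau> n)) (g t)) \<longlonglongrightarrow> 0)"
    and compact_initial: "(\<And>n. gs n \<in> G) \<Longrightarrow> x \<in> X \<Longrightarrow> (\<lambda>n. d (gs n 0) x) \<longlonglongrightarrow> 0 \<Longrightarrow>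
        \<exists>r g. strict_mono r \<and> g \<in> G \<and> g 0 = x \<and>
          (\<forall>t \<tau>. 0 \<le> t \<and> (\<forall>n. 0 \<le> \<tau> n) \<and> \<tau> \<longlonglongrightarrow> t \<longrightarrow> (\<lambda>n. d (gs (r n) (\<tau> n)) (g t)) \<longlonglongrightarrow> 0)"
    and V_rest: "\<exists>C. \<forall>g\<in>G. (\<forall>s t. 0 < s \<and> s \<le> t \<and> t \<le> 1 \<longrightarrow> V (g s) = V (g t)) \<longrightarrow> V (g 1) \<le> C"
begin

lemma in_X: "g \<in> G \<Longrightarrow> 0 \<le> t \<Longrightarrow> g t \<in> X"
  using maps by (auto simp: PiE_iff)

lemma generalized_semiflow: "generalized_semiflow X d G"
  unfolding generalized_semiflow_def
proof (intro conjI ballI allI impI)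
  fix gs x assume *: "(\<forall>n::nat. gs n \<in> G) \<and> limitin mtopology (\<lambda>n. gs n 0) x sequentially"
  then have "x \<in> X" "(\<lambda>n. d (gs n 0) x) \<longlonglongrightarrow> 0" by (auto simp: limitin_metric_dist_null)
  then obtain r g where rg: "strict_mono r" "g \<in> G" "g 0 = x"
    "\<And>t \<tau>. 0 \<le> t \<Longrightarrow> (\<And>n. 0 \<le> \<tau> n) \<Longrightarrow> \<tau> \<longlonglongrightarrow> t \<Longrightarrow> (\<lambda>n. d (gs (r n) (\<tau> n)) (g t)) \<longlonglongrightarrow> 0"
    using compact_initial[of gs x] * by metis
  have "limitin mtopology (\<lambda>k. gs (r k) t) (g t) sequentially" if "0 \<le> t" for t
    using rg(4)[of t "\<lambda>_. t"] that in_X rg(2) * by (auto simp: limitin_metric_dist_null intro!: always_eventually)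
  then show "\<exists>r g. strict_mono r \<and> g \<in> G \<and> g 0 = x \<and> (\<forall>t\<ge>0. limitin mtopology (\<lambda>k. gs (r k) t) (g t) sequentially)"
    using rg by blast
qed (use maps exist shift concat Metric_space_axioms in auto)

text \<open>One inclusion is translation, the other concatenation, so the set-valued maps form a
  semigroup.\<close>

lemma flow_image_add:
  assumes "0 \<le> s" "0 \<le> t"
  shows "flow_image G (s + t) E = flow_image G s (flow_image G t E)"
proof (intro equalityI subsetI)
  fix y assume "y \<in> flow_image G (s + t) E"
  then obtain g where g: "g \<in> G" "g 0 \<in> E" "y = g (s + t)" by (auto simp: flow_image_def)
  let ?h = "restrict (\<lambda>\<sigma>. g (\<sigma> + t)) {0..}"
  have "?h \<in> G" "?h 0 = g t" "y = ?h s" using shift g assms by auto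
  then show "y \<in> flow_image G s (flow_image G t E)" using flow_imageI[of ?h G _ s] flow_imageI[OF g(1,2)] by metis
next
  fix y assume "y \<in> flow_image G s (flow_image G t E)"
  then obtain h g where g: "h \<in> G" "y = h s" "g \<in> G" "g 0 \<in> E" "h 0 = g t" by (auto simp: flow_image_def)
  let ?k = "restrict (\<lambda>\<tau>. if \<tau> \<le> t then g \<tau> else h (\<tau> - t)) {0..}"
  have "?k \<in> G" using concat g assms by blast
  \<comment> \<open>For \<open>s = 0\<close> the first branch is taken, and \<open>g t = h 0\<close>
    is the required value.\<close>
  moreover have "?k 0 \<in> E" "?k (s + t) = y" using g assms by (auto simp: order_antisym)
  ultimately show "y \<in> flow_image G (s + t) E" using flow_imageI[of ?k G E "s + t"] by metis
qed

text \<open>A fixed drop of \<open>V\<close> on every unit interval is impossible, so a trajectory that stays above the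
  rest level has unit intervals on which \<open>V\<close> is almost constant; limits of these are at rest.\<close>

lemma V_absorbing:
  obtains C0 where "\<And>B. mbounded B \<Longrightarrow> \<exists>tB\<ge>0. \<forall>t\<ge>tB. flow_image G t B \<subseteq> {x\<in>X. V x \<le> C0}"
proof -
  obtain Cz where Cz: "\<And>g. g \<in> G \<Longrightarrow> (\<And>s t. 0 < s \<Longrightarrow> s \<le> t \<Longrightarrow> t \<le> 1 \<Longrightarrow> V (g s) = V (g t)) \<Longrightarrow> V (g 1) \<le> Cz"
    using V_rest by blast
  obtain m where m: "\<And>x. x \<in> X \<Longrightarrow> m \<le> V x" using V_bounded_below by blast
  \<comment> \<open>The margin 1 above the rest level survives the limit and contradicts it.\<close>
  have "\<exists>tB\<ge>0. \<forall>t\<ge>tB. flow_image G t B \<subseteq> {x\<in>X. V x \<le> Cz + 1}" if B: "mbounded B" for B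
  proof (rule ccontr)
    assume neg: "\<not> ?thesis"
    have "\<exists>t g. real n \<le> t \<and> g \<in> G \<and> g 0 \<in> B \<and> V (g t) > Cz + 1" for n :: nat
    proof -
      obtain t where t: "t \<ge> real n" "\<not> flow_image G t B \<subseteq> {x\<in>X. V x \<le> Cz + 1}"
        using neg by (meson of_nat_0_le_iff)
      then obtain g where "g \<in> G" "g 0 \<in> B" "g t \<notin> {x\<in>X. V x \<le> Cz + 1}" by (auto simp: flow_image_def)
      then show ?thesis using in_X[of g t] t by force
    qed
    then obtain t g where tg: "\<And>n. real n \<le> t n" "\<And>n. g n \<in> G" "\<And>n. g n 0 \<in> B" "\<And>n. V (g n (t n)) > Cz + 1"
      by metis
    obtain C where C: "\<And>x. x \<in> B \<Longrightarrow> V x \<le> C" using V_mbounded[OF B] by blast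
    \<comment> \<open>Pigeonhole: \<open>V\<close> drops by at most \<open>C - m\<close> over
      \<open>Suc n\<close> unit intervals, so some drop is at most the average.\<close>
    have "\<exists>k<Suc n. V (g (Suc n) (real k)) - V (g (Suc n) (real (Suc k))) \<le> (C - m) / real (Suc n)" for n
    proof (rule ccontr)
      assume "\<not> ?thesis"
      then have "(\<Sum>k<Suc n. (C - m) / real (Suc n)) < (\<Sum>k<Suc n. V (g (Suc n) (real k)) - V (g (Suc n) (real (Suc k))))"
        by (intro sum_strict_mono) (auto simp: not_le)
      also have "\<dots> = V (g (Suc n) (real 0)) - V (g (Suc n) (real (Suc n)))"
        by (rule sum_lessThan_telescope'[of "\<lambda>k. V (g (Suc n) (real k))"])
      also have "\<dots> \<le> C - m" using C[OF tg(3)[of "Suc n"]] m[OF in_X[OF tg(2)[of "Suc n"], of "real (Suc n)"]] by simp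
      finally show False by simp
    qed
    then obtain k where k: "\<And>n. k n < Suc n"
      "\<And>n. V (g (Suc n) (real (k n))) - V (g (Suc n) (real (Suc (k n)))) \<le> (C - m) / real (Suc n)" by metis
    define h where "h n = restrict (\<lambda>s. g (Suc n) (s + real (k n))) {0..}" for n
    have hG: "h n \<in> G" for n unfolding h_def using shift tg(2) by auto
    have h0: "V (h n 0) \<le> C" for n
      using V_mono[OF tg(2)[of "Suc n"], of 0 "real (k n)"] C[OF tg(3)[of "Suc n"]] by (simp add: h_def)
    \<comment> \<open>The selected interval ends at
      \<open>k n + 1 \<le> Suc n \<le> t (Suc n)\<close>, and \<open>V\<close> decreases along the
      trajectory, so the level has not yet been passed.\<close>
    have h1: "V (h n 1) > Cz + 1" for n
    proof -
      have "real (Suc n) \<le> t (Suc n)" by (rule tg(1))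
      then have "V (g (Suc n) (t (Suc n))) \<le> V (g (Suc n) (1 + real (k n)))"
        using k(1)[of n] by (intro V_mono tg(2)) auto
      then show ?thesis using tg(4)[of "Suc n"] by (simp add: h_def)
    qed
    have hst: "V (h n s) - V (h n t) \<le> (C - m) / real (Suc n)" if "0 \<le> s" "s \<le> t" "t \<le> 1" for n s t
      using V_mono[OF hG[of n], of 0 s] V_mono[OF hG[of n], of t 1] k(2)[of n] that
      by (simp add: h_def add.commute)
    obtain r g' where rg: "strict_mono r" "g' \<in> G"
      "\<And>t \<tau>. 0 < t \<Longrightarrow> (\<And>n. 0 \<le> \<tau> n) \<Longrightarrow> \<tau> \<longlonglongrightarrow> t \<Longrightarrow> (\<lambda>n. d (h (r n) (\<tau> n)) (g' t)) \<longlonglongrightarrow> 0"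
      using V_compact[of h, OF hG h0] by metis
    have lim: "(\<lambda>n. V (h (r n) t)) \<longlonglongrightarrow> V (g' t)" if "0 < t" for t
      using that rg(3)[of t "\<lambda>_. t"] in_X hG rg(2) by (intro V_cont) auto
    have "V (g' s) = V (g' t)" if st: "0 < s" "s \<le> t" "t \<le> 1" for s t
    proof (rule antisym)
      have "(\<lambda>n. (C - m) / real (Suc n)) \<longlonglongrightarrow> 0"
        using LIMSEQ_ignore_initial_segment[OF lim_const_over_n[of "C - m"], of 1] by simp
      from LIMSEQ_subseq_LIMSEQ[OF this rg(1)] have z: "(\<lambda>n. (C - m) / real (Suc (r n))) \<longlonglongrightarrow> 0" by (simp add: o_def)
      have "V (g' s) - V (g' t) \<le> 0"
        by (rule LIMSEQ_le[OF tendsto_diff[OF lim lim] z]) (use st hst in auto)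
      then show "V (g' s) \<le> V (g' t)" by simp
    qed (use V_mono rg(2) st in auto)
    then have "V (g' 1) \<le> Cz" by (rule Cz[OF rg(2)])
    moreover have "Cz + 1 \<le> V (g' 1)"
      by (rule LIMSEQ_le_const[OF lim]) (use h1 less_imp_le in auto)
    ultimately show False by simp
  qed
  then show thesis using that by blast
qed

section \<open>Omega-limit sets of sublevels\<close>

definition sublevel :: "real \<Rightarrow> 'x set" where "sublevel C = {x\<in>X. V x \<le> C}"

text \<open>No closures are taken, as \<open>V_compact\<close> already makes the image of a sublevel
  at a positive time compact.\<close>

definition omega_limit :: "real \<Rightarrow> 'x set" where
  "omega_limit C = {y. \<forall>t>0. y \<in> flow_image G t (sublevel C)}"

lemma sublevel_invariant: "0 \<le> t \<Longrightarrow> flow_image G t (sublevel C) \<subseteq> sublevel C"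
  using V_mono in_X by (fastforce simp: flow_image_def sublevel_def)

lemma sublevel_nested:
  assumes "0 \<le> s" "s \<le> t"
  shows "flow_image G t (sublevel C) \<subseteq> flow_image G s (sublevel C)"
  using flow_image_add[of s "t - s" "sublevel C"] sublevel_invariant[of "t - s" C] assms flow_image_mono
  by fastforce

lemma limit_unique:
  assumes "\<And>n. x n \<in> X" "y \<in> X" "z \<in> X" "(\<lambda>n. d (x n) y) \<longlonglongrightarrow> 0" "(\<lambda>n. d (x n) z) \<longlonglongrightarrow> 0"
  shows "y = z"
proof -
  have "limitin mtopology x y sequentially" "limitin mtopology x z sequentially"
    using assms by (auto simp: limitin_metric_dist_null intro!: always_eventually)
  then show ?thesis by (rule limitin_metric_unique) simp
qed

text \<open>Windows of trajectories cut out at times tending to infinity have a limit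
  \<open>k\<close>. A point \<open>k t\<close> lies in the image at every time \<open>q\<close>:
  restarting the same trajectories \<open>q\<close> earlier and taking a further limit yields a
  trajectory from the sublevel that arrives at \<open>k t\<close> after time \<open>q\<close>.
  Invariance, compactness and attraction are all read off from this.\<close>

lemma late_trajectories:
  assumes g: "\<And>n. g n \<in> G" "\<And>n. g n 0 \<in> sublevel C" and s: "\<And>n. real n + 1 \<le> s n"
  obtains r k where "strict_mono (r :: nat \<Rightarrow> nat)" "k \<in> G" "\<And>t. 0 \<le> t \<Longrightarrow> k t \<in> omega_limit C"
    "\<And>t. 0 \<le> t \<Longrightarrow> (\<lambda>n. d (g (r n) (s (r n) + t)) (k t)) \<longlonglongrightarrow> 0"
proof -
  have later: "restrict (\<lambda>t. g n (t + a)) {0..} \<in> G \<and> V (g n a) \<le> C" if "0 \<le> a" for a n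
    using shift[OF g(1) that] V_mono[OF g(1)[of n] _ that] g(2)[of n] by (auto simp: sublevel_def)
  \<comment> \<open>The window opens one time unit early, because \<open>V_compact\<close> gives no
    convergence at the initial time.\<close>
  define h where "h n = restrict (\<lambda>t. g n (t + (s n - 1))) {0..}" for n
  have sn: "0 \<le> s n - 1" for n using s[of n] by simp
  have hG: "h n \<in> G" and h0: "V (h n 0) \<le> C" for n using later[OF sn] by (auto simp: h_def)
  obtain r h' where r: "strict_mono r" "h' \<in> G"
    "\<And>t \<tau>. 0 < t \<Longrightarrow> (\<And>n. 0 \<le> \<tau> n) \<Longrightarrow> \<tau> \<longlonglongrightarrow> t \<Longrightarrow> (\<lambda>n. d (h (r n) (\<tau> n)) (h' t)) \<longlonglongrightarrow> 0"
    using V_compact[of h, OF hG h0] by metis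
  define k where "k = restrict (\<lambda>t. h' (t + 1)) {0..}"
  have kG: "k \<in> G" unfolding k_def using shift[OF r(2)] by simp
  have conv: "(\<lambda>n. d (g (r n) (s (r n) + t)) (k t)) \<longlonglongrightarrow> 0" if "0 \<le> t" for t
    using r(3)[of "t + 1" "\<lambda>_. t + 1"] that by (simp add: h_def k_def add.commute add.left_commute)
  have rn: "n \<le> r n" for n using r(1) by (rule seq_suble)
  have "k t \<in> flow_image G q (sublevel C)" if "0 \<le> t" "0 < q" for t q
  proof -
    obtain N where N: "q \<le> real N" using real_arch_simple by blast
    \<comment> \<open>Discarding the first \<open>N\<close> terms makes the restart time
      nonnegative: \<open>s (r (n + N)) \<ge> N \<ge> q\<close>.\<close>
    define a where "a n = s (r (n + N)) + t - q" for n
    have a0: "0 \<le> a n" for n using s[of "r (n + N)"] rn[of "n + N"] N that by (simp add: a_def)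
    define p where "p n = restrict (\<lambda>t. g (r (n + N)) (t + a n)) {0..}" for n
    have pG: "p n \<in> G" and p0: "V (p n 0) \<le> C" for n using later[OF a0] by (auto simp: p_def)
    obtain r' p' where r': "strict_mono r'" "p' \<in> G" "V (p' 0) \<le> C"
      "\<And>t \<tau>. 0 < t \<Longrightarrow> (\<And>n. 0 \<le> \<tau> n) \<Longrightarrow> \<tau> \<longlonglongrightarrow> t \<Longrightarrow> (\<lambda>n. d (p (r' n) (\<tau> n)) (p' t)) \<longlonglongrightarrow> 0"
      using V_compact[of p, OF pG p0] by metis
    have "p n q = g (r (n + N)) (s (r (n + N)) + t)" for n using that by (simp add: p_def a_def)
    then have "(\<lambda>n. d (p n q) (k t)) \<longlonglongrightarrow> 0" using LIMSEQ_ignore_initial_segment[OF conv[OF \<open>0 \<le> t\<close>], of N] by simp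
    from LIMSEQ_subseq_LIMSEQ[OF this r'(1)] have "(\<lambda>n. d (p (r' n) q) (k t)) \<longlonglongrightarrow> 0" by (simp add: o_def)
    moreover have "(\<lambda>n. d (p (r' n) q) (p' q)) \<longlonglongrightarrow> 0" using r'(4)[of q "\<lambda>_. q"] that by simp
    ultimately have "k t = p' q" using in_X kG pG r'(2) that by (intro limit_unique[of "\<lambda>n. p (r' n) q"]) auto
    then show ?thesis using r'(2,3) in_X[OF r'(2)] by (auto simp: flow_image_def sublevel_def)
  qed
  then have "k t \<in> omega_limit C" if "0 \<le> t" for t using that by (auto simp: omega_limit_def)
  with r(1) kG conv show thesis using that by blast
qed

text \<open>Forward invariance follows from the nesting of the images. For the converse,
  \<open>y\<close> is reached at the times \<open>n + 1 + t\<close>; the windows opening at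
  \<open>n + 1\<close> have a limit \<open>k\<close> that starts in the set and takes the constant
  value \<open>y\<close> at time \<open>t\<close>.\<close>

lemma omega_limit_invariant: "flow_invariant G (omega_limit C)"
  unfolding flow_invariant_def
proof (intro allI impI equalityI subsetI)
  fix t y assume t: "0 \<le> (t::real)" and "y \<in> flow_image G t (omega_limit C)"
  then have "y \<in> flow_image G t (flow_image G q (sublevel C))" if "0 < q" for q
    using that by (auto simp: flow_image_def omega_limit_def)
  then have "y \<in> flow_image G (t + q) (sublevel C)" if "0 < q" for q using that t flow_image_add[of t q] by auto
  moreover have "flow_image G (t + q) (sublevel C) \<subseteq> flow_image G q (sublevel C)" if "0 < q" for q
    using t that by (intro sublevel_nested) auto
  ultimately show "y \<in> omega_limit C" unfolding omega_limit_def by blast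
next
  fix t y assume t: "0 \<le> (t::real)" and y: "y \<in> omega_limit C"
  have "\<exists>g\<in>G. g 0 \<in> sublevel C \<and> y = g (real n + 1 + t)" for n :: nat
  proof -
    have "y \<in> flow_image G (real n + 1 + t) (sublevel C)" using y t by (auto simp: omega_limit_def)
    then show ?thesis by (auto simp: flow_image_def)
  qed
  then obtain g where g: "\<And>n. g n \<in> G" "\<And>n. g n 0 \<in> sublevel C" "\<And>n. y = g n (real n + 1 + t)" by metis
  obtain r k where rk: "strict_mono r" "k \<in> G" "\<And>t. 0 \<le> t \<Longrightarrow> k t \<in> omega_limit C"
    "\<And>t. 0 \<le> t \<Longrightarrow> (\<lambda>n. d (g (r n) (real (r n) + 1 + t)) (k t)) \<longlonglongrightarrow> 0"
    using late_trajectories[of g C "\<lambda>n. real n + 1"] g by auto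
  have "(\<lambda>n::nat. d y (k t)) \<longlonglongrightarrow> 0" using rk(4)[OF t] g(3)[symmetric] by simp
  then have "d y (k t) = 0" by (simp add: LIMSEQ_const_iff)
  moreover have "y \<in> X" using g(3)[of 0] in_X[OF g(1)[of 0], of "real 0 + 1 + t"] t by simp
  ultimately have "y = k t" using in_X[OF rk(2) t] zero by blast
  then show "y \<in> flow_image G t (omega_limit C)" using rk by (auto simp: flow_image_def)
qed

lemma omega_limit_subset: "omega_limit C \<subseteq> X"
  using sublevel_invariant[of 1 C] by (auto simp: omega_limit_def sublevel_def dest: spec[of _ 1])

lemma omega_limit_compact: "compactin mtopology (omega_limit C)"
  unfolding compactin_sequentially
proof (intro conjI allI impI omega_limit_subset)
  fix y :: "nat \<Rightarrow> 'x" assume y: "range y \<subseteq> omega_limit C"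
  have "\<exists>g\<in>G. g 0 \<in> sublevel C \<and> y n = g (real n + 1)" for n :: nat
  proof -
    have "y n \<in> omega_limit C" using y by blast
    then have "y n \<in> flow_image G (real n + 1) (sublevel C)" by (simp add: omega_limit_def)
    then show ?thesis by (auto simp: flow_image_def)
  qed
  then obtain g where g: "\<And>n. g n \<in> G" "\<And>n. g n 0 \<in> sublevel C" "\<And>n. y n = g n (real n + 1)" by metis
  obtain r k where rk: "strict_mono r" "k \<in> G" "\<And>t. 0 \<le> t \<Longrightarrow> k t \<in> omega_limit C"
    "\<And>t. 0 \<le> t \<Longrightarrow> (\<lambda>n. d (g (r n) (real (r n) + 1 + t)) (k t)) \<longlonglongrightarrow> 0"
    using late_trajectories[of g C "\<lambda>n. real n + 1"] g by auto
  have "limitin mtopology (y \<circ> r) (k 0) sequentially"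
    using rk(4)[of 0] g(3) y omega_limit_subset[of C] in_X[OF rk(2)]
    by (auto simp: limitin_metric_dist_null intro!: always_eventually)
  then show "\<exists>l r. l \<in> omega_limit C \<and> strict_mono r \<and> limitin mtopology (y \<circ> r) l sequentially"
    using rk by blast
qed

lemma omega_limit_attracts_sublevel:
  assumes "0 < e"
  shows "\<exists>t0\<ge>0. \<forall>t\<ge>t0. \<forall>y\<in>flow_image G t (sublevel C). \<exists>a\<in>omega_limit C. d y a < e"
proof (rule ccontr)
  assume neg: "\<not> ?thesis"
  have "\<exists>s g. real n + 1 \<le> s \<and> g \<in> G \<and> g 0 \<in> sublevel C \<and> (\<forall>a\<in>omega_limit C. \<not> d (g s) a < e)" for n :: nat
  proof -
    obtain s y where "s \<ge> real n + 1" "y \<in> flow_image G s (sublevel C)" "\<not> (\<exists>a\<in>omega_limit C. d y a < e)"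
      using neg[simplified, rule_format, of "real n + 1"] by auto
    then show ?thesis by (auto simp: flow_image_def)
  qed
  then obtain s g where g: "\<And>n. real n + 1 \<le> s n" "\<And>n. g n \<in> G" "\<And>n. g n 0 \<in> sublevel C"
    "\<And>n a. a \<in> omega_limit C \<Longrightarrow> \<not> d (g n (s n)) a < e" by metis
  obtain r k where rk: "strict_mono r" "k \<in> G" "\<And>t. 0 \<le> t \<Longrightarrow> k t \<in> omega_limit C"
    "\<And>t. 0 \<le> t \<Longrightarrow> (\<lambda>n. d (g (r n) (s (r n) + t)) (k t)) \<longlonglongrightarrow> 0"
    using late_trajectories[of g C s] g(1-3) by auto
  have "\<forall>\<^sub>F n in sequentially. d (g (r n) (s (r n) + 0)) (k 0) < e"
    using rk(4)[of 0] assms by (intro order_tendstoD(2)) auto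
  then obtain n where "d (g (r n) (s (r n))) (k 0) < e" by (auto simp: eventually_sequentially)
  then show False using g(4) rk(3)[of 0] by auto
qed

section \<open>Existence, uniqueness and stability of the attractor\<close>

lemma attracts_iff:
  "attracts d G A E \<longleftrightarrow> (\<forall>e>0. \<exists>t0\<ge>0. \<forall>t\<ge>t0. \<forall>y\<in>flow_image G t E. \<exists>a\<in>A. d y a < e)"
proof
  assume a: "attracts d G A E"
  show "\<forall>e>0. \<exists>t0\<ge>0. \<forall>t\<ge>t0. \<forall>y\<in>flow_image G t E. \<exists>a\<in>A. d y a < e"
  proof (intro allI impI)
    fix e :: real assume "0 < e"
    then have "\<forall>\<^sub>F t in at_top. excess d (flow_image G t E) A < ennreal e"
      using a unfolding attracts_def by (intro order_tendstoD(2)) auto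
    then obtain t1 where t1: "\<And>t. t \<ge> t1 \<Longrightarrow> excess d (flow_image G t E) A < ennreal e"
      unfolding eventually_at_top_linorder by blast
    show "\<exists>t0\<ge>0. \<forall>t\<ge>t0. \<forall>y\<in>flow_image G t E. \<exists>a\<in>A. d y a < e"
      by (rule exI[of _ "max 0 t1"]) (use t1 excess_lessD in fastforce)
  qed
next
  assume *: "\<forall>e>0. \<exists>t0\<ge>0. \<forall>t\<ge>t0. \<forall>y\<in>flow_image G t E. \<exists>a\<in>A. d y a < e"
  show "attracts d G A E" unfolding attracts_def
  proof (rule order_tendstoI)
    fix l :: ennreal assume "0 < l"
    then have "\<exists>e>0. ennreal e < l"
    proof (cases l rule: ennreal_cases)
      case (real c)
      then show ?thesis using \<open>0 < l\<close> by (intro exI[of _ "c/2"]) (auto intro!: ennreal_lessI)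
    qed (auto intro: exI[of _ 1])
    then obtain e where e: "0 < e" "ennreal e < l" by blast
    obtain t0 where "\<And>t y. t \<ge> t0 \<Longrightarrow> y \<in> flow_image G t E \<Longrightarrow> \<exists>a\<in>A. d y a < e" using * e(1) by blast
    then have "\<forall>t\<ge>t0. excess d (flow_image G t E) A \<le> ennreal e"
      by (intro allI impI excess_le) (blast intro: less_imp_le)
    then show "\<forall>\<^sub>F t in at_top. excess d (flow_image G t E) A < l"
      unfolding eventually_at_top_linorder using e(2) by (blast intro: order_le_less_trans)
  qed simp
qed

text \<open>The level \<open>C0\<close> absorbs every bounded set, so the attraction of this one
  sublevel suffices, delayed by the entry time \<open>tB\<close>.\<close>

lemma global_attractor_exists: "\<exists>A. global_attractor X d G A"
proof -
  obtain C0 where C0: "\<And>B. mbounded B \<Longrightarrow> \<exists>tB\<ge>0. \<forall>t\<ge>tB. flow_image G t B \<subseteq> sublevel C0"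
    using V_absorbing unfolding sublevel_def by metis
  have "attracts d G (omega_limit C0) B" if B: "mbounded B" for B
    unfolding attracts_iff
  proof (intro allI impI)
    fix e :: real assume "0 < e"
    then obtain t0 where t0: "t0 \<ge> 0" "\<And>t y. t \<ge> t0 \<Longrightarrow> y \<in> flow_image G t (sublevel C0) \<Longrightarrow> \<exists>a\<in>omega_limit C0. d y a < e"
      using omega_limit_attracts_sublevel by blast
    obtain tB where tB: "tB \<ge> 0" "flow_image G tB B \<subseteq> sublevel C0" using C0[OF B] by blast
    have "flow_image G t B \<subseteq> flow_image G (t - tB) (sublevel C0)" if "t \<ge> t0 + tB" for t
    proof -
      have "flow_image G t B = flow_image G (t - tB) (flow_image G tB B)"
        using flow_image_add[of "t - tB" tB B] that t0(1) tB(1) by simp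
      then show ?thesis using flow_image_mono[OF tB(2), of G "t - tB"] by simp
    qed
    then have "\<exists>a\<in>omega_limit C0. d y a < e" if "t \<ge> t0 + tB" "y \<in> flow_image G t B" for t y
      using that by (intro t0(2)[of "t - tB"]) auto
    then show "\<exists>t0\<ge>0. \<forall>t\<ge>t0. \<forall>y\<in>flow_image G t B. \<exists>a\<in>omega_limit C0. d y a < e"
      using t0(1) tB(1) by (intro exI[of _ "t0 + tB"]) auto
  qed
  then show ?thesis unfolding global_attractor_def
    using omega_limit_subset omega_limit_compact omega_limit_invariant by blast
qed

lemma compact_near_imp_mem:
  assumes A: "compactin mtopology A" and y: "y \<in> X" and near: "\<And>e. 0 < e \<Longrightarrow> \<exists>a\<in>A. d y a < e"
  shows "y \<in> A"
proof -
  have "\<exists>a\<in>A. d y a < 1 / real (Suc n)" for n using near[of "1 / real (Suc n)"] by simp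
  then obtain a where a: "\<And>n. a n \<in> A" "\<And>n. d y (a n) < 1 / real (Suc n)" by metis
  obtain l r where l: "l \<in> A" "strict_mono r" "limitin mtopology (a \<circ> r) l sequentially"
    using A a(1) unfolding compactin_sequentially by blast
  have sub: "A \<subseteq> X" using A by (simp add: compactin_sequentially)
  have "(\<lambda>n. d (a n) y) \<longlonglongrightarrow> 0"
  proof (rule tendsto_sandwich[of "\<lambda>_. 0"])
    show "\<forall>\<^sub>F n in sequentially. d (a n) y \<le> 1 / real (Suc n)"
      using a(2) by (auto simp: commute intro!: always_eventually less_imp_le)
    show "(\<lambda>n. 1 / real (Suc n)) \<longlonglongrightarrow> 0" using LIMSEQ_inverse_real_of_nat by (simp add: inverse_eq_divide)
  qed auto
  from LIMSEQ_subseq_LIMSEQ[OF this l(2)] have "(\<lambda>n. d (a (r n)) y) \<longlonglongrightarrow> 0" by (simp add: o_def)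
  moreover have "(\<lambda>n. d (a (r n)) l) \<longlonglongrightarrow> 0" using l(3) by (simp add: limitin_metric_dist_null o_def)
  ultimately have "y = l" using a(1) sub l(1) y by (intro limit_unique[of "\<lambda>n. a (r n)"]) auto
  then show ?thesis using l(1) by simp
qed

text \<open>\<open>A'\<close> is bounded, so \<open>A\<close> attracts it, while invariance keeps it
  in place: each of its points is arbitrarily close to the compact set \<open>A\<close>. Exchanging
  the roles gives uniqueness.\<close>

lemma global_attractor_least:
  assumes A: "global_attractor X d G A" and A': "global_attractor X d G A'"
  shows "A' \<subseteq> A"
proof
  fix y assume y: "y \<in> A'"
  have "mbounded A'" using A' compactin_imp_mbounded by (auto simp: global_attractor_def)
  then have att: "attracts d G A A'" using A by (simp add: global_attractor_def)
  show "y \<in> A"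
  proof (rule compact_near_imp_mem)
    show "compactin mtopology A" "y \<in> X" using A A' y by (auto simp: global_attractor_def)
    fix e :: real assume "0 < e"
    then obtain t0 where "t0 \<ge> 0" "\<And>y. y \<in> flow_image G t0 A' \<Longrightarrow> \<exists>a\<in>A. d y a < e"
      using att unfolding attracts_iff by blast
    moreover have "flow_image G t0 A' = A'" using A' \<open>t0 \<ge> 0\<close> by (simp add: global_attractor_def flow_invariant_def)
    ultimately show "\<exists>a\<in>A. d y a < e" using y by simp
  qed
qed

text \<open>By contradiction: take trajectories starting ever closer to \<open>A\<close> that are
  farther than \<open>\<epsilon>\<close> from \<open>A\<close> at times \<open>t n\<close>.
  Attraction of a bounded neighbourhood of \<open>A\<close> keeps these times bounded, so a
  subsequence converges at moving times to a trajectory issuing from \<open>A\<close>, and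
  invariance places its value at the limit time in \<open>A\<close>.\<close>

lemma global_attractor_Lyapunov_stable:
  assumes A: "global_attractor X d G A"
  shows "Lyapunov_stable X d G A"
  unfolding Lyapunov_stable_def
proof (intro allI impI, rule ccontr)
  fix \<epsilon> :: real assume "0 < \<epsilon>"
  assume neg: "\<not> (\<exists>\<delta>>0. \<forall>E\<subseteq>X. excess d E A \<le> ennreal \<delta> \<longrightarrow> (\<forall>t\<ge>0. excess d (flow_image G t E) A \<le> ennreal \<epsilon>))"
  have "\<exists>g t a. g \<in> G \<and> 0 \<le> t \<and> a \<in> A \<and> d (g 0) a < 1 / real (Suc n) \<and> (\<forall>b\<in>A. \<epsilon> < d (g t) b)" for n
  proof -
    \<comment> \<open>Smaller than \<open>1 / real (Suc n)\<close>, so the weak inequality on the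
      excess becomes the strict one that yields a nearby point of \<open>A\<close>.\<close>
    define \<delta> where "\<delta> = 1 / real (Suc (Suc n))"
    have \<delta>: "0 < \<delta>" "\<delta> < 1 / real (Suc n)" by (simp_all add: \<delta>_def divide_strict_left_mono)
    obtain E t where E: "E \<subseteq> X" "excess d E A \<le> ennreal \<delta>" "t \<ge> 0" "\<not> excess d (flow_image G t E) A \<le> ennreal \<epsilon>"
      using neg \<delta>(1) by blast
    have "\<exists>y\<in>flow_image G t E. \<forall>b\<in>A. \<not> d y b \<le> \<epsilon>"
    proof (rule ccontr)
      assume "\<not> ?thesis"
      then have "excess d (flow_image G t E) A \<le> ennreal \<epsilon>" by (intro excess_le) blast
      with E(4) show False by contradiction
    qed
    then obtain y where y: "y \<in> flow_image G t E" "\<And>b. b \<in> A \<Longrightarrow> \<not> d y b \<le> \<epsilon>" by blast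
    obtain g where g: "g \<in> G" "g 0 \<in> E" "y = g t" using y(1) by (auto simp: flow_image_def)
    have "excess d E A < ennreal (1 / real (Suc n))"
      by (rule order_le_less_trans[OF E(2)], rule ennreal_lessI) (use \<delta> in auto)
    from excess_lessD[OF this g(2)] obtain a where "a \<in> A" "d (g 0) a < 1 / real (Suc n)" by blast
    moreover have "\<forall>b\<in>A. \<epsilon> < d (g t) b" using y(2) g(3) by (simp add: not_le)
    ultimately show ?thesis using g(1) E(3) by blast
  qed
  then obtain g t a where g: "\<And>n. g n \<in> G" "\<And>n. 0 \<le> t n" "\<And>n. a n \<in> A" "\<And>n. d (g n 0) (a n) < 1 / real (Suc n)"
    "\<And>n b. b \<in> A \<Longrightarrow> \<epsilon> < d (g n (t n)) b" by metis
  have comp: "compactin mtopology A" and sub: "A \<subseteq> X" using A by (auto simp: global_attractor_def)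
  \<comment> \<open>Bounded, and containing all initial points since
    \<open>1 / real (Suc n) \<le> 1\<close>.\<close>
  define B where "B = {x\<in>X. \<exists>a\<in>A. d x a \<le> 1}"
  have "mbounded A" using comp by (rule compactin_imp_mbounded)
  then obtain b0 R where "A \<subseteq> mcball b0 R" unfolding mbounded_def by blast
  then have "B \<subseteq> mcball b0 (R + 1)"
  proof (intro subsetI)
    fix x assume "x \<in> B"
    then obtain a where "x \<in> X" "a \<in> A" "d x a \<le> 1" by (auto simp: B_def)
    moreover then have "a \<in> X" "b0 \<in> X" "d b0 a \<le> R" using \<open>A \<subseteq> mcball b0 R\<close> by (auto simp: in_mcball)
    ultimately show "x \<in> mcball b0 (R + 1)" using triangle[of b0 a x] commute[of x a] by (simp add: in_mcball)
  qed
  then have "mbounded B" unfolding mbounded_def by blast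
  then obtain t0 where t0: "\<And>t y. t \<ge> t0 \<Longrightarrow> y \<in> flow_image G t B \<Longrightarrow> \<exists>a\<in>A. d y a < \<epsilon>"
    using A \<open>0 < \<epsilon>\<close> unfolding global_attractor_def attracts_iff by blast
  have tn: "t n \<in> {0..t0}" for n
  proof (rule ccontr)
    assume "t n \<notin> {0..t0}"
    moreover have "d (g n 0) (a n) \<le> 1" using g(4)[of n] by (rule less_imp_le[OF order_less_le_trans]) simp
    then have "g n (t n) \<in> flow_image G (t n) B"
      using g(1,3)[of n] in_X[OF g(1)[of n], of 0] by (auto simp: flow_image_def B_def)
    ultimately obtain b where "b \<in> A" "d (g n (t n)) b < \<epsilon>" using t0[of "t n"] g(2)[of n] by auto
    then show False using g(5)[of b n] by simp
  qed
  obtain l r1 where l: "l \<in> A" "strict_mono r1" "limitin mtopology (a \<circ> r1) l sequentially"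
    using comp g(3) unfolding compactin_sequentially by blast
  obtain t' r2 where r2: "t' \<in> {0..t0}" "strict_mono r2" "((t \<circ> r1) \<circ> r2) \<longlonglongrightarrow> t'"
    using compact_imp_seq_compact[OF compact_Icc[of 0 t0]] tn unfolding seq_compact_def
    by (metis comp_apply)
  define r where "r = r1 \<circ> r2"
  have r: "strict_mono r" unfolding r_def using l(2) r2(2) by (rule strict_mono_o)
  have lX: "l \<in> X" using l(1) sub by blast
  have "(\<lambda>n. d (g (r n) 0) l) \<longlonglongrightarrow> 0"
  proof (rule tendsto_sandwich[of "\<lambda>_. 0"])
    show "\<forall>\<^sub>F n in sequentially. d (g (r n) 0) l \<le> 1 / real (Suc (r n)) + d (a (r n)) l"
    proof (intro always_eventually allI)
      fix n
      have "d (g (r n) 0) l \<le> d (g (r n) 0) (a (r n)) + d (a (r n)) l"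
        using in_X[OF g(1)] g(3) sub lX by (intro triangle) auto
      then show "d (g (r n) 0) l \<le> 1 / real (Suc (r n)) + d (a (r n)) l" using g(4)[of "r n"] by linarith
    qed
    have "(\<lambda>n. 1 / real (Suc n)) \<longlonglongrightarrow> 0" using LIMSEQ_inverse_real_of_nat by (simp add: inverse_eq_divide)
    from LIMSEQ_subseq_LIMSEQ[OF this r] have "(\<lambda>n. 1 / real (Suc (r n))) \<longlonglongrightarrow> 0" by (simp add: o_def)
    moreover have "(\<lambda>n. d (a (r1 n)) l) \<longlonglongrightarrow> 0" using l(3) by (simp add: limitin_metric_dist_null o_def)
    from LIMSEQ_subseq_LIMSEQ[OF this r2(2)] have "(\<lambda>n. d (a (r n)) l) \<longlonglongrightarrow> 0" by (simp add: o_def r_def)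
    ultimately show "(\<lambda>n. 1 / real (Suc (r n)) + d (a (r n)) l) \<longlonglongrightarrow> 0" using tendsto_add by fastforce
  qed auto
  then obtain r' g' where r': "strict_mono r'" "g' \<in> G" "g' 0 = l"
    "\<And>t \<tau>. 0 \<le> t \<Longrightarrow> (\<And>n. 0 \<le> \<tau> n) \<Longrightarrow> \<tau> \<longlonglongrightarrow> t \<Longrightarrow> (\<lambda>n. d (g (r (r' n)) (\<tau> n)) (g' t)) \<longlonglongrightarrow> 0"
    using compact_initial[of "\<lambda>n. g (r n)" l] g(1) lX by metis
  have "(\<lambda>n. t (r (r' n))) \<longlonglongrightarrow> t'" using LIMSEQ_subseq_LIMSEQ[OF r2(3) r'(1)] by (simp add: o_def r_def)
  then have "(\<lambda>n. d (g (r (r' n)) (t (r (r' n)))) (g' t')) \<longlonglongrightarrow> 0" using r2(1) g(2) by (intro r'(4)) auto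
  then have "\<forall>\<^sub>F n in sequentially. d (g (r (r' n)) (t (r (r' n)))) (g' t') < \<epsilon>" using \<open>0 < \<epsilon>\<close> by (intro order_tendstoD(2)) auto
  then obtain n where "d (g (r (r' n)) (t (r (r' n)))) (g' t') < \<epsilon>" by (auto simp: eventually_sequentially)
  moreover have "g' t' \<in> flow_image G t' A" using r'(2,3) l(1) by (auto simp: flow_image_def)
  then have "g' t' \<in> A" using A r2(1) by (simp add: global_attractor_def flow_invariant_def)
  ultimately show False using g(5)[of "g' t'" "r (r' n)"] by simp
qed

end

section \<open>The energy functional\<close>

lemma lower_semicont_open:
  fixes f :: "'a::topological_space \<Rightarrow> ereal"
  assumes "lower_semicont f"
  shows "open {x. y < f x}"
proof (subst open_subopen, intro ballI)
  fix x assume x: "x \<in> {x. y < f x}"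
  have "f x \<le> Liminf (at x) f" using assms by (simp add: lower_semicont_def)
  then have "\<forall>\<^sub>F z in at x. y < f z" using x by (auto simp: le_Liminf_iff)
  then have "\<forall>\<^sub>F z in nhds x. y < f z" using x by (simp add: eventually_nhds_conv_at)
  then show "\<exists>T. open T \<and> x \<in> T \<and> T \<subseteq> {x. y < f x}" by (auto simp: eventually_nhds)
qed

lemma lower_semicont_closed: "lower_semicont f \<Longrightarrow> closed {x. f x \<le> y}"
  using lower_semicont_open[of f y] by (simp add: closed_def Compl_eq not_le)

lemma lower_semicont_measurable: "lower_semicont f \<Longrightarrow> f \<in> borel_measurable borel"
  unfolding borel_measurable_ereal_iff_Ioi
  using lower_semicont_open[of f] by (auto simp: vimage_def)

lemma open_superlevel_add_continuous:
  fixes f :: "'a::topological_space \<Rightarrow> ereal"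
  assumes f: "lower_semicont f" and c: "continuous_on UNIV c"
  shows "open {x. ereal y < f x + ereal (c x)}"
proof (subst open_subopen, intro ballI)
  fix x assume "x \<in> {x. ereal y < f x + ereal (c x)}"
  then have "ereal (y - c x) < f x" by (cases "f x") auto
  then obtain z where z: "ereal (y - c x) < ereal z" "ereal z < f x" using ereal_dense2 by blast
  have "open {x. ereal z < f x}" by (rule lower_semicont_open[OF f])
  moreover have "open {x. y - z < c x}" using c by (intro open_Collect_less continuous_on_const)
  ultimately have "open ({x. ereal z < f x} \<inter> {x. y - z < c x})" by (rule open_Int)
  moreover have "{x. ereal z < f x} \<inter> {x. y - z < c x} \<subseteq> {x. ereal y < f x + ereal (c x)}"
  proof
    fix v assume "v \<in> {x. ereal z < f x} \<inter> {x. y - z < c x}"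
    then show "v \<in> {x. ereal y < f x + ereal (c x)}" by (cases "f v") auto
  qed
  ultimately show "\<exists>T. open T \<and> x \<in> T \<and> T \<subseteq> {x. ereal y < f x + ereal (c x)}" using z by fastforce
qed

text \<open>If no point of \<open>K\<close> were minimal, the open sets
  \<open>{x. h k < h x}\<close> with \<open>k\<close> in \<open>K\<close> would cover
  \<open>K\<close>; among the finitely many \<open>k\<close> of a subcover, one with the smallest
  value lies in none of the selected sets.\<close>

lemma compact_attains_inf_lower_semicont:
  fixes h :: "'a::topological_space \<Rightarrow> ereal"
  assumes K: "compact K" "K \<noteq> {}" and op: "\<And>y. open {x. y < h x}"
  shows "\<exists>x\<in>K. \<forall>y\<in>K. h x \<le> h y"
proof (rule ccontr)
  assume neg: "\<not> ?thesis"
  then have "K \<subseteq> (\<Union>k\<in>K. {x. h k < h x})" by (auto simp: not_le)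
  then obtain K' where K': "K' \<subseteq> K" "finite K'" "K \<subseteq> (\<Union>k\<in>K'. {x. h k < h x})"
    using compactE_image[OF K(1), of K "\<lambda>k. {x. h k < h x}"] op by metis
  then have "K' \<noteq> {}" using K(2) by auto
  then have "Min (h ` K') \<in> h ` K'" using K'(2) by (intro Min_in) auto
  then obtain k where k: "k \<in> K'" "h k = Min (h ` K')" by auto
  then obtain k' where "k' \<in> K'" "h k' < h k" using K'(1,3) by blast
  then show False using k(2) K'(2) by (metis Min_le finite_imageI imageI leD)
qed

text \<open>Only one of the two points has to lie in \<open>K\<close>, which is more than uniform
  continuity on \<open>K\<close>. It is needed for segments, which may leave a compact set of curve
  values.\<close>

lemma continuous_uniformly_near_compact:
  fixes F :: "'a::metric_space \<Rightarrow> 'b::metric_space"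
  assumes F: "continuous_on UNIV F" and K: "compact K" and "e > 0"
  shows "\<exists>\<eta>>0. \<forall>x\<in>K. \<forall>y. dist y x < \<eta> \<longrightarrow> dist (F y) (F x) < e"
proof (rule ccontr)
  assume "\<not> ?thesis"
  then have "\<exists>x\<in>K. \<exists>y. dist y x < 1 / real (Suc n) \<and> \<not> dist (F y) (F x) < e" for n by force
  then obtain x y where xy: "\<And>n. x n \<in> K" "\<And>n. dist (y n) (x n) < 1 / real (Suc n)" "\<And>n. \<not> dist (F (y n)) (F (x n)) < e"
    by metis
  obtain l r where l: "l \<in> K" "strict_mono r" "(x \<circ> r) \<longlonglongrightarrow> l"
    using compact_imp_seq_compact[OF K] xy(1) unfolding seq_compact_def by blast
  have "(\<lambda>n. dist (y n) (x n)) \<longlonglongrightarrow> 0"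
  proof (rule tendsto_sandwich[of "\<lambda>_. 0"])
    show "\<forall>\<^sub>F n in sequentially. dist (y n) (x n) \<le> 1 / real (Suc n)"
      using xy(2) by (auto intro!: always_eventually less_imp_le)
    show "(\<lambda>n. 1 / real (Suc n)) \<longlonglongrightarrow> 0" using LIMSEQ_inverse_real_of_nat by (simp add: inverse_eq_divide)
  qed auto
  from LIMSEQ_subseq_LIMSEQ[OF this l(2)] have d: "(\<lambda>n. dist (y (r n)) (x (r n))) \<longlonglongrightarrow> 0" by (simp add: o_def)
  have xl: "(\<lambda>n. x (r n)) \<longlonglongrightarrow> l" using l(3) by (simp add: o_def)
  have "(\<lambda>n. dist (y (r n)) l) \<longlonglongrightarrow> 0"
  proof (rule tendsto_sandwich[of "\<lambda>_. 0"])
    show "\<forall>\<^sub>F n in sequentially. dist (y (r n)) l \<le> dist (y (r n)) (x (r n)) + dist (x (r n)) l"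
      by (intro always_eventually allI dist_triangle)
    show "(\<lambda>n. dist (y (r n)) (x (r n)) + dist (x (r n)) l) \<longlonglongrightarrow> 0"
      using tendsto_add[OF d xl[unfolded tendsto_dist_iff[of _ l]]] by simp
  qed auto
  then have yl: "(\<lambda>n. y (r n)) \<longlonglongrightarrow> l" by (rule tendsto_dist_iff[THEN iffD2])
  have "isCont F l" using F by (simp add: continuous_on_eq_continuous_at)
  then have "(\<lambda>n. F (x (r n))) \<longlonglongrightarrow> F l" "(\<lambda>n. F (y (r n))) \<longlonglongrightarrow> F l"
    using xl yl isCont_tendsto_compose by blast+
  then have "(\<lambda>n. dist (F (y (r n))) (F (x (r n)))) \<longlonglongrightarrow> dist (F l) (F l)" by (intro tendsto_dist)
  then have "\<forall>\<^sub>F n in sequentially. dist (F (y (r n))) (F (x (r n))) < e"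
    using \<open>e > 0\<close> by (intro order_tendstoD(2)) auto
  then show False using xy(3) by (auto simp: eventually_sequentially)
qed

locale gradient_system =
  fixes f :: "'a::{real_inner, banach, second_countable_topology} \<Rightarrow> ereal"
    and p :: "'a \<Rightarrow> real" and F :: "'a \<Rightarrow> 'a" and \<kappa> :: real
  assumes proper: "proper_fun f" and lsc: "lower_semicont f" and conv: "convex_fun f"
    and grad: "GDERIV p v :> F v" and F_cont: "continuous_on UNIV F"
    and compact_sublevels: "compact {v. f v + ereal (p v) + ereal (\<kappa> * (norm v)\<^sup>2) \<le> ereal c}"
    and \<kappa>: "\<kappa> \<ge> 0"
    and coercive: "Liminf at_infinity (\<lambda>v. f v + ereal (p v)) = \<infinity>"
    and rest_bounded: "Metric_space.mbounded (eff_dom f) (dom_dist f) {v. \<exists>\<xi>\<in>subdifferential f v. \<xi> + F v = 0}"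
begin

abbreviation "D \<equiv> eff_dom f"
text \<open>Off \<open>D\<close>, where \<open>f\<close> is infinite, this is 0; upper bounds on
  \<open>r\<close> therefore carry information only together with membership in
  \<open>D\<close>.\<close>

definition r :: "'a \<Rightarrow> real" where "r x = real_of_ereal (f x)"
definition E :: "'a \<Rightarrow> real" where "E x = r x + p x"
text \<open>The integrand of the EVI. It is lower semicontinuous on \<open>D\<close>, and it differs
  from \<open>E\<close> by a continuous function of \<open>x\<close>, which makes it bounded on
  sublevels of \<open>E\<close>.\<close>

definition j :: "'a \<Rightarrow> 'a \<Rightarrow> real" where "j w x = r x + F x \<bullet> (x - w)"

lemma f_not_MInf: "f x \<noteq> - \<infinity>" using proper by (simp add: proper_fun_def)

lemma f_eq: "x \<in> D \<Longrightarrow> f x = ereal (r x)"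
  using f_not_MInf[of x] by (cases "f x") (auto simp: eff_dom_def r_def)

lemma f_le_iff: "f x \<le> ereal c \<longleftrightarrow> x \<in> D \<and> r x \<le> c"
  using f_not_MInf[of x] by (cases "f x") (auto simp: eff_dom_def r_def)

lemma D_nonempty: "D \<noteq> {}" using proper by (simp add: proper_fun_def)

lemma p_has_derivative: "(p has_derivative (\<lambda>h. h \<bullet> F v)) (at v)"
  using grad by (simp add: gderiv_def inner_commute)

lemma p_cont: "continuous_on S p"
  by (rule continuous_at_imp_continuous_on) (blast intro: has_derivative_continuous p_has_derivative)

lemma p_tendsto: "(x \<longlongrightarrow> l) Fi \<Longrightarrow> ((\<lambda>n. p (x n)) \<longlongrightarrow> p l) Fi"
  using p_cont[of UNIV] isCont_tendsto_compose[of l p x Fi] by (simp add: continuous_on_eq_continuous_at)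

lemma F_tendsto: "(x \<longlongrightarrow> l) Fi \<Longrightarrow> ((\<lambda>n. F (x n)) \<longlongrightarrow> F l) Fi"
  using F_cont isCont_tendsto_compose[of l F x Fi] by (simp add: continuous_on_eq_continuous_at)

lemma subdifferential_iff: "\<xi> \<in> subdifferential f u \<longleftrightarrow> u \<in> D \<and> (\<forall>w\<in>D. r u + \<xi> \<bullet> (w - u) \<le> r w)"
proof -
  have "f u + ereal (\<xi> \<bullet> (w - u)) \<le> f w \<longleftrightarrow> (w \<in> D \<longrightarrow> r u + \<xi> \<bullet> (w - u) \<le> r w)" if "u \<in> D" for w
  proof (cases "w \<in> D")
    case False
    then have "f w = \<infinity>" by (auto simp: eff_dom_def)
    then show ?thesis using False by simp
  qed (use that f_eq in simp)
  then show ?thesis by (auto simp: subdifferential_def)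
qed

lemma lsc_limit:
  assumes x: "xs \<longlonglongrightarrow> x" and "\<forall>\<^sub>F n in sequentially. xs n \<in> D \<and> r (xs n) \<le> c"
  shows "x \<in> D" "r x \<le> c"
proof -
  have "\<forall>\<^sub>F n in sequentially. xs n \<in> {x. f x \<le> ereal c}" using assms(2) by (simp add: f_le_iff)
  then have "x \<in> {x. f x \<le> ereal c}"
    using x lower_semicont_closed[OF lsc] by (metis Lim_in_closed_set sequentially_bot)
  then show "x \<in> D" "r x \<le> c" by (auto simp: f_le_iff)
qed

lemma lsc_eventually:
  assumes x: "(xs \<longlongrightarrow> x) Fi" and "x \<in> D" "c < r x"
  shows "\<forall>\<^sub>F n in Fi. xs n \<in> D \<longrightarrow> c < r (xs n)"
proof -
  have "\<forall>\<^sub>F n in Fi. xs n \<in> {x. ereal c < f x}"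
    using assms f_eq by (intro topological_tendstoD[OF x] lower_semicont_open[OF lsc]) simp
  then show ?thesis by eventually_elim (auto simp: f_eq)
qed

section \<open>Compactness, minimisers and upper bounds of the energy\<close>

lemma E_limit:
  assumes x: "xs \<longlonglongrightarrow> x" and le: "\<And>n. xs n \<in> D \<and> E (xs n) \<le> c n" and c: "c \<longlonglongrightarrow> c0"
  shows "x \<in> D" "E x \<le> c0"
proof -
  have lim: "(\<lambda>n. c n - p (xs n)) \<longlonglongrightarrow> c0 - p x" by (intro tendsto_diff c p_tendsto x)
  have *: "x \<in> D \<and> r x \<le> c0 - p x + e" if "e > 0" for e
  proof -
    have "\<forall>\<^sub>F n in sequentially. c n - p (xs n) < c0 - p x + e" using that by (intro order_tendstoD(2)[OF lim]) simp
    then have "\<forall>\<^sub>F n in sequentially. xs n \<in> D \<and> r (xs n) \<le> c0 - p x + e"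
    proof eventually_elim
      case (elim n)
      then show ?case using le[of n] by (simp add: E_def)
    qed
    from lsc_limit[OF x this] show ?thesis by simp
  qed
  show "x \<in> D" using *[of 1] by simp
  have "r x \<le> c0 - p x" by (rule field_le_epsilon) (use * in auto)
  then show "E x \<le> c0" by (simp add: E_def)
qed

text \<open>The compactness hypothesis concerns the energy plus \<open>\<kappa>\<close> times the
  squared norm. Coercivity confines a sublevel of \<open>E\<close> to a ball of radius
  \<open>b\<close>, where the extra term is at most \<open>\<kappa> * b\<^sup>2\<close>.\<close>

lemma compact_E: "compact {x\<in>D. E x \<le> c}"
proof -
  let ?K = "{x\<in>D. E x \<le> c}"
  have K: "?K = {x. f x + ereal (p x) \<le> ereal c}"
  proof (intro set_eqI)
    fix x show "x \<in> ?K \<longleftrightarrow> x \<in> {x. f x + ereal (p x) \<le> ereal c}"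
      using f_not_MInf[of x] by (cases "f x") (auto simp: eff_dom_def r_def E_def)
  qed
  have cl: "closed ?K" unfolding K
    using open_superlevel_add_continuous[OF lsc p_cont, of c] by (simp add: closed_def Compl_eq not_le)
  have "\<forall>\<^sub>F x in at_infinity. ereal c < f x + ereal (p x)"
    using coercive le_Liminf_iff[of \<infinity> at_infinity "\<lambda>v. f v + ereal (p v)"] by simp
  then obtain b where b: "\<And>x. b \<le> norm x \<Longrightarrow> ereal c < f x + ereal (p x)" by (auto simp: eventually_at_infinity)
  have "?K \<subseteq> {v. f v + ereal (p v) + ereal (\<kappa> * (norm v)\<^sup>2) \<le> ereal (c + \<kappa> * b\<^sup>2)}"
  proof
    fix x assume x: "x \<in> ?K"
    then have "norm x < b" using b[of x] unfolding K by (auto simp: not_less[symmetric])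
    then have "\<kappa> * (norm x)\<^sup>2 \<le> \<kappa> * b\<^sup>2" using \<kappa> by (intro mult_left_mono power_mono) auto
    moreover have "f x + ereal (p x) \<le> ereal c" using x unfolding K by simp
    ultimately have "f x + ereal (p x) + ereal (\<kappa> * (norm x)\<^sup>2) \<le> ereal c + ereal (\<kappa> * b\<^sup>2)"
      by (intro add_mono) auto
    then show "x \<in> {v. f v + ereal (p v) + ereal (\<kappa> * (norm v)\<^sup>2) \<le> ereal (c + \<kappa> * b\<^sup>2)}" by simp
  qed
  then have "{v. f v + ereal (p v) + ereal (\<kappa> * (norm v)\<^sup>2) \<le> ereal (c + \<kappa> * b\<^sup>2)} \<inter> ?K = ?K"
    by (rule Int_absorb1)
  with compact_Int_closed[OF compact_sublevels[of "c + \<kappa> * b\<^sup>2"] cl] show ?thesis by simp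
qed

text \<open>Since \<open>c\<close> is nonnegative, points outside the sublevel of \<open>E\<close>
  at height \<open>E w + c w\<close> cannot beat \<open>w\<close>, so the minimum is sought on a
  compact set. Taking \<open>c = 0\<close> bounds \<open>E\<close> below; a quadratic
  \<open>c\<close> gives an Euler step.\<close>

lemma E_attains_inf:
  assumes c: "continuous_on UNIV c" "\<And>x. 0 \<le> c x" and w: "w \<in> D"
  obtains x where "x \<in> D" "\<And>y. y \<in> D \<Longrightarrow> E x + c x \<le> E y + c y"
proof -
  let ?K = "{x\<in>D. E x \<le> E w + c w}"
  let ?h = "\<lambda>x. f x + ereal (p x + c x)"
  have h: "?h x = ereal (E x + c x)" if "x \<in> D" for x using f_eq[OF that] by (simp add: E_def)
  have "open {x. ereal y < ?h x}" for y
    by (intro open_superlevel_add_continuous lsc continuous_intros p_cont c)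
  moreover have "{x. \<infinity> < ?h x} = {}" "{x. - \<infinity> < ?h x} = UNIV" using f_not_MInf by auto
  ultimately have "open {x. y < ?h x}" for y by (cases y) simp_all
  moreover have "w \<in> ?K" using w c(2)[of w] by simp
  ultimately obtain x where x: "x \<in> ?K" "\<And>y. y \<in> ?K \<Longrightarrow> ?h x \<le> ?h y"
    using compact_attains_inf_lower_semicont[OF compact_E, of _ ?h] by blast
  have "E x + c x \<le> E y + c y" if y: "y \<in> D" for y
  proof (cases "y \<in> ?K")
    case True
    then show ?thesis using x(2)[of y] x(1) h by simp
  next
    case False
    then show ?thesis using x(2)[OF \<open>w \<in> ?K\<close>] x(1) w y h c(2)[of y] by (simp add: not_le)
  qed
  then show thesis using that x(1) by blast
qed

lemma E_bounded_below: "\<exists>m. \<forall>x\<in>D. m \<le> E x"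
proof -
  obtain w where "w \<in> D" using D_nonempty by blast
  then obtain x where "\<And>y. y \<in> D \<Longrightarrow> E x + 0 \<le> E y + 0" using E_attains_inf[of "\<lambda>_. 0" w] by auto
  then show ?thesis by auto
qed

lemma convex_r:
  assumes "u \<in> D" "v \<in> D" "0 < s" "s < 1"
  shows "(1 - s) *\<^sub>R u + s *\<^sub>R v \<in> D" "r ((1 - s) *\<^sub>R u + s *\<^sub>R v) \<le> (1 - s) * r u + s * r v"
proof -
  have "f ((1 - s) *\<^sub>R u + s *\<^sub>R v) \<le> ereal (1 - s) * f u + ereal s * f v"
    using conv assms by (simp add: convex_fun_def)
  also have "\<dots> = ereal ((1 - s) * r u + s * r v)" using assms by (simp add: f_eq)
  finally show "(1 - s) *\<^sub>R u + s *\<^sub>R v \<in> D" "r ((1 - s) *\<^sub>R u + s *\<^sub>R v) \<le> (1 - s) * r u + s * r v"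
    by (auto simp: f_le_iff)
qed

text \<open>Since \<open>p\<close> is locally bounded, a small piece of the convex set on the left lies in a compact
  sublevel of \<open>E\<close>, and a homothety carries that piece onto the whole set.\<close>

lemma E_bounded_on_bounded: "\<exists>C. \<forall>x\<in>D. norm x \<le> R \<and> r x \<le> R \<longrightarrow> E x \<le> C"
proof (cases "\<exists>x0\<in>D. norm x0 \<le> R \<and> r x0 \<le> R")
  case True
  then obtain x0 where x0: "x0 \<in> D" "norm x0 \<le> R" "r x0 \<le> R" by blast
  have "isCont p x0" using p_cont[of UNIV] by (simp add: continuous_on_eq_continuous_at)
  then obtain \<rho> where \<rho>: "\<rho> > 0" "\<And>y. dist y x0 < \<rho> \<Longrightarrow> dist (p y) (p x0) < 1"
    unfolding continuous_at_eps_delta by (metis zero_less_one)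
  have R: "0 \<le> R" using x0(2) norm_ge_zero order_trans by blast
  \<comment> \<open>The points \<open>x\<close> and \<open>x0\<close> are at most
    \<open>2 * R\<close> apart, so this \<open>s\<close> brings the contracted point within
    \<open>\<rho>\<close> of \<open>x0\<close>, where \<open>p\<close> is under control.\<close>
  define s where "s = min (1/2) (\<rho> / (2 * R + 1) / 2)"
  have s: "0 < s" "s < 1" using \<rho>(1) R by (auto simp: s_def)
  have sR: "s * (2 * R) < \<rho>"
  proof -
    have "s \<le> \<rho> / (2 * R + 1) / 2" by (simp add: s_def)
    then have "s * (2 * R) \<le> (\<rho> / (2 * R + 1) / 2) * (2 * R)" using R by (intro mult_right_mono) auto
    also have "\<dots> = \<rho> * (R / (2 * R + 1))" using R by (simp add: field_simps)
    also have "\<dots> < \<rho> * 1" using \<rho>(1) R by (intro mult_strict_left_mono) auto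
    finally show ?thesis by simp
  qed
  let ?K = "{x\<in>D. E x \<le> R + p x0 + 1}"
  \<comment> \<open>\<open>p\<close> after the homothety with centre \<open>x0\<close> and ratio
    \<open>1/s\<close>, which undoes the contraction; being continuous, it is bounded on the compact
    \<open>?K\<close>.\<close>
  let ?q = "\<lambda>y. p (x0 + (1/s) *\<^sub>R (y - x0))"
  have "compact (?q ` ?K)"
    by (intro compact_continuous_image continuous_on_compose2[OF p_cont[of UNIV]] continuous_intros compact_E) auto
  then have "bounded (?q ` ?K)" by (rule compact_imp_bounded)
  then obtain M where M: "\<And>y. y \<in> ?K \<Longrightarrow> \<bar>?q y\<bar> \<le> M" unfolding bounded_iff real_norm_def by blast
  have "E x \<le> R + M" if x: "x \<in> D" "norm x \<le> R" "r x \<le> R" for x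
  proof -
    define y where "y = (1 - s) *\<^sub>R x0 + s *\<^sub>R x"
    have yD: "y \<in> D" "r y \<le> (1 - s) * r x0 + s * r x" unfolding y_def by (rule convex_r[OF x0(1) x(1) s])+
    have "(1 - s) * r x0 + s * r x \<le> (1 - s) * R + s * R"
      using s x0 x by (intro add_mono mult_left_mono) auto
    then have "r y \<le> R" using yD(2) by (simp add: algebra_simps)
    have yx: "y - x0 = s *\<^sub>R (x - x0)" by (simp add: y_def algebra_simps)
    have "dist y x0 = s * norm (x - x0)" using s by (simp add: dist_norm yx)
    also have "\<dots> \<le> s * (2 * R)" using s norm_triangle_ineq4[of x x0] x x0 by (intro mult_left_mono) auto
    finally have "dist (p y) (p x0) < 1" using sR by (intro \<rho>(2)) simp
    then have "E y \<le> R + p x0 + 1" using \<open>r y \<le> R\<close> by (simp add: E_def dist_real_def)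
    then have "\<bar>?q y\<bar> \<le> M" using M yD by simp
    moreover have "x0 + (1/s) *\<^sub>R (y - x0) = x" using s by (simp add: yx)
    ultimately show ?thesis using x by (simp add: E_def)
  qed
  then show ?thesis by blast
qed auto

text \<open>\<open>U\<close> is compared with points of the segment towards \<open>v\<close>.
  Convexity bounds the change of \<open>r\<close> there linearly, so only the smooth part has to be
  differentiated, from the right at 0. The conclusion is the Euler-Lagrange inclusion of the
  implicit step, tested with \<open>v\<close>.\<close>

lemma E_minimizer_inclusion:
  assumes \<tau>: "\<tau> > 0" and U: "U \<in> D" and min: "\<And>v. v \<in> D \<Longrightarrow> E U + (norm (U - w))\<^sup>2 / (2 * \<tau>) \<le> E v + (norm (v - w))\<^sup>2 / (2 * \<tau>)"
    and v: "v \<in> D"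
  shows "r U + (- (1/\<tau>) *\<^sub>R (U - w) - F U) \<bullet> (v - U) \<le> r v"
proof -
  define q where "q x = p x + (norm (x - w))\<^sup>2 / (2 * \<tau>)" for x
  define z where "z s = U + s *\<^sub>R (v - U)" for s
  have z0: "z 0 = U" by (simp add: z_def)
  have dz: "(z has_derivative (\<lambda>s. s *\<^sub>R (v - U))) (at 0)"
    unfolding z_def by (auto intro!: derivative_eq_intros)
  have "(p has_derivative (\<lambda>h. h \<bullet> F U)) (at (z 0))" unfolding z0 by (rule p_has_derivative)
  from has_derivative_compose[OF dz this]
  have d1: "((\<lambda>s. p (z s)) has_derivative (\<lambda>s. (s *\<^sub>R (v - U)) \<bullet> F U)) (at 0)" .
  have n: "(norm (z s - w))\<^sup>2 = (norm (U - w))\<^sup>2 + 2 * s * ((U - w) \<bullet> (v - U)) + s\<^sup>2 * (norm (v - U))\<^sup>2" for s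
    unfolding z_def power2_norm_eq_inner
    by (simp add: algebra_simps inner_commute power2_eq_square)
  have "((\<lambda>s. (norm (z s - w))\<^sup>2 / (2 * \<tau>)) has_real_derivative ((U - w) \<bullet> (v - U)) / \<tau>) (at 0)"
    unfolding n using \<tau> by (auto intro!: derivative_eq_intros simp: field_simps)
  moreover have "((\<lambda>s. p (z s)) has_real_derivative F U \<bullet> (v - U)) (at 0)"
    using d1 by (simp add: has_field_derivative_def inner_commute mult_commute_abs)
  ultimately have "((\<lambda>s. q (z s)) has_real_derivative F U \<bullet> (v - U) + ((U - w) \<bullet> (v - U)) / \<tau>) (at 0)"
    unfolding q_def by (intro DERIV_add)
  then have "((\<lambda>s. (q (z s) - q U) / s) \<longlongrightarrow> F U \<bullet> (v - U) + ((U - w) \<bullet> (v - U)) / \<tau>) (at_right 0)"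
    unfolding has_field_derivative_iff z0 by (auto intro: tendsto_within_subset)
  moreover have "\<forall>\<^sub>F s in at_right 0. r U - r v \<le> (q (z s) - q U) / s"
  proof -
    have "\<forall>\<^sub>F s in at_right (0::real). s \<in> {0<..<1}" by (rule eventually_at_right_real) simp
    then show ?thesis
    proof eventually_elim
      case (elim s)
      have zs: "z s = (1 - s) *\<^sub>R U + s *\<^sub>R v" by (simp add: z_def algebra_simps)
      have "z s \<in> D" "r (z s) \<le> (1 - s) * r U + s * r v" unfolding zs using convex_r[OF U v] elim by auto
      then have "s * (r U - r v) \<le> q (z s) - q U" using min[of "z s"] by (simp add: q_def E_def algebra_simps)
      then show ?case using elim by (simp add: field_simps)
    qed
  qed
  ultimately have "r U - r v \<le> F U \<bullet> (v - U) + ((U - w) \<bullet> (v - U)) / \<tau>"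
    by (intro tendsto_lowerbound[of _ _ "at_right (0::real)"]) auto
  then show ?thesis using \<tau> by (simp add: inner_diff_left)
qed

text \<open>Mean value theorem on the segment; continuity of \<open>F\<close>, uniform near
  \<open>K\<close>, makes the remainder uniform in the base point.\<close>

lemma p_taylor:
  assumes K: "compact K" and e: "e > 0"
  shows "\<exists>\<eta>>0. \<forall>x\<in>K. \<forall>y. norm (y - x) < \<eta> \<longrightarrow> \<bar>p y - p x - F x \<bullet> (y - x)\<bar> \<le> e * norm (y - x)"
proof -
  obtain \<eta> where \<eta>: "\<eta> > 0" "\<And>x y. x \<in> K \<Longrightarrow> dist y x < \<eta> \<Longrightarrow> dist (F y) (F x) < e"
    using continuous_uniformly_near_compact[OF F_cont K e] by blast
  have "\<bar>p y - p x - F x \<bullet> (y - x)\<bar> \<le> e * norm (y - x)" if x: "x \<in> K" and y: "norm (y - x) < \<eta>" for x y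
  proof -
    define h where "h s = p (x + s *\<^sub>R (y - x))" for s :: real
    have der: "(h has_real_derivative F (x + s *\<^sub>R (y - x)) \<bullet> (y - x)) (at s)" for s
    proof -
      have "((\<lambda>s. x + s *\<^sub>R (y - x)) has_derivative (\<lambda>t. t *\<^sub>R (y - x))) (at s)"
        by (auto intro!: derivative_eq_intros)
      from has_derivative_compose[OF this p_has_derivative]
      show ?thesis unfolding h_def by (simp add: has_field_derivative_def inner_commute mult_commute_abs)
    qed
    obtain s where s: "0 < s" "s < 1" "h 1 - h 0 = (1 - 0) * (F (x + s *\<^sub>R (y - x)) \<bullet> (y - x))"
      using MVT2[of 0 1 h "\<lambda>s. F (x + s *\<^sub>R (y - x)) \<bullet> (y - x)"] der by auto
    have "dist (x + s *\<^sub>R (y - x)) x \<le> norm (y - x)"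
      using s mult_right_mono[of s 1 "norm (y - x)"] by (simp add: dist_norm)
    then have "dist (F (x + s *\<^sub>R (y - x))) (F x) < e" using \<eta>(2)[OF x] y by simp
    then have "\<bar>(F (x + s *\<^sub>R (y - x)) - F x) \<bullet> (y - x)\<bar> \<le> e * norm (y - x)"
      using Cauchy_Schwarz_ineq2[of "F (x + s *\<^sub>R (y - x)) - F x" "y - x"]
        mult_right_mono[of "norm (F (x + s *\<^sub>R (y - x)) - F x)" e "norm (y - x)"] by (simp add: dist_norm)
    then show ?thesis using s(3) by (simp add: h_def inner_diff_left)
  qed
  then show ?thesis using \<eta>(1) by blast
qed

lemma r_measurable [measurable]: "r \<in> borel_measurable borel"
  unfolding r_def[abs_def] using lower_semicont_measurable[OF lsc] by (rule borel_measurable_real_of_ereal)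

lemma F_measurable [measurable]: "F \<in> borel_measurable borel"
  by (rule borel_measurable_continuous_onI[OF F_cont])

lemma j_measurable [measurable]: "j w \<in> borel_measurable borel"
  unfolding j_def[abs_def] by measurable

end

section \<open>Solutions and the evolution variational inequality\<close>

lemma set_borel_measurable_compose_continuous:
  fixes h :: "'a::topological_space \<Rightarrow> 'b::{banach, second_countable_topology}"
  assumes u: "continuous_on {0..} u" and h: "h \<in> borel_measurable borel" and a: "0 \<le> a"
  shows "set_borel_measurable lebesgue {a..b::real} (\<lambda>t. h (u t))"
proof -
  \<comment> \<open>Freezing \<open>u\<close> at its initial value for negative times gives a
    continuous function on the whole line, hence Borel measurability of the composition.\<close>
  have "continuous_on UNIV (\<lambda>t. u (max 0 t))"
    by (rule continuous_on_compose2[OF u]) (auto intro!: continuous_intros)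
  then have "(\<lambda>t. h (u (max 0 t))) \<in> borel_measurable borel"
    using measurable_compose[OF borel_measurable_continuous_onI h] by blast
  then have "(\<lambda>t. h (u (max 0 t))) \<in> borel_measurable lborel" by simp
  then have "(\<lambda>t. h (u (max 0 t))) \<in> borel_measurable lebesgue" by (rule measurable_completion)
  then have "(\<lambda>t. indicator {a..b} t *\<^sub>R h (u (max 0 t))) \<in> borel_measurable lebesgue"
    by (intro borel_measurable_scaleR borel_measurable_indicator) auto
  then show ?thesis unfolding set_borel_measurable_def
    by (rule measurable_cong[THEN iffD1, rotated]) (use a in \<open>auto simp: max_def split: split_indicator\<close>)
qed

lemma continuous_on_half_line:
  fixes u :: "real \<Rightarrow> 'b::topological_space"
  assumes "\<And>T. T > 0 \<Longrightarrow> continuous_on {0..T} u"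
  shows "continuous_on {0..} u"
  unfolding continuous_on_eq_continuous_within
proof
  fix x :: real assume x: "x \<in> {0..}"
  have "at x within {0..} = at x within {0..x + 1}"
    by (rule at_within_nhd[of x "{..<x + 1}"]) auto
  moreover have "continuous (at x within {0..x + 1}) u"
    using assms[of "x + 1"] x by (simp add: continuous_on_eq_continuous_within)
  ultimately show "continuous (at x within {0..}) u" by simp
qed

text \<open>Cauchy-Schwarz for the pairs \<open>(sqrt p, sqrt q)\<close> and
  \<open>(sqrt A, sqrt B)\<close>. It makes estimates of the form "squared distance at most elapsed
  time times energy drop" transitive, for solutions as well as for Euler steps.\<close>

lemma norm_sq_add_le:
  fixes x y :: "'a::real_normed_vector"
  assumes "(norm x)\<^sup>2 \<le> p * A" "(norm y)\<^sup>2 \<le> q * B" "0 \<le> p" "0 \<le> q" "0 \<le> A" "0 \<le> B"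
  shows "(norm (x + y))\<^sup>2 \<le> (p + q) * (A + B)"
proof -
  have "(2 * (norm x * norm y))\<^sup>2 \<le> 4 * ((p * A) * (q * B))"
    using mult_mono[OF assms(1,2)] assms by (simp add: power_mult_distrib)
  also have "\<dots> \<le> (p * B + q * A)\<^sup>2"
    using zero_le_power2[of "p * B - q * A"] by (simp add: power2_eq_square algebra_simps)
  finally have "2 * (norm x * norm y) \<le> p * B + q * A" by (rule power2_le_imp_le) (use assms in auto)
  moreover have "(norm (x + y))\<^sup>2 \<le> (norm x + norm y)\<^sup>2" by (intro power_mono norm_triangle_ineq) auto
  ultimately show ?thesis using assms(1,2) by (simp add: power2_sum algebra_simps)
qed

context gradient_system
begin

abbreviation "G \<equiv> gradient_flow_solutions f F"

text \<open>Integrability is part of the definition because the integral of a non-integrable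
  function is 0 by convention, which would make the inequality meaningless.\<close>

definition EVI :: "(real \<Rightarrow> 'a) \<Rightarrow> 'a \<Rightarrow> real \<Rightarrow> real \<Rightarrow> bool" where
  "EVI u w a b \<longleftrightarrow> set_integrable lebesgue {a..b} (\<lambda>t. j w (u t)) \<and>
    (norm (u b - w))\<^sup>2 / 2 - (norm (u a - w))\<^sup>2 / 2 + (LINT t:{a..b}|lebesgue. j w (u t)) \<le> (b - a) * r w"

text \<open>Collects what is used of a solution: its weak derivative \<open>g\<close> represents
  increments as integrals, and the subgradient is eliminated through
  \<open>\<xi> = - (g t + F (u t))\<close>. Membership in \<open>D\<close> is so far known only at
  time 0 and at almost every positive time.\<close>

lemma solution_derivative:
  assumes "u \<in> G"
  shows "\<exists>g. (\<forall>T>0. g \<in> L2_on T) \<and> (\<forall>T>0. has_integral_derivative u g T) \<and> continuous_on {0..} u \<and> u 0 \<in> D \<and>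
    (AE t in lebesgue. 0 < t \<longrightarrow> u t \<in> D \<and> (\<forall>w\<in>D. r (u t) \<le> r w + (g t + F (u t)) \<bullet> (w - u t)))"
proof -
  obtain g where H1: "\<And>T. T > 0 \<Longrightarrow> u \<in> H1_on T" and u0: "u 0 \<in> D"
    and w: "\<And>T. T > 0 \<Longrightarrow> has_L2_weak_derivative T u g"
    and ae: "AE t in lebesgue_on {0<..}. \<exists>\<xi>\<in>subdifferential f (u t). g t + \<xi> + F (u t) = 0"
    using assms by (auto simp: gradient_flow_solutions_def)
  have c: "continuous_on {0..T} u" if "T > 0" for T using H1[OF that] by (simp add: H1_on_def)
  have "AE t in lebesgue. t \<in> {0<..} \<longrightarrow> (\<exists>\<xi>\<in>subdifferential f (u t). g t + \<xi> + F (u t) = 0)"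
    using ae by (subst (asm) AE_restrict_space_iff) auto
  then have "AE t in lebesgue. 0 < t \<longrightarrow> u t \<in> D \<and> (\<forall>w\<in>D. r (u t) \<le> r w + (g t + F (u t)) \<bullet> (w - u t))"
  proof eventually_elim
    case (elim t)
    show ?case
    proof
      assume "0 < t"
      then obtain \<xi> where xi: "\<xi> \<in> subdifferential f (u t)" "g t + \<xi> + F (u t) = 0" using elim by auto
      from xi(2) have "\<xi> + (g t + F (u t)) = 0" by (simp add: algebra_simps)
      then have "\<xi> = - (g t + F (u t))" by (rule eq_neg_iff_add_eq_0[THEN iffD2])
      with xi(1) show "u t \<in> D \<and> (\<forall>w\<in>D. r (u t) \<le> r w + (g t + F (u t)) \<bullet> (w - u t))"
        by (auto simp: subdifferential_iff inner_diff_left inner_add_left)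
    qed
  qed
  then show ?thesis
    using w weak_imp_has_integral_derivative[OF w c] continuous_on_half_line[OF c] u0
    by (intro exI[of _ g]) (auto simp: has_L2_weak_derivative_def)
qed

lemma r_bounded_below_on_compact:
  assumes "compact K"
  shows "\<exists>c. \<forall>x\<in>K. c \<le> r x"
proof (cases "K = {}")
  case False
  then obtain x where x: "x \<in> K" "\<And>y. y \<in> K \<Longrightarrow> f x \<le> f y"
    using compact_attains_inf_lower_semicont[OF assms False lower_semicont_open[OF lsc]] by blast
  \<comment> \<open>The 0 covers points where \<open>f\<close> is infinite, at which
    \<open>r\<close> is 0.\<close>
  have "min 0 (r x) \<le> r y" if "y \<in> K" for y
    using x(2)[OF that] f_not_MInf[of x] f_not_MInf[of y] by (cases "f x"; cases "f y") (auto simp: r_def)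
  then show ?thesis by blast
qed simp

lemma set_integrable_inner_F:
  fixes u :: "real \<Rightarrow> 'a"
  assumes "continuous_on {0..} u" "0 \<le> a"
  shows "set_integrable lebesgue {a..b} (\<lambda>t. F (u t) \<bullet> (u t - w))"
  by (intro set_integrable_continuous_interval continuous_intros continuous_on_compose2[OF F_cont]
      continuous_on_subset[OF assms(1)]) (use assms(2) in auto)

text \<open>The subdifferential inequality is tested with \<open>w\<close> and integrated; the
  derivative term becomes a difference of half squared distances. Integrability of \<open>r\<close>
  along \<open>u\<close> has to be proved: the bound from below comes from compactness of the curve
  segment, that from above from the inequality itself.\<close>

lemma solution_EVI:
  assumes u: "u \<in> G" and w: "w \<in> D" and ab: "0 \<le> a" "a \<le> b"
  shows "EVI u w a b"
proof -
  obtain g where g: "\<And>T. T > 0 \<Longrightarrow> g \<in> L2_on T" "\<And>T. T > 0 \<Longrightarrow> has_integral_derivative u g T"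
    "continuous_on {0..} u"
    "AE t in lebesgue. 0 < t \<longrightarrow> u t \<in> D \<and> (\<forall>w\<in>D. r (u t) \<le> r w + (g t + F (u t)) \<bullet> (w - u t))"
    using solution_derivative[OF u] by blast
  define T where "T = b + 1"
  have T: "T > 0" using ab by (simp add: T_def)
  have c: "continuous_on {0..T} u" "continuous_on {a..b} u" using continuous_on_subset[OF g(3)] ab by auto
  have gi: "set_integrable lebesgue {a..b} g"
    using set_integrable_interval_subset[OF L2_on_integrable[OF g(1)[OF T]]] ab by (auto simp: T_def)
  have gw: "set_integrable lebesgue {a..b} (\<lambda>t. g t \<bullet> (u t - w))"
    by (intro set_integrable_inner_continuous gi continuous_intros c)
  have Fi: "set_integrable lebesgue {a..b} (\<lambda>t. F (u t) \<bullet> (u t - w))" by (rule set_integrable_inner_F[OF g(3) ab(1)])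
  have "compact (u ` {a..b})" using c(2) by (intro compact_continuous_image) auto
  then obtain m where "\<forall>x\<in>u ` {a..b}. m \<le> r x" using r_bounded_below_on_compact by metis
  then have m: "\<And>t. t \<in> {a..b} \<Longrightarrow> m \<le> r (u t)" by simp
  have ae: "AE t\<in>{a..b} in lebesgue. j w (u t) \<le> r w - g t \<bullet> (u t - w)"
    using g(4) AE_lborel_singleton[of 0, THEN AE_completion]
  proof eventually_elim
    case (elim t)
    show ?case
    proof
      assume "t \<in> {a..b}"
      then have "0 < t" using elim(2) ab by auto
      then show "j w (u t) \<le> r w - g t \<bullet> (u t - w)"
        using elim(1) w by (auto simp: j_def inner_add_left inner_diff_right algebra_simps)
    qed
  qed
  have ri: "set_integrable lebesgue {a..b} (\<lambda>t. r (u t))"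
  proof (rule set_integrable_bound)
    show "set_borel_measurable lebesgue {a..b} (\<lambda>t. r (u t))"
      by (rule set_borel_measurable_compose_continuous[OF g(3) r_measurable ab(1)])
    show "set_integrable lebesgue {a..b} (\<lambda>t. (\<bar>m\<bar> + \<bar>r w\<bar>) + (\<bar>g t \<bullet> (u t - w)\<bar> + \<bar>F (u t) \<bullet> (u t - w)\<bar>))"
      by (intro set_integral_add(1) set_integrable_const_interval set_integrable_abs gw Fi)
    show "AE t\<in>{a..b} in lebesgue. norm (r (u t)) \<le> (\<bar>m\<bar> + \<bar>r w\<bar>) + (\<bar>g t \<bullet> (u t - w)\<bar> + \<bar>F (u t) \<bullet> (u t - w)\<bar>)"
      using ae
    proof eventually_elim
      case (elim t)
      show ?case
      proof
        assume t: "t \<in> {a..b}"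
        then have "r (u t) + F (u t) \<bullet> (u t - w) \<le> r w - g t \<bullet> (u t - w)" using elim by (simp add: j_def)
        then show "norm (r (u t)) \<le> (\<bar>m\<bar> + \<bar>r w\<bar>) + (\<bar>g t \<bullet> (u t - w)\<bar> + \<bar>F (u t) \<bullet> (u t - w)\<bar>)"
          using m[OF t] by (simp add: abs_le_iff) linarith
      qed
    qed
  qed
  have ji: "set_integrable lebesgue {a..b} (\<lambda>t. j w (u t))" unfolding j_def by (rule set_integral_add(1)[OF ri Fi])
  have "(LINT t:{a..b}|lebesgue. j w (u t)) \<le> (LINT t:{a..b}|lebesgue. r w - g t \<bullet> (u t - w))"
    by (rule set_integral_mono_AE[OF ji _ ae]) (intro set_integral_diff(1) set_integrable_const_interval gw)
  also have "\<dots> = (LINT t:{a..b}|lebesgue. r w) - (LINT t:{a..b}|lebesgue. g t \<bullet> (u t - w))"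
    by (intro set_integral_diff(2) set_integrable_const_interval gw)
  also have "(LINT t:{a..b}|lebesgue. r w) = (b - a) * r w" using set_integral_const_interval[OF ab(2), of "r w"] by simp
  also have "(LINT t:{a..b}|lebesgue. g t \<bullet> (u t - w)) = (norm (u b - w))\<^sup>2 / 2 - (norm (u a - w))\<^sup>2 / 2"
    using half_norm_sq_integral[OF g(2)[OF T] c(1) ab, of w] by (simp add: T_def)
  finally show ?thesis using ji by (simp add: EVI_def)
qed

section \<open>The energy inequality along solutions\<close>

text \<open>With \<open>w = u a\<close> the integrand \<open>j (u a) (u t) - r (u a)\<close> is
  \<open>E (u t) - E (u a)\<close> up to the Taylor remainder of \<open>p\<close>, which is at most
  \<open>e * (L t - L a)\<close> on short intervals. Hence the energy cannot stay above its initial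
  value, up to a perturbation that disappears with \<open>e\<close>. Once \<open>E\<close> is known
  to decrease, it is bounded below on the interval by its final value, and the same inequality
  yields the energy estimate.\<close>

lemma solution_energy:
  assumes u: "u \<in> G"
  shows solution_in_D: "0 \<le> t \<Longrightarrow> u t \<in> D"
    and solution_energy_le: "0 \<le> a \<Longrightarrow> a \<le> b \<Longrightarrow> (norm (u b - u a))\<^sup>2 \<le> 2 * (b - a) * (E (u a) - E (u b))"
    and solution_E_mono: "0 \<le> a \<Longrightarrow> a \<le> b \<Longrightarrow> E (u b) \<le> E (u a)"
proof -
  obtain g where g: "\<And>T. T > 0 \<Longrightarrow> g \<in> L2_on T" "\<And>T. T > 0 \<Longrightarrow> has_integral_derivative u g T"
    "continuous_on {0..} u" "u 0 \<in> D"
    "AE t in lebesgue. 0 < t \<longrightarrow> u t \<in> D \<and> (\<forall>w\<in>D. r (u t) \<le> r w + (g t + F (u t)) \<bullet> (w - u t))"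
    using solution_derivative[OF u] by blast
  have aeD: "AE t in lebesgue. 0 < t \<longrightarrow> u t \<in> D" using g(5) by eventually_elim auto
  \<comment> \<open>An arc length function: its increments are additive and dominate those of
    \<open>u\<close>, as the gluing of local estimates demands.\<close>
  define L where "L t = (LINT x:{0..t}|lebesgue. norm (g x))" for t
  have ng: "set_integrable lebesgue {a..b} (\<lambda>x. norm (g x))" if "0 \<le> a" for a b
    using set_integrable_interval_subset[OF L2_on_integrable[OF g(1)[of "max 1 b"]], of a b] that
    by (intro set_integrable_norm) auto
  have Linc: "L b - L a = (LINT x:{a..b}|lebesgue. norm (g x))" if "0 \<le> a" "a \<le> b" for a b
    using set_integral_interval_combine[OF ng[of 0 b], of a] that by (simp add: L_def)
  have uL: "norm (u b - u a) \<le> L b - L a" if "0 \<le> a" "a \<le> b" for a b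
    using has_integral_derivative_norm_le[OF g(2)[of "b + 1"], of a b] Linc that by simp
  have Lcont: "(\<lambda>n. L (X n)) \<longlonglongrightarrow> L t" if X: "\<And>n. X n \<in> {t0..b}" "X \<longlonglongrightarrow> t" "t \<in> {t0..b}" "0 \<le> t0" for X t t0 b
  proof -
    \<comment> \<open>For each \<open>n\<close> at most one of the two integrals is nonzero,
      according to the side of \<open>t\<close> on which \<open>X n\<close> lies.\<close>
    have "(\<lambda>n. (LINT x:{X n..t}|lebesgue. norm (g x)) - (LINT x:{t..X n}|lebesgue. norm (g x))) \<longlonglongrightarrow> 0 - 0"
      by (intro tendsto_diff set_integral_interval_tendsto_0[OF ng[OF X(4)] X(1-3)])
    moreover have "L t - L (X n) = (LINT x:{X n..t}|lebesgue. norm (g x)) - (LINT x:{t..X n}|lebesgue. norm (g x))" for n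
    proof (cases "X n \<le> t")
      case True
      have "(LINT x:{t..X n}|lebesgue. norm (g x)) = 0"
      proof (cases "X n = t")
        case True
        then show ?thesis using Linc[of t t] X(3,4) by simp
      next
        case False
        then have "{t..X n} = {}" using \<open>X n \<le> t\<close> by auto
        then show ?thesis by (simp add: set_lebesgue_integral_def)
      qed
      then show ?thesis using Linc[of "X n" t] True X(1)[of n] X(4) by simp
    next
      case False
      then have "{X n..t} = {}" by auto
      then have "(LINT x:{X n..t}|lebesgue. norm (g x)) = 0" by (simp add: set_lebesgue_integral_def)
      then show ?thesis using Linc[of t "X n"] False X(3,4) by simp
    qed
    ultimately have "(\<lambda>n. L t - L (X n)) \<longlonglongrightarrow> 0" by simp
    then have "(\<lambda>n. L t - (L t - L (X n))) \<longlonglongrightarrow> L t - 0" by (intro tendsto_intros)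
    then show ?thesis by simp
  qed
  have EVIi: "(norm (u b - u a))\<^sup>2 / 2 + (LINT t:{a..b}|lebesgue. j (u a) (u t) - r (u a)) \<le> 0"
    "set_integrable lebesgue {a..b} (\<lambda>t. j (u a) (u t) - r (u a))" if "u a \<in> D" "0 \<le> a" "a \<le> b" for a b
  proof -
    have ev: "EVI u (u a) a b" by (rule solution_EVI[OF u that])
    then show "set_integrable lebesgue {a..b} (\<lambda>t. j (u a) (u t) - r (u a))"
      unfolding EVI_def by (intro set_integral_diff(1) set_integrable_const_interval) auto
    have "(LINT t:{a..b}|lebesgue. j (u a) (u t) - r (u a)) = (LINT t:{a..b}|lebesgue. j (u a) (u t)) - (LINT t:{a..b}|lebesgue. r (u a))"
      using ev unfolding EVI_def by (intro set_integral_diff(2) set_integrable_const_interval) auto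
    then show "(norm (u b - u a))\<^sup>2 / 2 + (LINT t:{a..b}|lebesgue. j (u a) (u t) - r (u a)) \<le> 0"
      using ev set_integral_const_interval[OF that(3), of "r (u a)"] by (simp add: EVI_def)
  qed
  have close: "\<exists>\<delta>>0. \<forall>s t. 0 \<le> s \<and> s \<le> t \<and> t \<le> T \<and> t - s < \<delta> \<longrightarrow> p (u t) - p (u s) - F (u t) \<bullet> (u t - u s) \<le> e * (L t - L s)"
    if "e > 0" "T \<ge> 0" for e T
  proof -
    have cT: "continuous_on {0..T} u" using continuous_on_subset[OF g(3)] by auto
    have "compact (u ` {0..T})" using cT by (intro compact_continuous_image) auto
    then obtain \<eta> where \<eta>: "\<eta> > 0" "\<And>x y. x \<in> u ` {0..T} \<Longrightarrow> norm (y - x) < \<eta> \<Longrightarrow> \<bar>p y - p x - F x \<bullet> (y - x)\<bar> \<le> e * norm (y - x)"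
      using p_taylor[OF _ \<open>e > 0\<close>] by metis
    have "uniformly_continuous_on {0..T} u" using cT compact_uniformly_continuous by blast
    then obtain \<delta> where \<delta>: "\<delta> > 0" "\<And>x y. x \<in> {0..T} \<Longrightarrow> y \<in> {0..T} \<Longrightarrow> dist x y < \<delta> \<Longrightarrow> dist (u x) (u y) < \<eta>"
      using \<eta>(1) unfolding uniformly_continuous_on_def by metis
    show ?thesis
    proof (intro exI[of _ \<delta>] conjI allI impI)
      fix s t assume st: "0 \<le> s \<and> s \<le> t \<and> t \<le> T \<and> t - s < \<delta>"
      have "dist (u s) (u t) < \<eta>" using st by (intro \<delta>(2)) (auto simp: dist_real_def)
      \<comment> \<open>The expansion is about the later point \<open>u t\<close>, since
        \<open>j\<close> evaluates the gradient there.\<close>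
      then have "\<bar>p (u s) - p (u t) - F (u t) \<bullet> (u s - u t)\<bar> \<le> e * norm (u s - u t)"
        using st by (intro \<eta>(2)) (auto simp: dist_norm)
      also have "\<dots> \<le> e * (L t - L s)" using uL[of s t] st \<open>e > 0\<close> by (intro mult_left_mono) (auto simp: norm_minus_commute)
      finally show "p (u t) - p (u s) - F (u t) \<bullet> (u t - u s) \<le> e * (L t - L s)" by (simp add: inner_diff_right)
    qed (rule \<delta>(1))
  qed
  have Lmono: "L a \<le> L b" if "0 \<le> a" "a \<le> b" for a b
    using uL[OF that] norm_ge_zero[of "u b - u a"] by linarith
  \<comment> \<open>The last time before \<open>b\<close> at which the perturbed energy is at most its value at \<open>a\<close> must be \<open>b\<close>,
    as otherwise the EVI started at that time would be violated.\<close>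
  have loc: "u b \<in> D \<and> E (u b) - e * (L b + b) \<le> E (u a) - e * (L a + a)"
    if e: "e > 0" and T: "T \<ge> 0" and ab: "0 \<le> a" "a \<le> b" "b \<le> T" "b - a < \<delta>" and ua: "u a \<in> D"
      and \<delta>: "\<And>s t. 0 \<le> s \<Longrightarrow> s \<le> t \<Longrightarrow> t \<le> T \<Longrightarrow> t - s < \<delta> \<Longrightarrow> p (u t) - p (u s) - F (u t) \<bullet> (u t - u s) \<le> e * (L t - L s)"
    for e T a b \<delta>
  proof -
    define c where "c = E (u a) - e * (L a + a)"
    define Z where "Z = {t\<in>{a..b}. u t \<in> D \<and> E (u t) \<le> c + e * (L t + t)}"
    have "closed Z"
    proof (rule closed_sequential_limits[THEN iffD2], intro allI impI)
      fix X t assume X: "(\<forall>n. X n \<in> Z) \<and> X \<longlonglongrightarrow> t"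
      have tab: "t \<in> {a..b}" using X closed_sequentially[of "{a..b}" X t] by (auto simp: Z_def)
      have Xab: "X n \<in> {a..b}" for n using X by (auto simp: Z_def)
      have ut: "(\<lambda>n. u (X n)) \<longlonglongrightarrow> u t"
        using X Xab tab ab by (intro continuous_on_tendsto_compose[OF g(3)]) (auto intro!: always_eventually intro: order_trans)
      have "(\<lambda>n. c + e * (L (X n) + X n)) \<longlonglongrightarrow> c + e * (L t + t)"
        using X by (intro tendsto_intros Lcont[OF Xab _ tab ab(1)]) auto
      from E_limit[OF ut _ this] X have "u t \<in> D" "E (u t) \<le> c + e * (L t + t)" by (auto simp: Z_def)
      then show "t \<in> Z" using tab by (simp add: Z_def)
    qed
    moreover have aZ: "a \<in> Z" using ua ab by (simp add: Z_def c_def)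
    moreover have bdd: "bdd_above Z" by (rule bdd_aboveI[of _ b]) (auto simp: Z_def)
    ultimately have tZ: "Sup Z \<in> Z" by (intro closed_contains_Sup) auto
    define t0 where "t0 = Sup Z"
    have t0: "t0 \<in> {a..b}" "u t0 \<in> D" "E (u t0) \<le> c + e * (L t0 + t0)" using tZ by (auto simp: Z_def t0_def)
    have "t0 = b"
    proof (rule ccontr)
      assume "t0 \<noteq> b"
      then have lt: "t0 < b" using t0 by auto
      \<comment> \<open>The summand \<open>t\<close> of the perturbation leaves the lower bound
        \<open>e * (t - t0)\<close>, whose integral is positive, against the EVI.\<close>
      have low: "AE t\<in>{t0..b} in lebesgue. e * (t - t0) \<le> j (u t0) (u t) - r (u t0)"
        using aeD AE_lborel_singleton[of t0, THEN AE_completion]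
      proof eventually_elim
        case (elim t)
        show ?case
        proof
          assume t: "t \<in> {t0..b}"
          then have tt: "t0 < t" using elim(2) by auto
          then have uD: "u t \<in> D" using elim(1) t0 ab by auto
          have "t \<notin> Z" using cSup_upper[OF _ bdd, of t] tt by (auto simp: t0_def)
          then have "c + e * (L t + t) < E (u t)" using uD t tt t0 by (auto simp: Z_def)
          moreover have "p (u t) - p (u t0) - F (u t) \<bullet> (u t - u t0) \<le> e * (L t - L t0)"
            using t tt t0 ab by (intro \<delta>) auto
          ultimately show "e * (t - t0) \<le> j (u t0) (u t) - r (u t0)" using t0(3) by (simp add: j_def E_def algebra_simps)
        qed
      qed
      have ci: "set_integrable lebesgue {t0..b} (\<lambda>t. e * (t - t0))"
        by (intro set_integrable_continuous_interval continuous_intros)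
      have "((\<lambda>t. e * (t - t0)) has_integral (e * (b - t0)\<^sup>2 / 2 - e * (t0 - t0)\<^sup>2 / 2)) {t0..b}"
        using lt by (intro fundamental_theorem_of_calculus)
          (auto intro!: derivative_eq_intros simp flip: has_real_derivative_iff_has_vector_derivative)
      from integral_unique[OF this] have "(LINT t:{t0..b}|lebesgue. e * (t - t0)) = e * (b - t0)\<^sup>2 / 2"
        unfolding set_lebesgue_integral_eq_integral(2)[OF ci] by simp
      moreover have "(LINT t:{t0..b}|lebesgue. e * (t - t0)) \<le> (LINT t:{t0..b}|lebesgue. j (u t0) (u t) - r (u t0))"
        using t0 ab lt by (intro set_integral_mono_AE ci EVIi(2) low) auto
      moreover have "(norm (u b - u t0))\<^sup>2 / 2 + (LINT t:{t0..b}|lebesgue. j (u t0) (u t) - r (u t0)) \<le> 0"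
        using t0 ab lt by (intro EVIi(1)) auto
      moreover have "0 < e * (b - t0)\<^sup>2 / 2" using e lt by simp
      moreover have "0 \<le> (norm (u b - u t0))\<^sup>2" by simp
      ultimately show False by linarith
    qed
    then show ?thesis using t0 by (simp add: c_def algebra_simps)
  qed
  have glob: "u b \<in> D \<and> E (u b) - e * (L b + b) \<le> E (u a) - e * (L a + a)"
    if e: "e > 0" and ab: "0 \<le> a" "a \<le> b" and ua: "u a \<in> D" for e a b
  proof -
    obtain \<delta> where \<delta>: "\<delta> > 0" "\<And>s t. 0 \<le> s \<Longrightarrow> s \<le> t \<Longrightarrow> t \<le> b \<Longrightarrow> t - s < \<delta> \<Longrightarrow> p (u t) - p (u s) - F (u t) \<bullet> (u t - u s) \<le> e * (L t - L s)"
      using close[OF e, of b] ab by auto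
    \<comment> \<open>Membership in \<open>D\<close> is propagated together with the inequality,
      since the local step requires it at its left end.\<close>
    have "u a \<in> D \<longrightarrow> u b \<in> D \<and> E (u b) - e * (L b + b) \<le> E (u a) - e * (L a + a)"
    proof (rule interval_local_to_global[OF ab(2) \<delta>(1), of "\<lambda>x y. u x \<in> D \<longrightarrow> u y \<in> D \<and> E (u y) - e * (L y + y) \<le> E (u x) - e * (L x + x)"])
      fix x y assume "a \<le> x" "x \<le> y" "y \<le> b" "y - x < \<delta>"
      then show "u x \<in> D \<longrightarrow> u y \<in> D \<and> E (u y) - e * (L y + y) \<le> E (u x) - e * (L x + x)"
        using loc[OF e, of b x y \<delta>] \<delta>(2) ab by auto
    qed auto
    then show ?thesis using ua by simp
  qed
  show inD: "u t \<in> D" if "0 \<le> t" for t using glob[of 1 0 t] g(4) that by simp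
  show Em: "E (u b) \<le> E (u a)" if ab: "0 \<le> a" "a \<le> b" for a b
  proof (rule field_le_epsilon)
    fix \<epsilon> :: real assume "\<epsilon> > 0"
    define K where "K = (L b + b) - (L a + a)"
    have K: "0 \<le> K" using Lmono[OF ab] ab by (simp add: K_def)
    define e where "e = \<epsilon> / (K + 1)"
    have e: "e > 0" "e * K \<le> \<epsilon>" using \<open>\<epsilon> > 0\<close> K by (auto simp: e_def field_simps)
    show "E (u b) \<le> E (u a) + \<epsilon>" using glob[OF e(1) ab inD[OF ab(1)]] e(2) by (simp add: K_def algebra_simps)
  qed
  show "(norm (u b - u a))\<^sup>2 \<le> 2 * (b - a) * (E (u a) - E (u b))" if ab: "0 \<le> a" "a \<le> b" for a b
  proof -
    have pert: "(norm (u b - u a))\<^sup>2 \<le> (b - a) * (2 * (E (u a) - E (u b) + e * (L b - L a)))" if e: "e > 0" for e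
    proof -
      obtain \<delta> where \<delta>: "\<delta> > 0" "\<And>s t. 0 \<le> s \<Longrightarrow> s \<le> t \<Longrightarrow> t \<le> b \<Longrightarrow> t - s < \<delta> \<Longrightarrow> p (u t) - p (u s) - F (u t) \<bullet> (u t - u s) \<le> e * (L t - L s)"
        using close[OF e, of b] ab by auto
      show ?thesis
      proof (rule interval_local_to_global[OF ab(2) \<delta>(1), of "\<lambda>x y. (norm (u y - u x))\<^sup>2 \<le> (y - x) * (2 * (E (u x) - E (u y) + e * (L y - L x)))"])
        fix x y assume xy: "a \<le> x" "x \<le> y" "y \<le> b" "y - x < \<delta>"
        have x0: "0 \<le> x" using xy ab by simp
        \<comment> \<open>A constant lower bound of the integrand on \<open>[x, y]\<close>, from
          monotonicity of the energy and of \<open>L\<close>.\<close>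
        let ?c = "E (u y) - E (u x) - e * (L y - L x)"
        have "(y - x) * ?c = (LINT t:{x..y}|lebesgue. ?c)" using set_integral_const_interval[OF xy(2), of ?c] by simp
        also have "\<dots> \<le> (LINT t:{x..y}|lebesgue. j (u x) (u t) - r (u x))"
        proof (rule set_integral_mono)
          fix t assume t: "t \<in> {x..y}"
          have "p (u t) - p (u x) - F (u t) \<bullet> (u t - u x) \<le> e * (L t - L x)" using t xy x0 by (intro \<delta>(2)) auto
          moreover have "E (u y) \<le> E (u t)" using t x0 by (intro Em) auto
          moreover have "e * (L t - L x) \<le> e * (L y - L x)" using Lmono[of t y] t x0 e by (intro mult_left_mono) auto
          ultimately show "?c \<le> j (u x) (u t) - r (u x)" by (simp add: j_def E_def)
        qed (intro set_integrable_const_interval, use EVIi(2) inD x0 xy in auto)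
        also have "\<dots> \<le> - (norm (u y - u x))\<^sup>2 / 2" using EVIi(1)[of x y] inD x0 xy by simp
        finally show "(norm (u y - u x))\<^sup>2 \<le> (y - x) * (2 * (E (u x) - E (u y) + e * (L y - L x)))"
          by (simp add: algebra_simps)
      next
        fix x y z assume o: "a \<le> x" "x \<le> y" "y \<le> z" "z \<le> b"
          and 1: "(norm (u y - u x))\<^sup>2 \<le> (y - x) * (2 * (E (u x) - E (u y) + e * (L y - L x)))"
          and 2: "(norm (u z - u y))\<^sup>2 \<le> (z - y) * (2 * (E (u y) - E (u z) + e * (L z - L y)))"
        have "0 \<le> 2 * (E (u x) - E (u y) + e * (L y - L x))" "0 \<le> 2 * (E (u y) - E (u z) + e * (L z - L y))"
          using Em[of x y] Em[of y z] Lmono[of x y] Lmono[of y z] o ab e by auto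
        from norm_sq_add_le[OF 1 2 _ _ this] o
        show "(norm (u z - u x))\<^sup>2 \<le> (z - x) * (2 * (E (u x) - E (u z) + e * (L z - L x)))"
          by (simp add: algebra_simps)
      qed
    qed
    show ?thesis
    proof (rule field_le_epsilon)
      fix \<epsilon> :: real assume "\<epsilon> > 0"
      define K where "K = 2 * (b - a) * (L b - L a)"
      have K: "0 \<le> K" using Lmono[OF ab] ab by (simp add: K_def)
      define e where "e = \<epsilon> / (K + 1)"
      have e: "e > 0" "e * K \<le> \<epsilon>" using \<open>\<epsilon> > 0\<close> K by (auto simp: e_def field_simps)
      show "(norm (u b - u a))\<^sup>2 \<le> 2 * (b - a) * (E (u a) - E (u b)) + \<epsilon>"
        using pert[OF e(1)] e(2) by (simp add: K_def algebra_simps)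
    qed
  qed
qed

text \<open>By Cauchy-Schwarz the quotient is at most the integral of the squared derivative over a
  shrinking interval. It will supply a step length \<open>d\<close> for which the squared
  displacement is small compared with \<open>d\<close>.\<close>

lemma solution_increment_small:
  assumes u: "u \<in> G" and t: "t > 0"
  shows "(\<lambda>n. (norm (u (t - t / (real n + 1)) - u t))\<^sup>2 / (t / (real n + 1))) \<longlonglongrightarrow> 0"
proof -
  obtain g where g: "\<And>T. T > 0 \<Longrightarrow> g \<in> L2_on T" "\<And>T. T > 0 \<Longrightarrow> has_integral_derivative u g T"
    using solution_derivative[OF u] by blast
  define X where "X n = t - t / (real n + 1)" for n
  have X: "X n \<in> {0..t}" "X n < t" for n using t by (auto simp: X_def field_simps)
  have "X \<longlonglongrightarrow> t - 0" unfolding X_def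
    using LIMSEQ_ignore_initial_segment[OF lim_const_over_n[of t], of 1] by (intro tendsto_diff tendsto_const) (simp add: add.commute)
  then have Xt: "X \<longlonglongrightarrow> t" by simp
  have gi: "set_integrable lebesgue {0..t} (\<lambda>x. (norm (g x))\<^sup>2)" using g(1)[OF t] by (simp add: L2_on_iff)
  have lim: "(\<lambda>n. LINT x:{X n..t}|lebesgue. (norm (g x))\<^sup>2) \<longlonglongrightarrow> 0"
    by (rule set_integral_interval_tendsto_0(1)[OF gi X(1) Xt]) (use t in auto)
  have "(\<lambda>n. (norm (u (X n) - u t))\<^sup>2 / (t - X n)) \<longlonglongrightarrow> 0"
  proof (rule tendsto_sandwich[OF _ _ tendsto_const lim])
    show "\<forall>\<^sub>F n in sequentially. (norm (u (X n) - u t))\<^sup>2 / (t - X n) \<le> (LINT x:{X n..t}|lebesgue. (norm (g x))\<^sup>2)"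
    proof (intro always_eventually allI)
      fix n
      have "(norm (u t - u (X n)))\<^sup>2 \<le> (t - X n) * (LINT x:{X n..t}|lebesgue. (norm (g x))\<^sup>2)"
        using X[of n] by (intro interval_norm_sq_le[OF g(2)[OF t] g(1)[OF t]]) auto
      then show "(norm (u (X n) - u t))\<^sup>2 / (t - X n) \<le> (LINT x:{X n..t}|lebesgue. (norm (g x))\<^sup>2)"
        using X(2)[of n] by (simp add: field_simps norm_minus_commute)
    qed
    show "\<forall>\<^sub>F n in sequentially. 0 \<le> (norm (u (X n) - u t))\<^sup>2 / (t - X n)"
      using X(2) by (intro always_eventually allI divide_nonneg_nonneg) (auto intro: less_imp_le)
  qed
  then show ?thesis by (simp add: X_def)
qed

text \<open>Differentiating the EVI along the dyadic intervals that shrink to \<open>t\<close> avoids Lebesgue points.\<close>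

lemma EVI_imp_solution:
  assumes ext: "u \<in> extensional {0..}" and cont: "continuous_on {0..} u" and uD: "\<And>t. 0 \<le> t \<Longrightarrow> u t \<in> D"
    and evi: "\<And>w a b. w \<in> D \<Longrightarrow> 0 \<le> a \<Longrightarrow> a \<le> b \<Longrightarrow> EVI u w a b"
    and energy: "\<And>N n. dyadic_energy u N n \<le> C"
  shows "u \<in> G"
proof -
  obtain g where gL2: "\<And>T. g \<in> L2_on T" and gd: "\<And>T. has_integral_derivative u g T"
    and ae: "AE t in lebesgue. 0 \<le> t \<longrightarrow> (\<exists>r. strict_mono r \<and> (\<lambda>k. dyadic_slope u (r k) (dyadic_index (r k) t)) \<longlonglongrightarrow> g t)"
    using bounded_dyadic_energy_imp_integral_derivative[OF cont energy] by blast
  have cT: "continuous_on {0..T} u" for T using continuous_on_subset[OF cont] by auto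
  have weak: "has_L2_weak_derivative T u g" if "T > 0" for T
    using has_integral_derivative_imp_weak[OF gd cT _ gL2] that by simp
  have H1: "u \<in> H1_on T" if T: "T > 0" for T
  proof -
    have "u \<in> L2_on T" unfolding L2_on_iff
      by (intro conjI set_borel_measurable_continuous_interval set_integrable_continuous_interval continuous_intros cT)
    then show ?thesis using weak[OF T] cT by (auto simp: H1_on_def)
  qed
  have incl: "- g t - F (u t) \<in> subdifferential f (u t)"
    if t: "0 \<le> t" and r': "strict_mono r'" "(\<lambda>k. dyadic_slope u (r' k) (dyadic_index (r' k) t)) \<longlonglongrightarrow> g t" for t r'
    unfolding subdifferential_iff
  proof (intro conjI ballI uD t)
    fix w assume w: "w \<in> D"
    define a where "a k = real (dyadic_index (r' k) t) / 2^(r' k)" for k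
    define b where "b k = (real (dyadic_index (r' k) t) + 1) / 2^(r' k)" for k
    define sl where "sl k = dyadic_slope u (r' k) (dyadic_index (r' k) t)" for k
    have ab: "0 \<le> a k" "a k \<le> t" "t < b k" "b k - a k = 1 / 2^(r' k)" for k
      using dyadic_index_bounds[OF t, of "r' k"] by (auto simp: a_def b_def diff_divide_distrib add_divide_distrib)
    have al: "a \<longlonglongrightarrow> t" and bl: "b \<longlonglongrightarrow> t"
      using LIMSEQ_subseq_LIMSEQ[OF dyadic_left_tendsto(1)[OF t] r'(1)] LIMSEQ_subseq_LIMSEQ[OF dyadic_left_tendsto(2)[OF t] r'(1)]
      by (simp_all add: a_def[abs_def] b_def[abs_def] o_def)
    have b0: "0 \<le> b k" for k using ab[of k] t by linarith
    have ual: "(\<lambda>k. u (a k)) \<longlonglongrightarrow> u t"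
      by (rule continuous_on_tendsto_compose[OF cont al]) (use t ab in \<open>auto intro!: always_eventually\<close>)
    have ubl: "(\<lambda>k. u (b k)) \<longlonglongrightarrow> u t"
      by (rule continuous_on_tendsto_compose[OF cont bl]) (use t b0 in \<open>auto intro!: always_eventually\<close>)
    \<comment> \<open>Near \<open>t\<close> the integrand of the EVI is at least
      \<open>j w (u t) - e\<close> by lower semicontinuity, so dividing the EVI on a dyadic cell by
      its length leaves the slope paired with a midpoint.\<close>
    have main: "g t \<bullet> (u t - w) + (j w (u t) - e) \<le> r w" if e: "e > 0" for e
    proof -
      have "\<forall>\<^sub>F s in at t within {0..}. j w (u t) - e < j w (u s)"
      proof -
        have us: "((\<lambda>s. u s) \<longlongrightarrow> u t) (at t within {0..})" using cont t by (auto simp: continuous_on)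
        have "((\<lambda>s. F (u s) \<bullet> (u s - w)) \<longlongrightarrow> F (u t) \<bullet> (u t - w)) (at t within {0..})"
          by (intro tendsto_intros F_tendsto us)
        then have "\<forall>\<^sub>F s in at t within {0..}. F (u t) \<bullet> (u t - w) - e/2 < F (u s) \<bullet> (u s - w)"
          by (rule order_tendstoD(1)) (use e in simp)
        moreover have "\<forall>\<^sub>F s in at t within {0..}. u s \<in> D \<longrightarrow> r (u t) - e/2 < r (u s)"
          by (rule lsc_eventually[OF us uD[OF t]]) (use e in simp)
        moreover have "\<forall>\<^sub>F s in at t within {0..}. s \<in> {0..}" by (simp add: eventually_at_filter)
        ultimately show ?thesis
        proof eventually_elim
          case (elim s)
          then show ?case using uD[of s] by (simp add: j_def)
        qed
      qed
      then obtain \<delta> where \<delta>: "\<delta> > 0" "\<And>s. 0 \<le> s \<Longrightarrow> s \<noteq> t \<Longrightarrow> dist s t < \<delta> \<Longrightarrow> j w (u t) - e < j w (u s)"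
        unfolding eventually_at by auto
      have "\<forall>\<^sub>F k in sequentially. t - \<delta> < a k" "\<forall>\<^sub>F k in sequentially. b k < t + \<delta>"
        using order_tendstoD(1)[OF al, of "t - \<delta>"] order_tendstoD(2)[OF bl, of "t + \<delta>"] \<delta>(1) by auto
      then have "\<forall>\<^sub>F k in sequentially. sl k \<bullet> ((1/2) *\<^sub>R (u (a k) + u (b k)) - w) + (j w (u t) - e) \<le> r w"
      proof eventually_elim
        case (elim k)
        let ?h = "1 / 2^(r' k)"
        have h: "0 < (?h :: real)" by simp
        have ev: "EVI u w (a k) (b k)" using ab[of k] by (intro evi w) auto
        have sl: "u (b k) - u (a k) = ?h *\<^sub>R sl k" by (simp add: sl_def dyadic_slope_def a_def b_def)
        have A: "(norm (u (b k) - w))\<^sup>2 / 2 - (norm (u (a k) - w))\<^sup>2 / 2 = (u (b k) - u (a k)) \<bullet> ((1/2) *\<^sub>R (u (a k) + u (b k)) - w)"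
          unfolding power2_norm_eq_inner by (simp add: algebra_simps inner_commute diff_divide_distrib add_divide_distrib)
        have "?h * (j w (u t) - e) = (LINT s:{a k..b k}|lebesgue. j w (u t) - e)"
          using set_integral_const_interval[of "a k" "b k" "j w (u t) - e"] ab[of k] by simp
        also have "\<dots> \<le> (LINT s:{a k..b k}|lebesgue. j w (u s))"
        proof (rule set_integral_mono)
          fix s assume s: "s \<in> {a k..b k}"
          show "j w (u t) - e \<le> j w (u s)"
          proof (cases "s = t")
            case False
            have "dist s t < \<delta>" using s elim ab(2,3)[of k] by (auto simp: dist_real_def)
            then show ?thesis using \<delta>(2)[of s] False s ab(1)[of k] by auto
          qed (use e in simp)
        qed (use ev in \<open>auto simp: EVI_def set_integrable_const_interval\<close>)
        finally have "?h * (sl k \<bullet> ((1/2) *\<^sub>R (u (a k) + u (b k)) - w)) + ?h * (j w (u t) - e) \<le> ?h * r w"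
          using ev ab(4)[of k] unfolding EVI_def A sl by simp
        then have "?h * (sl k \<bullet> ((1/2) *\<^sub>R (u (a k) + u (b k)) - w) + (j w (u t) - e)) \<le> ?h * r w" by (simp only: distrib_left)
        then show ?case using h by (simp only: mult_le_cancel_left_pos)
      qed
      moreover have "(\<lambda>k. sl k \<bullet> ((1/2) *\<^sub>R (u (a k) + u (b k)) - w) + (j w (u t) - e)) \<longlonglongrightarrow> g t \<bullet> ((1/2) *\<^sub>R (u t + u t) - w) + (j w (u t) - e)"
        using r'(2) by (intro tendsto_intros ual ubl) (simp add: sl_def)
      ultimately have "g t \<bullet> ((1/2) *\<^sub>R (u t + u t) - w) + (j w (u t) - e) \<le> r w"
        by (intro tendsto_upperbound) auto
      then show ?thesis by (simp flip: scaleR_2)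
    qed
    have "g t \<bullet> (u t - w) + j w (u t) \<le> r w"
      by (rule field_le_epsilon) (use main in \<open>force simp: algebra_simps\<close>)
    then show "r (u t) + (- g t - F (u t)) \<bullet> (w - u t) \<le> r w"
      by (simp add: j_def inner_diff_left inner_diff_right)
  qed
  have "AE t in lebesgue. t \<in> {0<..} \<longrightarrow> (\<exists>\<xi>\<in>subdifferential f (u t). g t + \<xi> + F (u t) = 0)"
    using ae
  proof eventually_elim
    case (elim t)
    show ?case
    proof
      assume "t \<in> {0<..}"
      then have "- g t - F (u t) \<in> subdifferential f (u t)" using elim incl[of t] by auto
      then show "\<exists>\<xi>\<in>subdifferential f (u t). g t + \<xi> + F (u t) = 0" by (intro bexI[of _ "- g t - F (u t)"]) auto
    qed
  qed
  then have "AE t in lebesgue_on {0<..}. \<exists>\<xi>\<in>subdifferential f (u t). g t + \<xi> + F (u t) = 0"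
    by (subst AE_restrict_space_iff) auto
  then show ?thesis unfolding gradient_flow_solutions_def using ext H1 uD[of 0] weak by auto
qed

end

section \<open>Limits of approximate solutions\<close>

lemma integrable_shift:
  fixes k :: "real \<Rightarrow> 'b::{banach, second_countable_topology}"
  assumes "integrable lebesgue k"
  shows "integrable lebesgue (\<lambda>t. k (t + c))" "integral\<^sup>L lebesgue (\<lambda>t. k (t + c)) = integral\<^sup>L lebesgue k"
proof -
  let ?T = "\<lambda>x::real. c + 1 * x"
  have e: "lebesgue = distr lebesgue lebesgue ?T"
    using lebesgue_real_affine[of 1 c] by (simp add: density_1)
  have T: "?T \<in> lebesgue \<rightarrow>\<^sub>M lebesgue"
    using lebesgue_affine_measurable[of "\<lambda>_. 1" c] by simp
  have km: "k \<in> borel_measurable lebesgue" using assms by (rule borel_measurable_integrable)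
  show "integrable lebesgue (\<lambda>t. k (t + c))"
    using assms integrable_distr_eq[OF T km] e by (simp add: add.commute)
  show "integral\<^sup>L lebesgue (\<lambda>t. k (t + c)) = integral\<^sup>L lebesgue k"
    using integral_distr[OF T km] e by (simp add: add.commute)
qed

text \<open>A Fatou argument for integrands of variable sign: \<open>min (hn n t) (h t)\<close>
  converges to \<open>h t\<close>, is dominated, and lies below \<open>hn n t\<close>.\<close>

lemma set_integral_eventually_ge:
  fixes h :: "real \<Rightarrow> real"
  assumes hn: "\<And>n. set_borel_measurable lebesgue {a..b} (hn n)" "\<And>n t. t \<in> {a..b} \<Longrightarrow> \<bar>hn n t\<bar> \<le> B"
    and h: "set_borel_measurable lebesgue {a..b} h" "\<And>t. t \<in> {a..b} \<Longrightarrow> \<bar>h t\<bar> \<le> B"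
    and lim: "\<And>t e. t \<in> {a..b} \<Longrightarrow> e > 0 \<Longrightarrow> \<forall>\<^sub>F n in sequentially. h t - e < hn n t"
    and c: "c < (LINT t:{a..b}|lebesgue. h t)"
  shows "\<forall>\<^sub>F n in sequentially. c < (LINT t:{a..b}|lebesgue. hn n t)"
proof -
  have hni: "set_integrable lebesgue {a..b} (hn n)" for n
    using hn(2)[of _ n] by (intro set_integrable_bounded_interval[OF hn(1), of _ B]) auto
  have hi: "set_integrable lebesgue {a..b} h"
    using h(2) by (intro set_integrable_bounded_interval[OF h(1), of B]) auto
  have mm: "(\<lambda>t. indicator {a..b} t *\<^sub>R min (hn n t) (h t)) \<in> borel_measurable lebesgue" for n
  proof -
    have "(\<lambda>t. min (indicator {a..b} t *\<^sub>R hn n t) (indicator {a..b} t *\<^sub>R h t)) \<in> borel_measurable lebesgue"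
      using hn(1)[of n] h(1) unfolding set_borel_measurable_def by (rule borel_measurable_min[rotated])
    then show ?thesis by (rule measurable_cong[THEN iffD1, rotated]) (auto split: split_indicator)
  qed
  have mb: "\<bar>min (hn n t) (h t)\<bar> \<le> B" if "t \<in> {a..b}" for n t
    using hn(2)[OF that, of n] h(2)[OF that] by (auto simp: min_def)
  have mi: "set_integrable lebesgue {a..b} (\<lambda>t. min (hn n t) (h t))" for n
    using mm mb by (intro set_integrable_bounded_interval[of _ _ _ B]) (auto simp: set_borel_measurable_def)
  have "(\<lambda>n. integral\<^sup>L lebesgue (\<lambda>t. indicator {a..b} t *\<^sub>R min (hn n t) (h t))) \<longlonglongrightarrow> integral\<^sup>L lebesgue (\<lambda>t. indicator {a..b} t *\<^sub>R h t)"
  proof (rule integral_dominated_convergence[where w="\<lambda>t. indicator {a..b} t *\<^sub>R B"])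
    show "integrable lebesgue (\<lambda>t. indicator {a..b} t *\<^sub>R B)" using set_integrable_const_interval[of a b B] by (simp add: set_integrable_def)
    show "AE t in lebesgue. norm (indicator {a..b} t *\<^sub>R min (hn n t) (h t)) \<le> indicator {a..b} t *\<^sub>R B" for n
      using mb[of _ n] by (intro AE_I2) (auto split: split_indicator)
    show "AE t in lebesgue. (\<lambda>n. indicator {a..b} t *\<^sub>R min (hn n t) (h t)) \<longlonglongrightarrow> indicator {a..b} t *\<^sub>R h t"
    proof (rule AE_I2)
      fix t
      have "(\<lambda>n. min (hn n t) (h t)) \<longlonglongrightarrow> h t" if t: "t \<in> {a..b}"
      proof (rule order_tendstoI)
        fix y assume "y < h t"
        with lim[OF t, of "h t - y"] show "\<forall>\<^sub>F n in sequentially. y < min (hn n t) (h t)" by (auto elim: eventually_mono)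
      qed (auto simp: min_less_iff_disj)
      then show "(\<lambda>n. indicator {a..b} t *\<^sub>R min (hn n t) (h t)) \<longlonglongrightarrow> indicator {a..b} t *\<^sub>R h t"
        by (auto split: split_indicator)
    qed
  qed (use mm h(1) in \<open>auto simp: set_borel_measurable_def\<close>)
  then have "\<forall>\<^sub>F n in sequentially. c < (LINT t:{a..b}|lebesgue. min (hn n t) (h t))"
    using c unfolding set_lebesgue_integral_def by (rule order_tendstoD(1))
  then show ?thesis
  proof eventually_elim
    case (elim n)
    have "(LINT t:{a..b}|lebesgue. min (hn n t) (h t)) \<le> (LINT t:{a..b}|lebesgue. hn n t)"
      by (rule set_integral_mono[OF mi hni]) simp
    then show ?case using elim by simp
  qed
qed

lemma set_integral_bounded_tendsto:
  fixes h :: "real \<Rightarrow> real"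
  assumes hn: "\<And>n. set_borel_measurable lebesgue {a..b} (hn n)" "\<And>n t. t \<in> {a..b} \<Longrightarrow> \<bar>hn n t\<bar> \<le> B"
    and h: "set_borel_measurable lebesgue {a..b} h"
    and lim: "\<And>t. t \<in> {a..b} \<Longrightarrow> (\<lambda>n. hn n t) \<longlonglongrightarrow> h t"
  shows "(\<lambda>n. LINT t:{a..b}|lebesgue. hn n t) \<longlonglongrightarrow> (LINT t:{a..b}|lebesgue. h t)"
  unfolding set_lebesgue_integral_def
proof (rule integral_dominated_convergence[where w="\<lambda>t. indicator {a..b} t *\<^sub>R B"])
  show "integrable lebesgue (\<lambda>t. indicator {a..b} t *\<^sub>R B)" using set_integrable_const_interval[of a b B] by (simp add: set_integrable_def)
  show "AE t in lebesgue. norm (indicator {a..b} t *\<^sub>R hn n t) \<le> indicator {a..b} t *\<^sub>R B" for n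
    using hn(2)[of _ n] by (intro AE_I2) (auto split: split_indicator)
  show "AE t in lebesgue. (\<lambda>n. indicator {a..b} t *\<^sub>R hn n t) \<longlonglongrightarrow> indicator {a..b} t *\<^sub>R h t"
    using lim by (intro AE_I2) (auto split: split_indicator)
qed (use hn h in \<open>auto simp: set_borel_measurable_def\<close>)

text \<open>Sequential compactness of the countable product does the work of a diagonal argument:
  one convergent subsequence in it converges in every coordinate.\<close>

lemma diagonal_subsequence_compact:
  fixes x :: "nat \<Rightarrow> nat \<Rightarrow> 'a::metric_space"
  assumes K: "compact K" and x: "\<And>n i. x n i \<in> K"
  shows "\<exists>r. strict_mono r \<and> (\<forall>i. convergent (\<lambda>n. x (r n) i))"
proof -
  have "compactin (product_topology (\<lambda>i::nat. euclidean) UNIV) (PiE UNIV (\<lambda>_. K))"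
    using K by (simp add: compactin_PiE)
  then have "compact (PiE UNIV (\<lambda>_::nat. K))" by (simp add: euclidean_product_topology)
  then have "seq_compact (PiE UNIV (\<lambda>_::nat. K))" by (rule compact_imp_seq_compact)
  moreover have "\<forall>n. x n \<in> PiE UNIV (\<lambda>_. K)" using x by auto
  ultimately obtain l r where l: "strict_mono r" "(x \<circ> r) \<longlonglongrightarrow> l" unfolding seq_compact_def by blast
  have "(\<lambda>n. x (r n) i) \<longlonglongrightarrow> l i" for i
  proof -
    have "isCont (\<lambda>y::nat \<Rightarrow> 'a. y i) l"
    proof -
      have "continuous_on UNIV (\<lambda>y::nat \<Rightarrow> 'a. y i)" by (rule continuous_on_product_coordinates)
      then show ?thesis using continuous_on_eq_continuous_at[OF open_UNIV] by blast
    qed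
    from isCont_tendsto_compose[OF this l(2)] show ?thesis by simp
  qed
  then show ?thesis using l(1) by (auto simp: convergent_def)
qed

lemma equicontinuous_subsequence:
  fixes v :: "nat \<Rightarrow> real \<Rightarrow> 'a::banach"
  assumes K: "compact K" and v: "\<And>n t. 0 \<le> t \<Longrightarrow> v n t \<in> K" and M: "0 \<le> M"
    and hol: "\<And>n s t. 0 \<le> s \<Longrightarrow> 0 \<le> t \<Longrightarrow> (norm (v n t - v n s))\<^sup>2 \<le> M * (\<bar>t - s\<bar> + \<epsilon> n)"
    and \<epsilon>: "\<epsilon> \<longlonglongrightarrow> 0"
  shows "\<exists>r u. strict_mono r \<and> (\<forall>t\<ge>0. (\<lambda>n. v (r n) t) \<longlonglongrightarrow> u t) \<and>
    (\<forall>s\<ge>0. \<forall>t\<ge>0. (norm (u t - u s))\<^sup>2 \<le> M * \<bar>t - s\<bar>)"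
proof -
  \<comment> \<open>An enumeration of the dyadic times, with repetitions.\<close>
  define q where "q i = real (fst (prod_decode i)) / 2^(snd (prod_decode i))" for i
  have q0: "0 \<le> q i" for i by (simp add: q_def)
  have q: "q (prod_encode (k, m)) = real k / 2^m" for k m by (simp add: q_def)
  obtain r where r: "strict_mono r" "\<And>i. convergent (\<lambda>n. v (r n) (q i))"
    using diagonal_subsequence_compact[OF K, of "\<lambda>n i. v n (q i)"] v q0 by blast
  have er: "(\<lambda>n. \<epsilon> (r n)) \<longlonglongrightarrow> 0" using LIMSEQ_subseq_LIMSEQ[OF \<epsilon> r(1)] by (simp add: o_def)
  have "convergent (\<lambda>n. v (r n) t)" if t: "0 \<le> t" for t
  proof -
    have "Cauchy (\<lambda>n. v (r n) t)"
    proof (rule metric_CauchyI)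
      fix e :: real assume "0 < e"
      \<comment> \<open>Time distance and slack of at most \<open>\<eta>\<close> each keep the
        squared displacement under \<open>(e/3)\<^sup>2\<close>; \<open>M + 1\<close> avoids
        division by zero.\<close>
      define \<eta> where "\<eta> = (e/3)\<^sup>2 / (M + 1) / 2"
      have \<eta>: "0 < \<eta>" using \<open>0 < e\<close> M by (simp add: \<eta>_def)
      have M\<eta>: "M * (2 * \<eta>) < (e/3)\<^sup>2"
      proof -
        have "M * (2 * \<eta>) < (M + 1) * (2 * \<eta>)" using \<eta> by simp
        also have "\<dots> = (e/3)\<^sup>2"
        proof -
          have "M + 1 \<noteq> 0" using M by simp
          then show ?thesis unfolding \<eta>_def by (metis (no_types, lifting) nonzero_mult_div_cancel_left times_divide_eq_right zero_neq_numeral)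
        qed
        finally show ?thesis .
      qed
      have "\<forall>\<^sub>F m in sequentially. t - \<eta> < real (dyadic_index m t) / 2^m"
        by (rule order_tendstoD(1)[OF dyadic_left_tendsto(1)[OF t]]) (use \<eta> in simp)
      then obtain m where m: "t - \<eta> < real (dyadic_index m t) / 2^m" by (auto simp: eventually_sequentially)
      define i where "i = prod_encode (dyadic_index m t, m)"
      have qi: "\<bar>t - q i\<bar> \<le> \<eta>" using m dyadic_index_bounds(1)[OF t, of m] by (simp add: i_def q)
      have "\<forall>\<^sub>F n in sequentially. \<epsilon> (r n) < \<eta>" using \<eta> by (intro order_tendstoD(2)[OF er])
      then obtain N1 where N1: "\<And>n. n \<ge> N1 \<Longrightarrow> \<epsilon> (r n) < \<eta>" by (auto simp: eventually_sequentially)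
      have near: "dist (v (r n) t) (v (r n) (q i)) < e/3" if "n \<ge> N1" for n
      proof -
        have "(norm (v (r n) t - v (r n) (q i)))\<^sup>2 \<le> M * (\<bar>t - q i\<bar> + \<epsilon> (r n))" by (rule hol[OF q0 t])
        also have "\<dots> \<le> M * (2 * \<eta>)" using qi N1[OF that] M by (intro mult_left_mono) auto
        finally have "(norm (v (r n) t - v (r n) (q i)))\<^sup>2 < (e/3)\<^sup>2" using M\<eta> by simp
        then have "norm (v (r n) t - v (r n) (q i)) < e/3" by (rule power_less_imp_less_base) (use \<open>0 < e\<close> in simp)
        then show ?thesis by (simp add: dist_norm)
      qed
      have "Cauchy (\<lambda>n. v (r n) (q i))" using r(2) by (rule convergent_Cauchy)
      then obtain N2 where N2: "\<And>m n. m \<ge> N2 \<Longrightarrow> n \<ge> N2 \<Longrightarrow> dist (v (r m) (q i)) (v (r n) (q i)) < e/3"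
        using \<open>0 < e\<close> unfolding Cauchy_def by (meson divide_pos_pos zero_less_numeral)
      show "\<exists>N. \<forall>m\<ge>N. \<forall>n\<ge>N. dist (v (r m) t) (v (r n) t) < e"
      proof (intro exI allI impI)
        fix m n assume mn: "m \<ge> max N1 N2" "n \<ge> max N1 N2"
        have "dist (v (r m) t) (v (r n) t) \<le> dist (v (r m) t) (v (r m) (q i)) + dist (v (r m) (q i)) (v (r n) (q i)) + dist (v (r n) t) (v (r n) (q i))"
          using dist_triangle[of "v (r m) t" "v (r n) t" "v (r m) (q i)"] dist_triangle[of "v (r m) (q i)" "v (r n) t" "v (r n) (q i)"]
            dist_commute[of "v (r n) t" "v (r n) (q i)"] by linarith
        then show "dist (v (r m) t) (v (r n) t) < e" using near[of m] near[of n] N2[of m n] mn by simp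
      qed
    qed
    then show ?thesis by (rule Cauchy_convergent)
  qed
  then obtain u where u: "\<And>t. 0 \<le> t \<Longrightarrow> (\<lambda>n. v (r n) t) \<longlonglongrightarrow> u t" unfolding convergent_def by metis
  have "(norm (u t - u s))\<^sup>2 \<le> M * \<bar>t - s\<bar>" if "0 \<le> s" "0 \<le> t" for s t
  proof (rule LIMSEQ_le)
    show "(\<lambda>n. (norm (v (r n) t - v (r n) s))\<^sup>2) \<longlonglongrightarrow> (norm (u t - u s))\<^sup>2" using that by (intro tendsto_intros u)
    have "(\<lambda>n. M * (\<bar>t - s\<bar> + \<epsilon> (r n))) \<longlonglongrightarrow> M * (\<bar>t - s\<bar> + 0)" by (intro tendsto_intros er)
    then show "(\<lambda>n. M * (\<bar>t - s\<bar> + \<epsilon> (r n))) \<longlonglongrightarrow> M * \<bar>t - s\<bar>" by simp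
    show "\<exists>N. \<forall>n\<ge>N. (norm (v (r n) t - v (r n) s))\<^sup>2 \<le> M * (\<bar>t - s\<bar> + \<epsilon> (r n))" using hol that by blast
  qed
  then show ?thesis using r(1) u by blast
qed

lemma continuous_on_if_Hoelder:
  fixes u :: "real \<Rightarrow> 'a::real_normed_vector"
  assumes "\<And>s t. s \<in> S \<Longrightarrow> t \<in> S \<Longrightarrow> (norm (u t - u s))\<^sup>2 \<le> M * \<bar>t - s\<bar>"
  shows "continuous_on S u"
proof (rule continuous_onI)
  fix s e :: real assume s: "s \<in> S" and e: "0 < e"
  define \<delta> where "\<delta> = e\<^sup>2 / (\<bar>M\<bar> + 1)"
  have \<delta>: "0 < \<delta>" using e by (simp add: \<delta>_def)
  have "dist (u t) (u s) \<le> e" if "t \<in> S" "dist t s < \<delta>" for t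
  proof -
    have "(norm (u t - u s))\<^sup>2 \<le> M * \<bar>t - s\<bar>" by (rule assms[OF s that(1)])
    also have "\<dots> \<le> (\<bar>M\<bar> + 1) * \<delta>" using that(2) by (intro mult_mono) (auto simp: dist_real_def)
    also have "\<dots> = e\<^sup>2" by (simp add: \<delta>_def)
    finally have "norm (u t - u s) \<le> e" by (rule power2_le_imp_le) (use e in simp)
    then show ?thesis by (simp add: dist_norm)
  qed
  then show "\<exists>d>0. \<forall>t\<in>S. dist t s < d \<longrightarrow> dist (u t) (u s) \<le> e" using \<delta> by blast
qed

lemma dyadic_index_mono: "s \<le> t \<Longrightarrow> dyadic_index n s \<le> dyadic_index n t"
  unfolding dyadic_index_def by (intro nat_mono floor_mono mult_left_mono) auto

text \<open>The energy drops telescope, and the weights from slopes and cell length combine to a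
  bound independent of \<open>n\<close> and \<open>N\<close>.\<close>

lemma dyadic_energy_le:
  assumes "\<And>k. (norm (u ((real k + 1) / 2^n) - u (real k / 2^n)))\<^sup>2 \<le> 2 * (1 / 2^n) * (e k - e (Suc k))"
    and "\<And>k. m \<le> e k"
  shows "dyadic_energy u N n \<le> 2 * (e 0 - m)"
proof -
  have "(norm (dyadic_slope u n k))\<^sup>2 \<le> 2 * 2^n * (e k - e (Suc k))" for k
  proof -
    have "(norm (dyadic_slope u n k))\<^sup>2 = 2^n * 2^n * (norm (u ((real k + 1) / 2^n) - u (real k / 2^n)))\<^sup>2"
      by (simp add: dyadic_slope_def power_mult_distrib power2_eq_square)
    also have "\<dots> \<le> 2^n * 2^n * (2 * (1 / 2^n) * (e k - e (Suc k)))" by (intro mult_left_mono assms) auto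
    finally have "(norm (dyadic_slope u n k))\<^sup>2 \<le> 2^n * (2 * e k - 2 * e (Suc k))" by simp
    then show ?thesis by (simp add: algebra_simps)
  qed
  then have "(\<Sum>k<N * 2^n. (norm (dyadic_slope u n k))\<^sup>2) \<le> (\<Sum>k<N * 2^n. 2 * 2^n * (e k - e (Suc k)))" by (intro sum_mono)
  also have "\<dots> = 2 * 2^n * (e 0 - e (N * 2^n))"
    unfolding sum_distrib_left[symmetric] sum_lessThan_telescope' ..
  also have "\<dots> \<le> 2 * 2^n * (e 0 - m)" using assms(2) by (intro mult_left_mono) auto
  finally show ?thesis by (simp add: dyadic_energy_def field_simps)
qed

context gradient_system
begin

lemma EVI_shift:
  assumes "EVI u w (a + c) (b + c)"
  shows "EVI (\<lambda>s. u (s + c)) w a b"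
proof -
  let ?k = "\<lambda>t. indicator {a + c..b + c} t *\<^sub>R j w (u t)"
  have k: "(\<lambda>t. ?k (t + c)) = (\<lambda>t. indicator {a..b} t *\<^sub>R j w (u (t + c)))" by (auto split: split_indicator)
  have "integrable lebesgue ?k" using assms by (simp add: EVI_def set_integrable_def)
  from integrable_shift[OF this, of c] show ?thesis
    using assms unfolding k by (simp add: EVI_def set_integrable_def set_lebesgue_integral_def)
qed

lemma EVI_combine:
  assumes 1: "EVI u w a b" and 2: "EVI u w b c" and ab: "a \<le> b" "b \<le> c"
  shows "EVI u w a c"
proof -
  have "{a..c} = {a..b} \<union> {b..c}" using ab by auto
  then have i: "set_integrable lebesgue {a..c} (\<lambda>t. j w (u t))"
    using 1 2 by (auto simp: EVI_def intro: set_integrable_Un)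
  then show ?thesis using 1 2 set_integral_interval_combine[OF i ab] by (simp add: EVI_def algebra_simps)
qed

lemma EVI_cong:
  assumes "\<And>t. a \<le> t \<Longrightarrow> t \<le> b \<Longrightarrow> u t = v t" "a \<le> b"
  shows "EVI u w a b \<longleftrightarrow> EVI v w a b"
proof -
  have "(\<lambda>t. indicator {a..b} t *\<^sub>R j w (u t)) = (\<lambda>t. indicator {a..b} t *\<^sub>R j w (v t))"
    using assms by (auto split: split_indicator)
  then show ?thesis unfolding EVI_def set_integrable_def set_lebesgue_integral_def using assms by simp
qed

lemma bounded_on_sublevel:
  assumes "continuous_on UNIV (h :: 'a \<Rightarrow> real)"
  shows "\<exists>B. \<forall>x\<in>D. E x \<le> C \<longrightarrow> \<bar>h x\<bar> \<le> B"
proof -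
  have "compact (h ` {x\<in>D. E x \<le> C})"
    using assms by (intro compact_continuous_image compact_E) (rule continuous_on_subset, auto)
  then have "bounded (h ` {x\<in>D. E x \<le> C})" by (rule compact_imp_bounded)
  then show ?thesis by (auto simp: bounded_iff)
qed

text \<open>\<open>r\<close> need not be continuous, but \<open>j w\<close> is \<open>E\<close>
  minus a continuous function: \<open>E\<close> lies between its lower bound and \<open>C\<close>,
  and the continuous part is bounded on the compact sublevel.\<close>

lemma j_bounded_on_sublevel: "\<exists>B. \<forall>x\<in>D. E x \<le> C \<longrightarrow> \<bar>j w x\<bar> \<le> B"
proof -
  obtain m where m: "\<And>x. x \<in> D \<Longrightarrow> m \<le> E x" using E_bounded_below by blast
  have "continuous_on UNIV (\<lambda>x. p x - F x \<bullet> (x - w))" by (intro continuous_intros p_cont F_cont)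
  then obtain B where B: "\<And>x. x \<in> D \<Longrightarrow> E x \<le> C \<Longrightarrow> \<bar>p x - F x \<bullet> (x - w)\<bar> \<le> B"
    using bounded_on_sublevel[of "\<lambda>x. p x - F x \<bullet> (x - w)" C] by blast
  have "\<bar>j w x\<bar> \<le> \<bar>m\<bar> + \<bar>C\<bar> + B" if "x \<in> D" "E x \<le> C" for x
  proof -
    have "j w x = E x - (p x - F x \<bullet> (x - w))" by (simp add: j_def E_def)
    then show ?thesis using m[OF that(1)] B[OF that] that(2) by linarith
  qed
  then show ?thesis by blast
qed

lemma j_liminf:
  assumes x: "xs \<longlonglongrightarrow> x" and D: "\<And>n. xs n \<in> D" "x \<in> D" and e: "e > 0"
  shows "\<forall>\<^sub>F n in sequentially. j w x - e < j w (xs n)"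
proof -
  have "(\<lambda>n. F (xs n) \<bullet> (xs n - w)) \<longlonglongrightarrow> F x \<bullet> (x - w)" by (intro tendsto_intros F_tendsto x)
  then have "\<forall>\<^sub>F n in sequentially. F x \<bullet> (x - w) - e/2 < F (xs n) \<bullet> (xs n - w)"
    by (rule order_tendstoD(1)) (use e in simp)
  moreover have "\<forall>\<^sub>F n in sequentially. xs n \<in> D \<longrightarrow> r x - e/2 < r (xs n)"
    by (rule lsc_eventually[OF x D(2)]) (use e in simp)
  ultimately show ?thesis
  proof eventually_elim
    case (elim n)
    then show ?case using D(1)[of n] by (simp add: j_def)
  qed
qed

text \<open>Both implicit Euler approximations and sequences of solutions satisfy these hypotheses.\<close>

lemma limit_is_solution:
  fixes v :: "nat \<Rightarrow> real \<Rightarrow> 'a"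
  assumes vD: "\<And>n t. 0 \<le> t \<Longrightarrow> v n t \<in> D" and vE: "\<And>n t. 0 \<le> t \<Longrightarrow> E (v n t) \<le> C"
    and meas: "\<And>n w a b. 0 \<le> a \<Longrightarrow> set_borel_measurable lebesgue {a..b} (\<lambda>t. j w (v n t))"
    and hol: "\<And>n s t. 0 \<le> s \<Longrightarrow> 0 \<le> t \<Longrightarrow> (norm (v n t - v n s))\<^sup>2 \<le> M * (\<bar>t - s\<bar> + \<epsilon> n)"
    and M: "0 \<le> M" and \<epsilon>: "\<epsilon> \<longlonglongrightarrow> 0"
    and evi: "\<And>w m i k. w \<in> D \<Longrightarrow> i \<le> k \<Longrightarrow> \<forall>\<^sub>F n in sequentially. EVI (v n) w (real i / 2^m) (real k / 2^m)"
    and energy: "\<And>N m. \<forall>\<^sub>F n in sequentially. dyadic_energy (v n) N m \<le> C'"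
  shows "\<exists>r u. strict_mono r \<and> u \<in> G \<and> (\<forall>t\<ge>0. (\<lambda>n. v (r n) t) \<longlonglongrightarrow> u t)"
proof -
  have vK: "v n t \<in> {x\<in>D. E x \<le> C}" if "0 \<le> t" for n t using vD vE that by simp
  obtain r' u0 where r': "strict_mono r'" and u0: "\<And>t. 0 \<le> t \<Longrightarrow> (\<lambda>n. v (r' n) t) \<longlonglongrightarrow> u0 t"
    and u0h: "\<And>s t. 0 \<le> s \<Longrightarrow> 0 \<le> t \<Longrightarrow> (norm (u0 t - u0 s))\<^sup>2 \<le> M * \<bar>t - s\<bar>"
    using equicontinuous_subsequence[OF compact_E vK M hol \<epsilon>] by blast
  define u where "u = restrict u0 {0..}"
  have u: "(\<lambda>n. v (r' n) t) \<longlonglongrightarrow> u t" if "0 \<le> t" for t using u0[OF that] that by (simp add: u_def)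
  have uD: "u t \<in> D" and uE: "E (u t) \<le> C" if "0 \<le> t" for t
    using E_limit[OF u[OF that], of "\<lambda>_. C" C] vD vE that by auto
  have cont: "continuous_on {0..} u"
    by (rule continuous_on_if_Hoelder[of _ _ M]) (use u0h in \<open>auto simp: u_def\<close>)
  have ev_r: "\<forall>\<^sub>F n in sequentially. P (r' n)" if "\<forall>\<^sub>F n in sequentially. P n" for P
    using that r' by (rule eventually_subseq[rotated])
  have jb: "\<exists>B. \<forall>t\<ge>0. \<bar>j w (u t)\<bar> \<le> B \<and> (\<forall>n. \<bar>j w (v n t)\<bar> \<le> B)" for w
    using j_bounded_on_sublevel[of C w] uD uE vD vE by metis
  have jm: "set_borel_measurable lebesgue {a..b} (\<lambda>t. j w (u t))" if "0 \<le> a" for a b w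
    by (rule set_borel_measurable_compose_continuous[OF cont j_measurable that])
  have ji: "set_integrable lebesgue {a..b} (\<lambda>t. j w (u t))" if a: "0 \<le> a" for a b w
  proof -
    obtain B where B: "\<And>t. 0 \<le> t \<Longrightarrow> \<bar>j w (u t)\<bar> \<le> B" using jb[of w] by blast
    show ?thesis by (rule set_integrable_bounded_interval[OF jm[OF a], of _ _ B]) (use B a in auto)
  qed
  \<comment> \<open>Dyadic endpoints come first, because for Euler interpolants the EVI is available
    only between grid points, which include any given dyadic time from some \<open>n\<close>
    on.\<close>
  have dyadic: "EVI u w (real i / 2^m) (real k / 2^m)" if w: "w \<in> D" and ik: "i \<le> k" for w i k m
  proof -
    define a b where "a = real i / 2^m" and "b = real k / 2^m"
    have ab: "0 \<le> a" "a \<le> b" using ik by (auto simp: a_def b_def divide_right_mono)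
    obtain B where B: "\<And>t. 0 \<le> t \<Longrightarrow> \<bar>j w (u t)\<bar> \<le> B" "\<And>t n. 0 \<le> t \<Longrightarrow> \<bar>j w (v n t)\<bar> \<le> B" using jb[of w] by blast
    have eps: "(norm (u b - w))\<^sup>2 / 2 - (norm (u a - w))\<^sup>2 / 2 + ((LINT t:{a..b}|lebesgue. j w (u t)) - e) \<le> (b - a) * r w"
      if e: "e > 0" for e
    proof -
      have "\<forall>\<^sub>F n in sequentially. (LINT t:{a..b}|lebesgue. j w (u t)) - e < (LINT t:{a..b}|lebesgue. j w (v (r' n) t))"
      proof (rule set_integral_eventually_ge[of a b "\<lambda>n t. j w (v (r' n) t)" B "\<lambda>t. j w (u t)"])
        show "\<forall>\<^sub>F n in sequentially. j w (u t) - e' < j w (v (r' n) t)" if "t \<in> {a..b}" "0 < e'" for t e'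
          using that ab by (intro j_liminf u vD uD) auto
      qed (use meas jm ab B e in auto)
      moreover have "\<forall>\<^sub>F n in sequentially. EVI (v (r' n)) w a b" unfolding a_def b_def by (rule ev_r[OF evi[OF w ik]])
      ultimately have "\<forall>\<^sub>F n in sequentially. (norm (v (r' n) b - w))\<^sup>2 / 2 - (norm (v (r' n) a - w))\<^sup>2 / 2
          + ((LINT t:{a..b}|lebesgue. j w (u t)) - e) \<le> (b - a) * r w"
        by eventually_elim (auto simp: EVI_def)
      moreover have "(\<lambda>n. (norm (v (r' n) b - w))\<^sup>2 / 2 - (norm (v (r' n) a - w))\<^sup>2 / 2 + ((LINT t:{a..b}|lebesgue. j w (u t)) - e))
          \<longlonglongrightarrow> (norm (u b - w))\<^sup>2 / 2 - (norm (u a - w))\<^sup>2 / 2 + ((LINT t:{a..b}|lebesgue. j w (u t)) - e)"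
        using ab by (intro tendsto_intros u) auto
      ultimately show ?thesis by (intro tendsto_upperbound) auto
    qed
    have "(norm (u b - w))\<^sup>2 / 2 - (norm (u a - w))\<^sup>2 / 2 + (LINT t:{a..b}|lebesgue. j w (u t)) \<le> (b - a) * r w"
    proof (rule field_le_epsilon)
      fix e :: real assume "0 < e"
      from eps[OF this] show "(norm (u b - w))\<^sup>2 / 2 - (norm (u a - w))\<^sup>2 / 2 + (LINT t:{a..b}|lebesgue. j w (u t)) \<le> (b - a) * r w + e"
        by linarith
    qed
    then show ?thesis using ji[OF ab(1)] by (simp add: EVI_def a_def b_def)
  qed
  \<comment> \<open>Both endpoints are rounded down to the dyadic grid; the integrals over the small
    leftovers vanish in the limit.\<close>
  have all: "EVI u w a b" if w: "w \<in> D" and ab: "0 \<le> a" "a \<le> b" for w a b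
  proof -
    define A where "A n = real (dyadic_index n a) / 2^n" for n
    define B where "B n = real (dyadic_index n b) / 2^n" for n
    have b0: "0 \<le> b" using ab by simp
    have AB: "0 \<le> A n" "A n \<le> a" "A n \<le> B n" "B n \<le> b" for n
      using dyadic_index_bounds(1)[OF ab(1), of n] dyadic_index_bounds(1)[OF b0, of n] dyadic_index_mono[OF ab(2), of n]
      by (auto simp: A_def B_def divide_right_mono)
    have Al: "A \<longlonglongrightarrow> a" and Bl: "B \<longlonglongrightarrow> b"
      unfolding A_def B_def using dyadic_left_tendsto(1) ab b0 by auto
    have uA: "(\<lambda>n. u (A n)) \<longlonglongrightarrow> u a" and uB: "(\<lambda>n. u (B n)) \<longlonglongrightarrow> u b"
      using AB ab b0 order_trans[OF AB(1,3)] by (auto intro!: continuous_on_tendsto_compose[OF cont Al] continuous_on_tendsto_compose[OF cont Bl] always_eventually)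
    have AI: "A n \<in> {0..b}" and BI: "B n \<in> {0..b}" for n using AB[of n] ab by auto
    have z: "(\<lambda>n. LINT t:{A n..a}|lebesgue. j w (u t)) \<longlonglongrightarrow> 0" "(\<lambda>n. LINT t:{B n..b}|lebesgue. j w (u t)) \<longlonglongrightarrow> 0"
      using ab by (auto intro!: set_integral_interval_tendsto_0(1)[OF ji[of 0 b]] AI BI Al Bl)
    have split: "(LINT t:{A n..B n}|lebesgue. j w (u t)) =
      (LINT t:{a..b}|lebesgue. j w (u t)) + (LINT t:{A n..a}|lebesgue. j w (u t)) - (LINT t:{B n..b}|lebesgue. j w (u t))" for n
      using set_integral_interval_combine[OF ji[OF AB(1)], of n a b w] set_integral_interval_combine[OF ji[OF AB(1)], of n "B n" b w] AB[of n] ab by simp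
    have "(\<lambda>n. (norm (u (B n) - w))\<^sup>2 / 2 - (norm (u (A n) - w))\<^sup>2 / 2 + ((LINT t:{a..b}|lebesgue. j w (u t)) + (LINT t:{A n..a}|lebesgue. j w (u t)) - (LINT t:{B n..b}|lebesgue. j w (u t))))
      \<longlonglongrightarrow> (norm (u b - w))\<^sup>2 / 2 - (norm (u a - w))\<^sup>2 / 2 + ((LINT t:{a..b}|lebesgue. j w (u t)) + 0 - 0)"
      by (intro tendsto_intros uA uB z) auto
    moreover have "(\<lambda>n. (B n - A n) * r w) \<longlonglongrightarrow> (b - a) * r w" by (intro tendsto_intros Al Bl)
    moreover have "EVI u w (A n) (B n)" for n unfolding A_def B_def by (intro dyadic w dyadic_index_mono ab)
    ultimately have "(norm (u b - w))\<^sup>2 / 2 - (norm (u a - w))\<^sup>2 / 2 + ((LINT t:{a..b}|lebesgue. j w (u t)) + 0 - 0) \<le> (b - a) * r w"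
      by (intro LIMSEQ_le) (auto simp: EVI_def split)
    then show ?thesis using ji[OF ab(1)] by (simp add: EVI_def)
  qed
  have "dyadic_energy u N m \<le> C'" for N m
  proof -
    have "(\<lambda>n. dyadic_energy (v (r' n)) N m) \<longlonglongrightarrow> dyadic_energy u N m"
      unfolding dyadic_energy_def dyadic_slope_def by (intro tendsto_intros u) auto
    then show ?thesis using ev_r[OF energy] by (intro tendsto_upperbound) auto
  qed
  then have "u \<in> G" by (intro EVI_imp_solution[OF _ cont uD all, of C']) (auto simp: u_def)
  then show ?thesis using r' u by blast
qed

end

section \<open>The semiflow of solutions\<close>

context gradient_system
begin

section \<open>Existence by minimising movements\<close>

text \<open>Each step minimises \<open>E v\<close> plus the squared distance to the previous point
  divided by \<open>2 * \<tau>\<close>. Comparison with the previous point gives the energy drop;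
  the inclusion at the minimiser, multiplied by \<open>\<tau>\<close>, gives a discrete EVI after
  dropping half the squared step. Minimisers exist for every positive \<open>\<tau>\<close>, since
  \<open>E\<close> has compact sublevels.\<close>

lemma euler_sequence:
  assumes \<tau>: "\<tau> > 0" and x: "x \<in> D"
  shows "\<exists>U. U 0 = x \<and> (\<forall>k. U k \<in> D) \<and>
    (\<forall>k. (norm (U (Suc k) - U k))\<^sup>2 \<le> 2 * \<tau> * (E (U k) - E (U (Suc k)))) \<and>
    (\<forall>k. \<forall>w\<in>D. (norm (U (Suc k) - w))\<^sup>2 / 2 - (norm (U k - w))\<^sup>2 / 2 + \<tau> * j w (U (Suc k)) \<le> \<tau> * r w)"
proof -
  have step: "\<exists>y. y \<in> D \<and> (norm (y - z))\<^sup>2 \<le> 2 * \<tau> * (E z - E y) \<and>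
      (\<forall>w\<in>D. (norm (y - w))\<^sup>2 / 2 - (norm (z - w))\<^sup>2 / 2 + \<tau> * j w y \<le> \<tau> * r w)" if z: "z \<in> D" for z
  proof -
    have "continuous_on UNIV (\<lambda>v. (norm (v - z))\<^sup>2 / (2 * \<tau>))" using \<tau> by (intro continuous_intros) auto
    then obtain y where y: "y \<in> D" "\<And>v. v \<in> D \<Longrightarrow> E y + (norm (y - z))\<^sup>2 / (2 * \<tau>) \<le> E v + (norm (v - z))\<^sup>2 / (2 * \<tau>)"
      using E_attains_inf[of "\<lambda>v. (norm (v - z))\<^sup>2 / (2 * \<tau>)" z] \<tau> z by auto
    have "(norm (y - z))\<^sup>2 / (2 * \<tau>) \<le> E z - E y" using y(2)[OF z] by simp
    then have 1: "(norm (y - z))\<^sup>2 \<le> 2 * \<tau> * (E z - E y)" using \<tau> by (simp add: field_simps)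
    have "(norm (y - w))\<^sup>2 / 2 - (norm (z - w))\<^sup>2 / 2 + \<tau> * j w y \<le> \<tau> * r w" if w: "w \<in> D" for w
    proof -
      have "r y + (- (1/\<tau>) *\<^sub>R (y - z) - F y) \<bullet> (w - y) \<le> r w" by (rule E_minimizer_inclusion[OF \<tau> y w])
      then have "r y + F y \<bullet> (y - w) + ((y - z) \<bullet> (y - w)) / \<tau> \<le> r w"
        by (simp add: inner_diff_left inner_diff_right diff_divide_distrib)
      then have "\<tau> * (r y + F y \<bullet> (y - w) + ((y - z) \<bullet> (y - w)) / \<tau>) \<le> \<tau> * r w" using \<tau> by (intro mult_left_mono) auto
      then have "\<tau> * j w y + (y - z) \<bullet> (y - w) \<le> \<tau> * r w" using \<tau> by (simp add: j_def distrib_left)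
      moreover have "(norm (z - w))\<^sup>2 = (norm (y - w))\<^sup>2 - 2 * ((y - z) \<bullet> (y - w)) + (norm (y - z))\<^sup>2"
        unfolding power2_norm_eq_inner by (simp add: inner_diff_left inner_diff_right inner_commute)
      moreover have "0 \<le> (norm (y - z))\<^sup>2" by simp
      ultimately show ?thesis by linarith
    qed
    with y(1) 1 show ?thesis by blast
  qed
  define Q where "Q z y \<longleftrightarrow> (norm (y - z))\<^sup>2 \<le> 2 * \<tau> * (E z - E y) \<and>
      (\<forall>w\<in>D. (norm (y - w))\<^sup>2 / 2 - (norm (z - w))\<^sup>2 / 2 + \<tau> * j w y \<le> \<tau> * r w)" for z y
  have "\<exists>U. \<forall>k. (U k \<in> D \<and> (k = 0 \<longrightarrow> U k = x)) \<and> Q (U k) (U (Suc k))"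
    by (rule dependent_nat_choice[where P="\<lambda>k z. z \<in> D \<and> (k = 0 \<longrightarrow> z = x)" and Q="\<lambda>_. Q"])
      (use x step in \<open>auto simp: Q_def\<close>)
  then show ?thesis unfolding Q_def by metis
qed

text \<open>The step is \<open>1 / 2^n\<close>, so the grid contains all dyadic points of level
  \<open>l \<le> n\<close>, where the discrete inequalities sum up to the EVI and to a bound on the
  dyadic energy. At arbitrary times a Hoelder estimate with slack \<open>1 / 2^n\<close> is
  left.\<close>

lemma euler_interpolant:
  assumes x: "x \<in> D" and m: "\<And>y. y \<in> D \<Longrightarrow> m \<le> E y"
  shows "\<exists>v. v 0 = x \<and> (\<forall>t\<ge>0. v t \<in> D \<and> E (v t) \<le> E x) \<and>
    (\<forall>w a b. set_borel_measurable lebesgue {a..b} (\<lambda>t. j w (v t))) \<and>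
    (\<forall>s\<ge>0. \<forall>t\<ge>0. (norm (v t - v s))\<^sup>2 \<le> (2 * (E x - m)) * (\<bar>t - s\<bar> + 1 / 2^n)) \<and>
    (\<forall>w\<in>D. \<forall>l\<le>n. \<forall>i k. i \<le> k \<longrightarrow> EVI v w (real i / 2^l) (real k / 2^l)) \<and>
    (\<forall>l\<le>n. \<forall>N. dyadic_energy v N l \<le> 2 * (E x - m))"
proof -
  define \<tau> where "\<tau> = (1 / 2^n :: real)"
  have \<tau>: "\<tau> > 0" by (simp add: \<tau>_def)
  obtain U where U0: "U 0 = x" and UD: "\<And>k. U k \<in> D"
    and US: "\<And>k. (norm (U (Suc k) - U k))\<^sup>2 \<le> 2 * \<tau> * (E (U k) - E (U (Suc k)))"
    and UE: "\<And>k w. w \<in> D \<Longrightarrow> (norm (U (Suc k) - w))\<^sup>2 / 2 - (norm (U k - w))\<^sup>2 / 2 + \<tau> * j w (U (Suc k)) \<le> \<tau> * r w"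
    using euler_sequence[OF \<tau> x] by blast
  have Udec: "E (U (Suc k)) \<le> E (U k)" for k
  proof -
    have "0 \<le> 2 * \<tau> * (E (U k) - E (U (Suc k)))" using US[of k] by (rule order_trans[rotated]) simp
    then show ?thesis using \<tau> by (simp add: zero_le_mult_iff)
  qed
  have Umono: "E (U k) \<le> E (U i)" if "i \<le> k" for i k
    using lift_Suc_antimono_le[of "\<lambda>k. E (U k)", OF Udec that] .
  have Udist: "(norm (U k - U i))\<^sup>2 \<le> (real (k - i) * \<tau>) * (2 * (E (U i) - E (U k)))" if "i \<le> k" for i k
    using that
  proof (induction k rule: dec_induct)
    case (step k)
    have s: "(norm (U (Suc k) - U k))\<^sup>2 \<le> \<tau> * (2 * (E (U k) - E (U (Suc k))))" using US[of k] by (simp add: algebra_simps)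
    have "(norm ((U k - U i) + (U (Suc k) - U k)))\<^sup>2 \<le> (real (k - i) * \<tau> + \<tau>) * (2 * (E (U i) - E (U k)) + 2 * (E (U k) - E (U (Suc k))))"
      by (rule norm_sq_add_le[OF step.IH s]) (use \<tau> Umono[OF step.hyps(1)] Udec[of k] in auto)
    then show ?case using step.hyps by (simp add: Suc_diff_le algebra_simps)
  qed simp
  \<comment> \<open>Rounding up gives the value \<open>U (Suc k)\<close> inside the cell from
    \<open>k\<close> to \<open>Suc k\<close>, the point at which the implicit scheme evaluates
    \<open>j\<close>.\<close>
  define v :: "real \<Rightarrow> 'a" where "v t = U (nat \<lceil>2^n * t\<rceil>)" for t
  have vgrid: "v (real k * \<tau>) = U k" for k by (simp add: v_def \<tau>_def)
  have vgrid': "v (real k / 2^l) = U (k * 2^(n - l))" if "l \<le> n" for k l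
  proof -
    have "(2::real)^n = 2^l * 2^(n - l)" using that by (simp flip: power_add)
    then have "real k / 2^l = real (k * 2^(n - l)) * \<tau>" by (simp add: \<tau>_def)
    then show ?thesis using vgrid[of "k * 2^(n - l)"] by simp
  qed
  have vstep: "v t = U (Suc k)" if "real k * \<tau> < t" "t < real (Suc k) * \<tau>" for k t
  proof -
    have "\<lceil>2^n * t\<rceil> = int (Suc k)" using that by (intro ceiling_unique) (auto simp: \<tau>_def field_simps)
    then show ?thesis by (simp only: v_def nat_int)
  qed
  have evi_grid: "EVI v w (real i * \<tau>) (real k * \<tau>)" if w: "w \<in> D" and ik: "i \<le> k" for w i k
  proof -
    have st: "\<And>l t. real l * \<tau> < t \<Longrightarrow> t < real (Suc l) * \<tau> \<Longrightarrow> j w (v t) = j w (U (Suc l))" by (simp only: vstep)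
    have "(norm (U k - w))\<^sup>2 / 2 - (norm (U i - w))\<^sup>2 / 2 + \<tau> * (\<Sum>l=i..<k. j w (U (Suc l))) \<le> real (k - i) * (\<tau> * r w)"
      using ik
    proof (induction k rule: dec_induct)
      case (step k)
      then show ?case using UE[OF w, of k] by (simp add: Suc_diff_le algebra_simps)
    qed simp
    then show ?thesis unfolding EVI_def vgrid
      using step_function_integral[where h="\<lambda>l. j w (U (Suc l))" and f="\<lambda>t. j w (v t)", OF \<tau> st ik] ik
      by (simp add: of_nat_diff algebra_simps)
  qed
  show ?thesis
  proof (intro exI[of _ v] conjI allI impI ballI)
    show "v 0 = x" using vgrid[of 0] U0 by simp
    show "v t \<in> D" "E (v t) \<le> E x" if "0 \<le> t" for t using UD Umono[of 0] U0 by (auto simp: v_def)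
    show "set_borel_measurable lebesgue {a..b} (\<lambda>t. j w (v t))" for w a b
    proof -
      have "(\<lambda>t::real. nat \<lceil>2^n * t\<rceil>) \<in> borel \<rightarrow>\<^sub>M count_space UNIV" by measurable
      then have "(\<lambda>t::real. j w (U (nat \<lceil>2^n * t\<rceil>))) \<in> borel_measurable borel"
        by (rule measurable_compose[where g="\<lambda>k. j w (U k)"]) simp
      then have "(\<lambda>t. j w (v t)) \<in> borel_measurable lborel" by (simp add: v_def)
      then have "(\<lambda>t. j w (v t)) \<in> borel_measurable lebesgue" by (rule measurable_completion)
      then show ?thesis unfolding set_borel_measurable_def
        by (intro borel_measurable_scaleR borel_measurable_indicator) auto
    qed
    have le: "(norm (v t - v s))\<^sup>2 \<le> (2 * (E x - m)) * (\<bar>t - s\<bar> + 1 / 2^n)" if st: "0 \<le> s" "s \<le> t" for s t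
    proof -
      let ?i = "nat \<lceil>2^n * s\<rceil>" and ?k = "nat \<lceil>2^n * t\<rceil>"
      have ik: "?i \<le> ?k" using st by (intro nat_mono ceiling_mono mult_left_mono) auto
      have "real ?i \<ge> 2^n * s" using st by (simp add: real_nat_ceiling_ge)
      \<comment> \<open>Rounding costs at most one cell, the source of the slack
        \<open>1 / 2^n\<close>.\<close>
      moreover have "real ?k \<le> 2^n * t + 1"
      proof -
        have "0 \<le> 2^n * t" using st by simp
        then have "real ?k = of_int \<lceil>2^n * t\<rceil>" by (simp add: of_nat_nat)
        then show ?thesis using ceiling_correct[of "2^n * t"] by linarith
      qed
      ultimately have "real (?k - ?i) \<le> 2^n * (t - s) + 1" using ik by (simp add: of_nat_diff algebra_simps)
      then have "real (?k - ?i) * \<tau> \<le> (2^n * (t - s) + 1) * \<tau>" using \<tau> by (intro mult_right_mono) auto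
      also have "\<dots> = (t - s) + 1 / 2^n" by (simp add: \<tau>_def field_simps)
      finally have a: "real (?k - ?i) * \<tau> \<le> \<bar>t - s\<bar> + 1 / 2^n" using st by simp
      have b: "2 * (E (U ?i) - E (U ?k)) \<le> 2 * (E x - m)" using Umono[of 0 ?i] U0 m[OF UD[of ?k]] by simp
      have "(norm (v t - v s))\<^sup>2 \<le> (real (?k - ?i) * \<tau>) * (2 * (E (U ?i) - E (U ?k)))" unfolding v_def by (rule Udist[OF ik])
      also have "\<dots> \<le> (\<bar>t - s\<bar> + 1 / 2^n) * (2 * (E x - m))"
        using a b Umono[OF ik] \<tau> by (intro mult_mono) auto
      finally show ?thesis by (simp add: mult.commute)
    qed
    show "(norm (v t - v s))\<^sup>2 \<le> (2 * (E x - m)) * (\<bar>t - s\<bar> + 1 / 2^n)" if "0 \<le> s" "0 \<le> t" for s t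
      using le[of s t] le[of t s] that by (cases "s \<le> t") (auto simp: norm_minus_commute abs_minus_commute)
    show "EVI v w (real i / 2^l) (real k / 2^l)" if w: "w \<in> D" "l \<le> n" "i \<le> k" for w l i k
    proof -
      have "(2::real)^n = 2^l * 2^(n - l)" using that by (simp flip: power_add)
      then have e: "real k / 2^l = real (k * 2^(n - l)) * \<tau>" for k by (simp add: \<tau>_def)
      show ?thesis unfolding e by (rule evi_grid[OF w(1)]) (use w(3) in simp)
    qed
    show "dyadic_energy v N l \<le> 2 * (E x - m)" if l: "l \<le> n" for l N
    proof -
      let ?c = "2^(n - l) :: nat"
      have "(2::real)^n = 2^l * 2^(n - l)" using l by (simp flip: power_add)
      then have ct: "real ?c * \<tau> = 1 / 2^l" by (simp add: \<tau>_def)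
      have "(norm (v ((real k + 1) / 2^l) - v (real k / 2^l)))\<^sup>2 \<le> 2 * (1 / 2^l) * (E (U (k * ?c)) - E (U (Suc k * ?c)))" for k
      proof -
        have "v ((real k + 1) / 2^l) = U (Suc k * ?c)" using vgrid'[OF l, of "Suc k"] by (simp add: add.commute)
        moreover have "real (Suc k * ?c - k * ?c) * \<tau> = 1 / 2^l" using ct by simp
        ultimately show ?thesis using Udist[of "k * ?c" "Suc k * ?c"] vgrid'[OF l, of k] by simp
      qed
      from dyadic_energy_le[of v l "\<lambda>k. E (U (k * ?c))", OF this m[OF UD]]
      show ?thesis using U0 by simp
    qed
  qed
qed

lemma solution_exists:
  assumes x: "x \<in> D"
  shows "\<exists>u\<in>G. u 0 = x"
proof -
  obtain m where m: "\<And>y. y \<in> D \<Longrightarrow> m \<le> E y" using E_bounded_below by blast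
  define P where "P n v \<longleftrightarrow> v 0 = x \<and> (\<forall>t\<ge>0. v t \<in> D \<and> E (v t) \<le> E x) \<and>
    (\<forall>w a b. set_borel_measurable lebesgue {a..b} (\<lambda>t. j w (v t))) \<and>
    (\<forall>s\<ge>0. \<forall>t\<ge>0. (norm (v t - v s))\<^sup>2 \<le> (2 * (E x - m)) * (\<bar>t - s\<bar> + 1 / 2^n)) \<and>
    (\<forall>w\<in>D. \<forall>l\<le>n. \<forall>i k. i \<le> k \<longrightarrow> EVI v w (real i / 2^l) (real k / 2^l)) \<and>
    (\<forall>l\<le>n. \<forall>N. dyadic_energy v N l \<le> 2 * (E x - m))" for n v
  have "\<forall>n. \<exists>v. P n v" unfolding P_def using euler_interpolant[OF x m] by (intro allI)
  from choice[OF this] obtain v where Pv: "\<And>n. P n (v n)" by blast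
  have v: "v n 0 = x" "0 \<le> t \<Longrightarrow> v n t \<in> D" "0 \<le> t \<Longrightarrow> E (v n t) \<le> E x"
    "set_borel_measurable lebesgue {a..b} (\<lambda>t. j w (v n t))"
    "0 \<le> s \<Longrightarrow> 0 \<le> t \<Longrightarrow> (norm (v n t - v n s))\<^sup>2 \<le> (2 * (E x - m)) * (\<bar>t - s\<bar> + 1 / 2^n)"
    "w \<in> D \<Longrightarrow> l \<le> n \<Longrightarrow> i \<le> k \<Longrightarrow> EVI (v n) w (real i / 2^l) (real k / 2^l)"
    "l \<le> n \<Longrightarrow> dyadic_energy (v n) N l \<le> 2 * (E x - m)" for n s t a b w l i k N
    using Pv[of n] unfolding P_def by simp_all
  have z: "(\<lambda>n. 1 / 2^n :: real) \<longlonglongrightarrow> 0"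
    using LIMSEQ_power_zero[of "1/2::real"] by (simp add: power_one_over)
  have "\<exists>r u. strict_mono r \<and> u \<in> G \<and> (\<forall>t\<ge>0. (\<lambda>n. v (r n) t) \<longlonglongrightarrow> u t)"
  proof (rule limit_is_solution[OF v(2,3) v(4) v(5) _ z])
    show "0 \<le> 2 * (E x - m)" using m[OF x] by simp
    show "\<forall>\<^sub>F n in sequentially. EVI (v n) w (real i / 2^l) (real k / 2^l)" if "w \<in> D" "i \<le> k" for w l i k
      using eventually_ge_at_top[of l] by eventually_elim (use v(6) that in auto)
    show "\<forall>\<^sub>F n in sequentially. dyadic_energy (v n) N l \<le> 2 * (E x - m)" for N l
      using eventually_ge_at_top[of l] by eventually_elim (use v(7) in auto)
  qed auto
  then obtain r' u where u: "u \<in> G" "\<And>t. t \<ge> 0 \<Longrightarrow> (\<lambda>n. v (r' n) t) \<longlonglongrightarrow> u t" by blast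
  have "(\<lambda>n. x) \<longlonglongrightarrow> u 0" using u(2)[of 0] v(1) by simp
  then have "u 0 = x" by (simp add: LIMSEQ_const_iff)
  then show ?thesis using u(1) by blast
qed

section \<open>Estimates for solutions, translation and concatenation\<close>

lemma solution_Hoelder:
  assumes u: "u \<in> G" and m: "\<And>y. y \<in> D \<Longrightarrow> m \<le> E y" and st: "0 \<le> s" "0 \<le> t"
  shows "(norm (u t - u s))\<^sup>2 \<le> (2 * (E (u 0) - m)) * \<bar>t - s\<bar>"
proof -
  have *: "(norm (u t - u s))\<^sup>2 \<le> (2 * (E (u 0) - m)) * \<bar>t - s\<bar>" if "0 \<le> s" "s \<le> t" for s t
  proof -
    have "(norm (u t - u s))\<^sup>2 \<le> 2 * (t - s) * (E (u s) - E (u t))" by (rule solution_energy_le[OF u that])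
    also have "\<dots> \<le> 2 * (t - s) * (E (u 0) - m)"
      using solution_E_mono[OF u, of 0 s] m[OF solution_in_D[OF u, of t]] that by (intro mult_left_mono) auto
    finally show ?thesis using that by (simp add: algebra_simps)
  qed
  show ?thesis using *[of s t] *[of t s] st by (cases "s \<le> t") (auto simp: norm_minus_commute abs_minus_commute)
qed

lemma solution_dyadic_energy_le:
  fixes u :: "real \<Rightarrow> 'a"
  assumes m: "\<And>y. y \<in> D \<Longrightarrow> m \<le> E y" and uD: "\<And>t. 0 \<le> t \<Longrightarrow> u t \<in> D"
    and le: "\<And>a b. 0 \<le> a \<Longrightarrow> a \<le> b \<Longrightarrow> (norm (u b - u a))\<^sup>2 \<le> 2 * (b - a) * (E (u a) - E (u b))"
  shows "dyadic_energy u N n \<le> 2 * (E (u 0) - m)"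
proof -
  have "(norm (u ((real k + 1) / 2^n) - u (real k / 2^n)))\<^sup>2 \<le> 2 * (1 / 2^n) * (E (u (real k / 2^n)) - E (u (real (Suc k) / 2^n)))" for k
  proof -
    have "(norm (u ((real k + 1) / 2^n) - u (real k / 2^n)))\<^sup>2 \<le> 2 * ((real k + 1) / 2^n - real k / 2^n) * (E (u (real k / 2^n)) - E (u ((real k + 1) / 2^n)))"
      by (intro le) (auto simp: divide_right_mono)
    then show ?thesis by (simp add: add_divide_distrib add.commute)
  qed
  from dyadic_energy_le[of u n "\<lambda>k. E (u (real k / 2^n))", OF this m[OF uD]] show ?thesis by simp
qed

lemma solution_continuous: "u \<in> G \<Longrightarrow> continuous_on {0..} u"
  using solution_derivative by blast

text \<open>The converse of \<open>solution_EVI\<close> and \<open>solution_energy_le\<close>: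
  translation and concatenation are verified on inequalities, with no return to weak
  derivatives.\<close>

lemma energy_EVI_imp_solution:
  assumes ext: "u \<in> extensional {0..}" and uD: "\<And>t. 0 \<le> t \<Longrightarrow> u t \<in> D"
    and cont: "continuous_on {0..} u"
    and le: "\<And>a b. 0 \<le> a \<Longrightarrow> a \<le> b \<Longrightarrow> (norm (u b - u a))\<^sup>2 \<le> 2 * (b - a) * (E (u a) - E (u b))"
    and evi: "\<And>w a b. w \<in> D \<Longrightarrow> 0 \<le> a \<Longrightarrow> a \<le> b \<Longrightarrow> EVI u w a b"
  shows "u \<in> G"
proof -
  obtain m where m: "\<And>y. y \<in> D \<Longrightarrow> m \<le> E y" using E_bounded_below by blast
  show ?thesis
    by (rule EVI_imp_solution[OF ext cont uD evi solution_dyadic_energy_le[OF m uD le]])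
qed

lemma solution_shift:
  assumes u: "u \<in> G" and \<tau>: "0 \<le> \<tau>"
  shows "restrict (\<lambda>t. u (t + \<tau>)) {0..} \<in> G"
proof (rule energy_EVI_imp_solution)
  show "continuous_on {0..} (restrict (\<lambda>t. u (t + \<tau>)) {0..})"
  proof -
    have "continuous_on {0..} (\<lambda>t. u (t + \<tau>))"
      by (rule continuous_on_compose2[OF solution_continuous[OF u]]) (use \<tau> in \<open>auto intro!: continuous_intros\<close>)
    then show ?thesis by (rule continuous_on_eq) simp
  qed
  show "(norm (restrict (\<lambda>t. u (t + \<tau>)) {0..} b - restrict (\<lambda>t. u (t + \<tau>)) {0..} a))\<^sup>2
      \<le> 2 * (b - a) * (E (restrict (\<lambda>t. u (t + \<tau>)) {0..} a) - E (restrict (\<lambda>t. u (t + \<tau>)) {0..} b))" if "0 \<le> a" "a \<le> b" for a b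
    using solution_energy_le[OF u, of "a + \<tau>" "b + \<tau>"] that \<tau> by simp
  show "EVI (restrict (\<lambda>t. u (t + \<tau>)) {0..}) w a b" if "w \<in> D" "0 \<le> a" "a \<le> b" for w a b
    using EVI_cong[of a b "restrict (\<lambda>t. u (t + \<tau>)) {0..}" "\<lambda>t. u (t + \<tau>)" w] EVI_shift[OF solution_EVI[OF u that(1)], of a \<tau> b] that \<tau> by simp
qed (use solution_in_D[OF u] \<tau> in auto)

text \<open>The EVI is additive at the junction time \<open>t\<close>, and the energy estimate is
  glued there by \<open>norm_sq_add_le\<close>, whose sign conditions hold because the energy
  decreases on both pieces.\<close>

lemma solution_concat:
  assumes g: "g \<in> G" and h: "h \<in> G" and t: "0 \<le> t" and eq: "h 0 = g t"
  shows "restrict (\<lambda>\<tau>. if \<tau> \<le> t then g \<tau> else h (\<tau> - t)) {0..} \<in> G" (is "?z \<in> G")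
proof (rule energy_EVI_imp_solution)
  have z1: "?z s = g s" if "0 \<le> s" "s \<le> t" for s using that by simp
  have z2: "?z s = h (s - t)" if "t \<le> s" for s using that t eq by (cases "s = t") auto
  show zD: "?z s \<in> D" if "0 \<le> s" for s using solution_in_D[OF g, of s] solution_in_D[OF h, of "s - t"] that by simp
  have e1: "(norm (?z b - ?z a))\<^sup>2 \<le> (b - a) * (2 * (E (?z a) - E (?z b)))" if "0 \<le> a" "a \<le> b" "b \<le> t" for a b
    using solution_energy_le[OF g, of a b] that unfolding z1[OF that(1) order_trans[OF that(2,3)]] z1[OF order_trans[OF that(1,2)] that(3)]
    by (simp add: algebra_simps)
  have e2: "(norm (?z b - ?z a))\<^sup>2 \<le> (b - a) * (2 * (E (?z a) - E (?z b)))" if "t \<le> a" "a \<le> b" for a b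
    using solution_energy_le[OF h, of "a - t" "b - t"] that unfolding z2[OF that(1)] z2[OF order_trans[OF that]]
    by (simp add: algebra_simps)
  show "(norm (?z b - ?z a))\<^sup>2 \<le> 2 * (b - a) * (E (?z a) - E (?z b))" if ab: "0 \<le> a" "a \<le> b" for a b
  proof -
    consider "b \<le> t" | "t \<le> a" | "a \<le> t" "t \<le> b" by linarith
    then have "(norm (?z b - ?z a))\<^sup>2 \<le> (b - a) * (2 * (E (?z a) - E (?z b)))"
    proof cases
      case 1
      then show ?thesis by (rule e1[OF ab])
    next
      case 2
      then show ?thesis by (rule e2) (rule ab)
    next
      case 3
      have "E (?z t) \<le> E (?z a)"
        using solution_E_mono[OF g ab(1) 3(1)] unfolding z1[OF ab(1) 3(1)] z1[OF t order_refl] .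
      moreover have "E (?z b) \<le> E (?z t)"
        using solution_E_mono[OF h, of 0 "b - t"] 3(2) unfolding z2[OF 3(2)] z2[OF order_refl] by simp
      ultimately have "(norm ((?z t - ?z a) + (?z b - ?z t)))\<^sup>2 \<le> ((t - a) + (b - t)) * (2 * (E (?z a) - E (?z t)) + 2 * (E (?z t) - E (?z b)))"
        using 3 by (intro norm_sq_add_le e1 e2 ab) auto
      moreover have "(?z t - ?z a) + (?z b - ?z t) = ?z b - ?z a" by simp
      moreover have "((t - a) + (b - t)) * (2 * (E (?z a) - E (?z t)) + 2 * (E (?z t) - E (?z b))) = (b - a) * (2 * (E (?z a) - E (?z b)))"
        by (simp only: right_diff_distrib) (simp add: algebra_simps)
      ultimately show ?thesis by (simp only:)
    qed
    then show ?thesis by (simp only: mult_ac)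
  qed
  have v1: "EVI ?z w a b" if "w \<in> D" "0 \<le> a" "a \<le> b" "b \<le> t" for w a b
  proof -
    have "EVI g w a b" by (rule solution_EVI[OF g that(1-3)])
    then show ?thesis using EVI_cong[of a b ?z g w] that z1 by simp
  qed
  have v2: "EVI ?z w a b" if "w \<in> D" "t \<le> a" "a \<le> b" for w a b
  proof -
    have "EVI h w (a - t) (b - t)" using that by (intro solution_EVI[OF h]) auto
    then have "EVI (\<lambda>s. h (s - t)) w a b" using EVI_shift[of h w a "- t" b] by simp
    moreover have "EVI ?z w a b \<longleftrightarrow> EVI (\<lambda>s. h (s - t)) w a b"
      by (rule EVI_cong) (use that z2 in auto)
    ultimately show ?thesis by simp
  qed
  show "EVI ?z w a b" if w: "w \<in> D" "0 \<le> a" "a \<le> b" for w a b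
  proof -
    consider "b \<le> t" | "t \<le> a" | "a \<le> t" "t \<le> b" by linarith
    then show ?thesis
    proof cases
      case 3
      show ?thesis by (rule EVI_combine[OF v1[OF w(1,2) 3(1) order_refl] v2[OF w(1) order_refl 3(2)] 3])
    qed (use v1 v2 w in blast)+
  qed
  show "continuous_on {0..} ?z"
  proof -
    obtain m where m: "\<And>y. y \<in> D \<Longrightarrow> m \<le> E y" using E_bounded_below by blast
    have "continuous_on ({0..t} \<union> {t..}) (\<lambda>\<tau>. if \<tau> \<le> t then g \<tau> else h (\<tau> - t))"
    proof (rule continuous_on_cases)
      show "continuous_on {0..t} g" using continuous_on_subset[OF solution_continuous[OF g]] by auto
      show "continuous_on {t..} (\<lambda>\<tau>. h (\<tau> - t))"
        by (rule continuous_on_compose2[OF solution_continuous[OF h]]) (auto intro!: continuous_intros)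
    qed (use eq in auto)
    moreover have "{0..t} \<union> {t..} = {0..}" using t by auto
    ultimately show ?thesis by (auto intro: continuous_on_eq)
  qed
qed simp

text \<open>Testing the EVI of the approximating solutions on \<open>[t - d, t - d/2]\<close> with the limit value
  \<open>u t\<close> bounds their energies from above, because energies decrease in time.\<close>

lemma energy_limsup:
  assumes g: "\<And>n. g n \<in> G" and gC: "\<And>n. E (g n 0) \<le> C" and u: "u \<in> G"
    and lim: "\<And>t. 0 \<le> t \<Longrightarrow> (\<lambda>n. g n t) \<longlonglongrightarrow> u t" and t: "0 < t" and \<tau>: "\<tau> \<longlonglongrightarrow> t" and e: "0 < e"
  shows "\<forall>\<^sub>F n in sequentially. E (g n (\<tau> n)) < E (u t) + e"
proof -
  define w where "w = u t"
  have wD: "w \<in> D" using solution_in_D[OF u] t by (simp add: w_def)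
  \<comment> \<open>The continuous function separating the energy from the integrand of the EVI:
    \<open>E x = j w x + q x\<close>, and \<open>q w = p w\<close>.\<close>
  define q where "q x = p x - F x \<bullet> (x - w)" for x
  have qc: "continuous_on UNIV q" unfolding q_def by (intro continuous_intros p_cont F_cont)
  have jq: "j w x = E x - q x" for x by (simp add: j_def E_def q_def)
  have qw: "q w = p w" by (simp add: q_def)
  have uc: "continuous_on {0..} u" by (rule solution_continuous[OF u])
  have "continuous_on {0..} (\<lambda>s. q (u s))" by (rule continuous_on_compose2[OF qc uc]) auto
  then have "((\<lambda>s. q (u s)) \<longlongrightarrow> q w) (at t within {0..})" using t by (simp add: continuous_on w_def)
  then have "\<forall>\<^sub>F s in at t within {0..}. q (u s) < p w + e/4" using e by (intro order_tendstoD(2)) (auto simp: qw)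
  then obtain \<delta> where \<delta>: "\<delta> > 0" "\<And>s. 0 \<le> s \<Longrightarrow> s \<noteq> t \<Longrightarrow> dist s t < \<delta> \<Longrightarrow> q (u s) < p w + e/4"
    unfolding eventually_at by auto
  have "(\<lambda>n. t / (real n + 1)) \<longlonglongrightarrow> 0" using LIMSEQ_ignore_initial_segment[OF lim_const_over_n[of t], of 1] by (simp add: add.commute)
  then have "\<forall>\<^sub>F n in sequentially. t / (real n + 1) < \<delta>" using \<delta>(1) by (intro order_tendstoD(2))
  moreover have "\<forall>\<^sub>F n in sequentially. (norm (u (t - t / (real n + 1)) - u t))\<^sup>2 / (t / (real n + 1)) < e/4"
    using e by (intro order_tendstoD(2)[OF solution_increment_small[OF u t]]) auto
  ultimately have "\<forall>\<^sub>F n in sequentially. t / (real n + 1) < \<delta> \<and> (norm (u (t - t / (real n + 1)) - u t))\<^sup>2 / (t / (real n + 1)) < e/4"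
    by (rule eventually_conj)
  \<comment> \<open>The step \<open>t / (real k + 1)\<close> is short enough for
    \<open>q (u s)\<close> to stay near \<open>p w\<close>, and the squared displacement over it is
    small compared with its length.\<close>
  then obtain k where k: "t / (real k + 1) < \<delta>" "(norm (u (t - t / (real k + 1)) - u t))\<^sup>2 / (t / (real k + 1)) < e/4"
    by (auto simp: eventually_sequentially)
  define d where "d = t / (real k + 1)"
  have d: "0 < d" "d \<le> t" "d < \<delta>" using t k(1) by (auto simp: d_def field_simps)
  \<comment> \<open>Stopping at \<open>t - d/2\<close> leaves room: eventually
    \<open>\<tau> n\<close> lies beyond \<open>b\<close>, so the energy at \<open>\<tau> n\<close>
    is at most that at \<open>b\<close>.\<close>
  define a b where "a = t - d" and "b = t - d/2"
  have ab: "0 \<le> a" "a \<le> b" "b < t" "b - a = d/2" using d by (auto simp: a_def b_def)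
  have "(norm (u a - w))\<^sup>2 / d < e/4" using k(2) unfolding a_def w_def d_def .
  then have small: "(norm (u a - w))\<^sup>2 < d * (e/4)" using d(1) by (simp add: divide_less_eq mult.commute)
  obtain B where B: "\<And>x. x \<in> D \<Longrightarrow> E x \<le> C \<Longrightarrow> \<bar>q x\<bar> \<le> B" using bounded_on_sublevel[OF qc, of C] by blast
  have gD: "g n s \<in> D" "E (g n s) \<le> C" if "0 \<le> s" for n s
    using solution_in_D[OF g that] order_trans[OF solution_E_mono[OF g order_refl that] gC] by auto
  have qm: "q \<in> borel_measurable borel" by (rule borel_measurable_continuous_onI[OF qc])
  have qgm: "set_borel_measurable lebesgue {a..b} (\<lambda>s. q (g n s))" for n
    by (rule set_borel_measurable_compose_continuous[OF solution_continuous[OF g] qm ab(1)])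
  have qum: "set_borel_measurable lebesgue {a..b} (\<lambda>s. q (u s))"
    by (rule set_borel_measurable_compose_continuous[OF uc qm ab(1)])
  have qg: "(\<lambda>n. LINT s:{a..b}|lebesgue. q (g n s)) \<longlonglongrightarrow> (LINT s:{a..b}|lebesgue. q (u s))"
  proof (rule set_integral_bounded_tendsto[OF qgm _ qum])
    show "\<bar>q (g n s)\<bar> \<le> B" if "s \<in> {a..b}" for n s using that ab by (intro B gD) auto
    show "(\<lambda>n. q (g n s)) \<longlonglongrightarrow> q (u s)" if "s \<in> {a..b}" for s
    proof -
      have "isCont q (u s)" using qc by (simp add: continuous_on_eq_continuous_at)
      then show ?thesis by (rule isCont_tendsto_compose) (use that ab lim in auto)
    qed
  qed
  have qgi: "set_integrable lebesgue {a..b} (\<lambda>s. q (g n s))" for n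
    using ab by (intro set_integrable_bounded_interval[OF qgm, of _ B] AE_I2 impI) (auto intro!: B gD)
  have main: "(d/2) * E (g n b) \<le> (d/2) * r w + (norm (g n a - w))\<^sup>2 / 2 + (LINT s:{a..b}|lebesgue. q (g n s))" for n
  proof -
    have ev: "EVI (g n) w a b" by (rule solution_EVI[OF g wD ab(1,2)])
    have "(d/2) * E (g n b) - (LINT s:{a..b}|lebesgue. q (g n s)) = (LINT s:{a..b}|lebesgue. E (g n b)) - (LINT s:{a..b}|lebesgue. q (g n s))"
      using set_integral_const_interval[OF ab(2), of "E (g n b)"] ab(4) by simp
    also have "\<dots> = (LINT s:{a..b}|lebesgue. E (g n b) - q (g n s))"
      by (intro set_integral_diff(2)[symmetric] set_integrable_const_interval qgi)
    also have "\<dots> \<le> (LINT s:{a..b}|lebesgue. j w (g n s))"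
    proof (rule set_integral_mono)
      show "set_integrable lebesgue {a..b} (\<lambda>s. E (g n b) - q (g n s))" by (intro set_integral_diff(1) set_integrable_const_interval qgi)
      show "set_integrable lebesgue {a..b} (\<lambda>s. j w (g n s))" using ev by (simp add: EVI_def)
      show "E (g n b) - q (g n s) \<le> j w (g n s)" if "s \<in> {a..b}" for s
        using solution_E_mono[OF g, of s b n] that ab by (simp add: jq)
    qed
    also have "\<dots> \<le> (d/2) * r w + (norm (g n a - w))\<^sup>2 / 2 - (norm (g n b - w))\<^sup>2 / 2"
      using ev ab(4) by (simp add: EVI_def)
    also have "\<dots> \<le> (d/2) * r w + (norm (g n a - w))\<^sup>2 / 2" by simp
    finally show ?thesis by simp
  qed
  have "(\<lambda>n. (d/2) * r w + (norm (g n a - w))\<^sup>2 / 2 + (LINT s:{a..b}|lebesgue. q (g n s)))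
      \<longlonglongrightarrow> (d/2) * r w + (norm (u a - w))\<^sup>2 / 2 + (LINT s:{a..b}|lebesgue. q (u s))"
    using ab by (intro tendsto_intros lim qg) auto
  \<comment> \<open>A quarter of \<open>e\<close> is spent on the displacement and a quarter on
    \<open>q\<close>; the rest makes the inequality strict.\<close>
  moreover have "(d/2) * r w + (norm (u a - w))\<^sup>2 / 2 + (LINT s:{a..b}|lebesgue. q (u s)) < (d/2) * (E w + e)"
  proof -
    have "(LINT s:{a..b}|lebesgue. q (u s)) \<le> (LINT s:{a..b}|lebesgue. p w + e/4)"
    proof (rule set_integral_mono)
      show "set_integrable lebesgue {a..b} (\<lambda>s. q (u s))"
        using ab by (intro set_integrable_continuous_interval continuous_on_compose2[OF qc] continuous_on_subset[OF uc]) auto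
      show "q (u s) \<le> p w + e/4" if "s \<in> {a..b}" for s
        by (rule less_imp_le[OF \<delta>(2)]) (use that ab d in \<open>auto simp: dist_real_def a_def\<close>)
    qed (rule set_integrable_const_interval)
    also have "\<dots> = (d/2) * (p w + e/4)" using set_integral_const_interval[OF ab(2), of "p w + e/4"] ab(4) by simp
    finally have "(d/2) * r w + (norm (u a - w))\<^sup>2 / 2 + (LINT s:{a..b}|lebesgue. q (u s)) \<le> (d/2) * r w + d * (e/4) / 2 + (d/2) * (p w + e/4)"
      using small by linarith
    also have "\<dots> = (d/2) * (E w + e/2)" by (simp add: E_def algebra_simps)
    also have "\<dots> < (d/2) * (E w + e)" using d(1) e by (intro mult_strict_left_mono) auto
    finally show ?thesis .
  qed
  ultimately have "\<forall>\<^sub>F n in sequentially. (d/2) * r w + (norm (g n a - w))\<^sup>2 / 2 + (LINT s:{a..b}|lebesgue. q (g n s)) < (d/2) * (E w + e)"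
    by (rule order_tendstoD(2))
  moreover have "\<forall>\<^sub>F n in sequentially. b < \<tau> n" by (rule order_tendstoD(1)[OF \<tau> ab(3)])
  ultimately show ?thesis
  proof eventually_elim
    case (elim n)
    have "(d/2) * E (g n b) < (d/2) * (E w + e)" using main[of n] elim(1) by linarith
    then have "E (g n b) < E w + e" using d(1) by (simp only: mult_less_cancel_left_pos half_gt_zero)
    moreover have "E (g n (\<tau> n)) \<le> E (g n b)" using elim(2) ab by (intro solution_E_mono[OF g]) auto
    ultimately show ?case by (simp add: w_def)
  qed
qed

section \<open>Convergence in the metric of the domain; compactness of sets of solutions\<close>

lemma dom_dist_eq: "dom_dist f x y = norm (x - y) + \<bar>r x - r y\<bar>"
  by (simp add: dom_dist_def r_def)

lemma dom_dist_tendsto_iff: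
  "((\<lambda>n. dom_dist f (xs n) y) \<longlongrightarrow> 0) Fi \<longleftrightarrow> (xs \<longlongrightarrow> y) Fi \<and> ((\<lambda>n. r (xs n)) \<longlongrightarrow> r y) Fi"
proof
  assume l: "((\<lambda>n. dom_dist f (xs n) y) \<longlongrightarrow> 0) Fi"
  have "((\<lambda>n. norm (xs n - y)) \<longlongrightarrow> 0) Fi"
    by (rule tendsto_sandwich[OF _ _ tendsto_const l]) (auto simp: dom_dist_eq)
  moreover have "((\<lambda>n. \<bar>r (xs n) - r y\<bar>) \<longlongrightarrow> 0) Fi"
    by (rule tendsto_sandwich[OF _ _ tendsto_const l]) (auto simp: dom_dist_eq)
  ultimately show "(xs \<longlongrightarrow> y) Fi \<and> ((\<lambda>n. r (xs n)) \<longlongrightarrow> r y) Fi"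
    by (simp add: LIM_zero_iff tendsto_norm_zero_iff tendsto_rabs_zero_iff)
next
  assume "(xs \<longlongrightarrow> y) Fi \<and> ((\<lambda>n. r (xs n)) \<longlongrightarrow> r y) Fi"
  then have "((\<lambda>n. norm (xs n - y) + \<bar>r (xs n) - r y\<bar>) \<longlongrightarrow> norm (y - y) + \<bar>r y - r y\<bar>) Fi"
    by (intro tendsto_intros) auto
  then show "((\<lambda>n. dom_dist f (xs n) y) \<longlongrightarrow> 0) Fi" by (simp add: dom_dist_eq)
qed

text \<open>Lower semicontinuity bounds \<open>r\<close> from below; the upper bound on the
  energies, with \<open>p\<close> continuous, bounds it from above. Hence only a limsup inequality
  for \<open>E\<close> has to be checked.\<close>

lemma dom_dist_limit:
  assumes x: "xs \<longlonglongrightarrow> y" and D: "\<And>n. xs n \<in> D" "y \<in> D"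
    and le: "\<And>e. 0 < e \<Longrightarrow> \<forall>\<^sub>F n in sequentially. E (xs n) < E y + e"
  shows "(\<lambda>n. dom_dist f (xs n) y) \<longlonglongrightarrow> 0"
proof -
  have "(\<lambda>n. r (xs n)) \<longlonglongrightarrow> r y"
  proof (rule order_tendstoI)
    fix c assume "c < r y"
    from lsc_eventually[OF x D(2) this] show "\<forall>\<^sub>F n in sequentially. c < r (xs n)" using D(1) by simp
  next
    fix c assume c: "r y < c"
    define e where "e = (c - r y) / 2"
    have e: "0 < e" using c by (simp add: e_def)
    have "\<forall>\<^sub>F n in sequentially. p y - e < p (xs n)" using e by (intro order_tendstoD(1)[OF p_tendsto[OF x]]) simp
    with le[OF e] show "\<forall>\<^sub>F n in sequentially. r (xs n) < c"
    proof eventually_elim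
      case (elim n)
      then show ?case by (simp add: E_def e_def field_simps)
    qed
  qed
  with x show ?thesis by (simp add: dom_dist_tendsto_iff)
qed

text \<open>All curves start in one sublevel, so they share a Hoelder constant and a compact range.
  Convergence in norm holds at every time, but in the metric of the domain it is claimed at positive
  times, where \<open>energy_limsup\<close> applies: the initial energies need not converge to that
  of the limit.\<close>

lemma solutions_compact:
  fixes g :: "nat \<Rightarrow> real \<Rightarrow> 'a"
  assumes g: "\<And>n. g n \<in> G" and gC: "\<And>n. E (g n 0) \<le> C"
  shows "\<exists>r' u. strict_mono r' \<and> u \<in> G \<and> (\<forall>t\<ge>0. (\<lambda>n. g (r' n) t) \<longlonglongrightarrow> u t) \<and> E (u 0) \<le> C \<and>
    (\<forall>t \<tau>. 0 \<le> t \<and> (\<forall>n. 0 \<le> \<tau> n) \<and> \<tau> \<longlonglongrightarrow> t \<longrightarrow> (\<lambda>n. g (r' n) (\<tau> n)) \<longlonglongrightarrow> u t) \<and>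
    (\<forall>t \<tau>. 0 < t \<and> (\<forall>n. 0 \<le> \<tau> n) \<and> \<tau> \<longlonglongrightarrow> t \<longrightarrow> (\<lambda>n. dom_dist f (g (r' n) (\<tau> n)) (u t)) \<longlonglongrightarrow> 0)"
proof -
  obtain m where m: "\<And>y. y \<in> D \<Longrightarrow> m \<le> E y" using E_bounded_below by blast
  have gD: "g n s \<in> D" "E (g n s) \<le> C" if "0 \<le> s" for n s
    using solution_in_D[OF g that] order_trans[OF solution_E_mono[OF g order_refl that] gC] by auto
  define M where "M = 2 * (C - m)"
  have M: "0 \<le> M" using m[OF gD(1)[of 0 0]] gD(2)[of 0 0] by (simp add: M_def)
  have hol: "(norm (g n t - g n s))\<^sup>2 \<le> M * \<bar>t - s\<bar>" if "0 \<le> s" "0 \<le> t" for n s t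
  proof -
    have "(norm (g n t - g n s))\<^sup>2 \<le> (2 * (E (g n 0) - m)) * \<bar>t - s\<bar>" by (rule solution_Hoelder[OF g m that])
    also have "\<dots> \<le> M * \<bar>t - s\<bar>" unfolding M_def using gC[of n] by (intro mult_right_mono) auto
    finally show ?thesis .
  qed
  have "\<exists>r' u. strict_mono r' \<and> u \<in> G \<and> (\<forall>t\<ge>0. (\<lambda>n. g (r' n) t) \<longlonglongrightarrow> u t)"
  proof (rule limit_is_solution[OF gD _ _ M, where \<epsilon>="\<lambda>_. 0" and C'=M])
    show "set_borel_measurable lebesgue {a..b} (\<lambda>t. j w (g n t))" if "0 \<le> a" for n w a b
      by (rule set_borel_measurable_compose_continuous[OF solution_continuous[OF g] j_measurable that])
    show "\<forall>\<^sub>F n in sequentially. EVI (g n) w (real i / 2^l) (real k / 2^l)" if "w \<in> D" "i \<le> k" for w l i k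
      using that by (intro always_eventually allI solution_EVI[OF g]) (auto simp: divide_right_mono)
    have "dyadic_energy (g n) N l \<le> M" for n N l
      using solution_dyadic_energy_le[OF m, of "g n" N l] solution_in_D[OF g] solution_energy_le[OF g] gC[of n] by (force simp: M_def)
    then show "\<forall>\<^sub>F n in sequentially. dyadic_energy (g n) N l \<le> M" for N l by simp
  qed (use hol in auto)
  then obtain r' u where r': "strict_mono r'" and u: "u \<in> G" and lim: "\<And>t. t \<ge> 0 \<Longrightarrow> (\<lambda>n. g (r' n) t) \<longlonglongrightarrow> u t" by blast
  have E0: "E (u 0) \<le> C" using E_limit(2)[OF lim[of 0], of "\<lambda>_. C" C] gD by auto
  have moving: "(\<lambda>n. g (r' n) (\<tau> n)) \<longlonglongrightarrow> u t" if "0 \<le> t" "\<And>n. 0 \<le> \<tau> n" "\<tau> \<longlonglongrightarrow> t" for t \<tau>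
  proof -
    have "(\<lambda>n. M * \<bar>\<tau> n - t\<bar>) \<longlonglongrightarrow> M * \<bar>t - t\<bar>" by (intro tendsto_intros that)
    then have "(\<lambda>n. sqrt (M * \<bar>\<tau> n - t\<bar>)) \<longlonglongrightarrow> 0" using tendsto_real_sqrt by fastforce
    moreover have "norm (g (r' n) (\<tau> n) - g (r' n) t) \<le> sqrt (M * \<bar>\<tau> n - t\<bar>)" for n
      using hol[of t "\<tau> n" "r' n"] that by (simp add: real_le_rsqrt)
    ultimately have "(\<lambda>n. g (r' n) (\<tau> n) - g (r' n) t) \<longlonglongrightarrow> 0"
      by (intro Lim_null_comparison[of "\<lambda>n. g (r' n) (\<tau> n) - g (r' n) t"]) (auto intro: always_eventually)
    from tendsto_add[OF this lim[OF that(1)]] show ?thesis by simp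
  qed
  have "(\<lambda>n. dom_dist f (g (r' n) (\<tau> n)) (u t)) \<longlonglongrightarrow> 0" if "0 < t" "\<And>n. 0 \<le> \<tau> n" "\<tau> \<longlonglongrightarrow> t" for t \<tau>
    using that moving[of t \<tau>] gD(1) solution_in_D[OF u, of t]
    by (intro dom_dist_limit energy_limsup[of "\<lambda>n. g (r' n)", OF g gC u lim]) auto
  then show ?thesis using r' u lim E0 moving by blast
qed

text \<open>The gap at time 0 closes because now the initial energies converge: since energies
  decrease, those at \<open>\<tau> n\<close> are bounded by the initial ones, for any
  \<open>\<tau> n\<close> tending to 0.\<close>

lemma solutions_compact_initial:
  fixes g :: "nat \<Rightarrow> real \<Rightarrow> 'a"
  assumes g: "\<And>n. g n \<in> G" and x: "x \<in> D" and init: "(\<lambda>n. dom_dist f (g n 0) x) \<longlonglongrightarrow> 0"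
  shows "\<exists>r' u. strict_mono r' \<and> u \<in> G \<and> u 0 = x \<and>
    (\<forall>t \<tau>. 0 \<le> t \<and> (\<forall>n. 0 \<le> \<tau> n) \<and> \<tau> \<longlonglongrightarrow> t \<longrightarrow> (\<lambda>n. dom_dist f (g (r' n) (\<tau> n)) (u t)) \<longlonglongrightarrow> 0)"
proof -
  have g0: "(\<lambda>n. g n 0) \<longlonglongrightarrow> x" "(\<lambda>n. r (g n 0)) \<longlonglongrightarrow> r x" using init by (auto simp: dom_dist_tendsto_iff)
  have E0: "(\<lambda>n. E (g n 0)) \<longlonglongrightarrow> E x" unfolding E_def by (intro tendsto_add g0 p_tendsto)
  then have "Bseq (\<lambda>n. E (g n 0))" by (intro convergent_imp_Bseq convergentI)
  then obtain C where "\<And>n. \<bar>E (g n 0)\<bar> \<le> C" by (auto simp: Bseq_def)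
  then have gC: "E (g n 0) \<le> C" for n using abs_le_D1 by blast
  obtain r' u where r': "strict_mono r'" and u: "u \<in> G"
    and mov': "\<forall>t \<tau>. 0 \<le> t \<and> (\<forall>n. 0 \<le> \<tau> n) \<and> \<tau> \<longlonglongrightarrow> t \<longrightarrow> (\<lambda>n. g (r' n) (\<tau> n)) \<longlonglongrightarrow> u t"
    and pos: "\<forall>t \<tau>. 0 < t \<and> (\<forall>n. 0 \<le> \<tau> n) \<and> \<tau> \<longlonglongrightarrow> t \<longrightarrow> (\<lambda>n. dom_dist f (g (r' n) (\<tau> n)) (u t)) \<longlonglongrightarrow> 0"
    using solutions_compact[of g C, OF g gC] by (elim exE conjE) (rule that)
  have mov: "(\<lambda>n. g (r' n) (\<tau> n)) \<longlonglongrightarrow> u t" if "0 \<le> t" "\<And>n. 0 \<le> \<tau> n" "\<tau> \<longlonglongrightarrow> t" for t \<tau>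
    using mov' that by simp
  have "(\<lambda>n. g (r' n) 0) \<longlonglongrightarrow> u 0" using mov[of 0 "\<lambda>_. 0"] by simp
  moreover have "(\<lambda>n. g (r' n) 0) \<longlonglongrightarrow> x" using LIMSEQ_subseq_LIMSEQ[OF g0(1) r'] by (simp add: o_def)
  ultimately have u0: "u 0 = x" by (rule LIMSEQ_unique)
  have "(\<lambda>n. dom_dist f (g (r' n) (\<tau> n)) (u t)) \<longlonglongrightarrow> 0" if t: "0 \<le> t" "\<And>n. 0 \<le> \<tau> n" "\<tau> \<longlonglongrightarrow> t" for t \<tau>
  proof (cases "t = 0")
    case True
    show ?thesis
    proof (rule dom_dist_limit[OF mov[OF t]])
      fix e :: real assume "0 < e"
      have "(\<lambda>n. E (g (r' n) 0)) \<longlonglongrightarrow> E x" using LIMSEQ_subseq_LIMSEQ[OF E0 r'] by (simp add: o_def)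
      then have "\<forall>\<^sub>F n in sequentially. E (g (r' n) 0) < E x + e" using \<open>0 < e\<close> by (intro order_tendstoD(2)) auto
      then show "\<forall>\<^sub>F n in sequentially. E (g (r' n) (\<tau> n)) < E (u t) + e"
      proof eventually_elim
        case (elim n)
        have "E (g (r' n) (\<tau> n)) \<le> E (g (r' n) 0)" by (rule solution_E_mono[OF g order_refl t(2)])
        then show ?case using elim True u0 by simp
      qed
    qed (use solution_in_D[OF g] solution_in_D[OF u] t in auto)
  qed (use pos t in auto)
  then show ?thesis using r' u u0 by blast
qed

lemma dom_metric: "Metric_space D (dom_dist f)"
proof
  show "dom_dist f x y = 0 \<longleftrightarrow> x = y" for x y
    using norm_ge_zero[of "x - y"] by (auto simp: dom_dist_eq add_nonneg_eq_0_iff)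
  show "dom_dist f x z \<le> dom_dist f x y + dom_dist f y z" for x y z
    using norm_triangle_ineq[of "x - y" "y - z"] by (simp add: dom_dist_eq)
qed (auto simp: dom_dist_eq norm_minus_commute)

text \<open>Balls of the metric bound the norm and \<open>r\<close>, but \<open>E\<close> also
  contains \<open>p\<close>, for which no bound on bounded sets is assumed;
  \<open>E_bounded_on_bounded\<close> supplies the estimate.\<close>

lemma E_bounded_on_mbounded:
  assumes "Metric_space.mbounded D (dom_dist f) B"
  shows "\<exists>C. \<forall>x\<in>B. E x \<le> C"
proof -
  interpret Metric_space D "dom_dist f" by (rule dom_metric)
  obtain y R where y: "B \<subseteq> mcball y R" using assms unfolding mbounded_def by blast
  obtain C where C: "\<And>x. x \<in> D \<Longrightarrow> norm x \<le> norm y + \<bar>r y\<bar> + R \<and> r x \<le> norm y + \<bar>r y\<bar> + R \<Longrightarrow> E x \<le> C"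
    using E_bounded_on_bounded by metis
  have "E x \<le> C" if "x \<in> B" for x
  proof -
    have "x \<in> D" "norm (y - x) + \<bar>r y - r x\<bar> \<le> R" using that y by (auto simp: in_mcball dom_dist_eq)
    moreover have "norm x - norm y \<le> norm (y - x)" using norm_triangle_ineq2[of x y] by (simp add: norm_minus_commute)
    moreover have "0 \<le> norm (y - x)" "0 \<le> norm y" by simp_all
    ultimately show ?thesis by (intro C conjI) linarith+
  qed
  then show ?thesis by blast
qed

text \<open>Without energy loss the curve does not move, so on \<open>[1/2, 1]\<close> the EVI is
  that of a constant curve, which is the stationary inclusion. The interval avoids time 0, where the
  energy is not assumed equal.\<close>

lemma constant_energy_imp_rest:
  assumes g: "g \<in> G" and const: "\<And>s t. 0 < s \<Longrightarrow> s \<le> t \<Longrightarrow> t \<le> 1 \<Longrightarrow> E (g s) = E (g t)"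
  shows "- F (g 1) \<in> subdifferential f (g 1)"
  unfolding subdifferential_iff
proof (intro conjI ballI)
  show "g 1 \<in> D" using solution_in_D[OF g] by simp
  fix w assume w: "w \<in> D"
  have eq: "g s = g 1" if "1/2 \<le> s" "s \<le> 1" for s
    using solution_energy_le[OF g, of s 1] const[of s 1] that by auto
  have "EVI g w (1/2) 1 \<longleftrightarrow> EVI (\<lambda>_. g 1) w (1/2) 1" by (rule EVI_cong, rule eq) auto
  then have "EVI (\<lambda>_. g 1) w (1/2) 1" using solution_EVI[OF g w, of "1/2" 1] by simp
  then have "j w (g 1) \<le> r w" using set_integral_const_interval[of "1/2" 1 "j w (g 1)"] by (simp add: EVI_def)
  then show "r (g 1) + - F (g 1) \<bullet> (w - g 1) \<le> r w" by (simp add: j_def inner_diff_right)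
qed

theorem solutions_lyapunov_semiflow: "lyapunov_semiflow D (dom_dist f) G E"
proof -
  interpret Metric_space D "dom_dist f" by (rule dom_metric)
  show ?thesis
  proof
    show "G \<subseteq> {0..} \<rightarrow>\<^sub>E D"
    proof
      fix g assume g: "g \<in> G"
      then have "g \<in> extensional {0..}" by (simp add: gradient_flow_solutions_def)
      then show "g \<in> {0..} \<rightarrow>\<^sub>E D" using solution_in_D[OF g] by (simp add: PiE_iff)
    qed
    show "\<exists>g\<in>G. g 0 = x" if "x \<in> D" for x by (rule solution_exists[OF that])
    show "\<exists>m. \<forall>x\<in>D. m \<le> E x" by (rule E_bounded_below)
    show "\<exists>C. \<forall>x\<in>B. E x \<le> C" if "mbounded B" for B by (rule E_bounded_on_mbounded[OF that])
    show "(\<lambda>n. E (xs n)) \<longlonglongrightarrow> E y" if "(\<lambda>n. dom_dist f (xs n) y) \<longlonglongrightarrow> 0" for xs y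
      using that unfolding E_def dom_dist_tendsto_iff by (intro tendsto_add p_tendsto) auto
    show "\<exists>r g. strict_mono r \<and> g \<in> G \<and> E (g 0) \<le> C \<and>
          (\<forall>t \<tau>. 0 < t \<and> (\<forall>n. 0 \<le> \<tau> n) \<and> \<tau> \<longlonglongrightarrow> t \<longrightarrow> (\<lambda>n. dom_dist f (gs (r n) (\<tau> n)) (g t)) \<longlonglongrightarrow> 0)"
      if "\<And>n. gs n \<in> G" "\<And>n. E (gs n 0) \<le> C" for gs :: "nat \<Rightarrow> real \<Rightarrow> 'a" and C
      using solutions_compact[of gs C, OF that] by (elim exE conjE, intro exI conjI)
    show "\<exists>r g. strict_mono r \<and> g \<in> G \<and> g 0 = x \<and>
          (\<forall>t \<tau>. 0 \<le> t \<and> (\<forall>n. 0 \<le> \<tau> n) \<and> \<tau> \<longlonglongrightarrow> t \<longrightarrow> (\<lambda>n. dom_dist f (gs (r n) (\<tau> n)) (g t)) \<longlonglongrightarrow> 0)"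
      if "\<And>n. gs n \<in> G" "x \<in> D" "(\<lambda>n. dom_dist f (gs n 0) x) \<longlonglongrightarrow> 0" for gs x
      by (rule solutions_compact_initial[OF that])
    \<comment> \<open>Here the boundedness of the rest points enters: it turns into a bound on their
      energies.\<close>
    obtain C where C: "\<forall>v\<in>{v. \<exists>\<xi>\<in>subdifferential f v. \<xi> + F v = 0}. E v \<le> C" using E_bounded_on_mbounded[OF rest_bounded] by blast
    have "E (g 1) \<le> C" if "g \<in> G" "\<forall>s t. 0 < s \<and> s \<le> t \<and> t \<le> 1 \<longrightarrow> E (g s) = E (g t)" for g
      using constant_energy_imp_rest[OF that(1)] that(2) C by force
    then show "\<exists>C. \<forall>g\<in>G. (\<forall>s t. 0 < s \<and> s \<le> t \<and> t \<le> 1 \<longrightarrow> E (g s) = E (g t)) \<longrightarrow> E (g 1) \<le> C" by blast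
  qed (rule solution_shift solution_concat solution_E_mono; assumption)+
qed

end

theorem proposition1:
  fixes \<phi> \<phi>1 :: "'a::{real_inner, banach, second_countable_topology} \<Rightarrow> ereal"
    and \<phi>2 :: "'a \<Rightarrow> real"
    and D\<phi>2 :: "'a \<Rightarrow> 'a"
    and \<kappa> :: real
  assumes "\<And>v. \<phi> v = \<phi>1 v + ereal (\<phi>2 v)"
    and "proper_fun \<phi>1" and "lower_semicont \<phi>1" and "convex_fun \<phi>1"
    and "\<And>v. GDERIV \<phi>2 v :> D\<phi>2 v" and "continuous_on UNIV D\<phi>2"
    and "\<kappa> \<ge> 0"
    and "\<And>c::real. compact {v. \<phi> v + ereal (\<kappa> * (norm v)\<^sup>2) \<le> ereal c}"
    and "Liminf at_infinity \<phi> = \<infinity>"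
    and "\<And>T v. T > 0 \<Longrightarrow> v \<in> H1_on T \<Longrightarrow> (\<lambda>t. D\<phi>2 (v t)) \<in> L2_on T"
    and "Metric_space.mbounded (eff_dom \<phi>1) (dom_dist \<phi>1)
           {v. \<exists>\<xi>\<in>subdifferential \<phi>1 v. \<xi> + D\<phi>2 v = 0}"
  shows "generalized_semiflow (eff_dom \<phi>1) (dom_dist \<phi>1) (gradient_flow_solutions \<phi>1 D\<phi>2)
    \<and> (\<exists>!A. global_attractor (eff_dom \<phi>1) (dom_dist \<phi>1) (gradient_flow_solutions \<phi>1 D\<phi>2) A)
    \<and> (\<forall>A. global_attractor (eff_dom \<phi>1) (dom_dist \<phi>1) (gradient_flow_solutions \<phi>1 D\<phi>2) A \<longrightarrow>
           Lyapunov_stable (eff_dom \<phi>1) (dom_dist \<phi>1) (gradient_flow_solutions \<phi>1 D\<phi>2) A)"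
proof -
  have \<phi>: "\<phi> = (\<lambda>v. \<phi>1 v + ereal (\<phi>2 v))" using assms(1) by (rule ext)
  interpret gradient_system \<phi>1 \<phi>2 D\<phi>2 \<kappa>
    by unfold_locales (use assms(2-9,11) in \<open>simp_all add: \<phi>\<close>)
  interpret lyapunov_semiflow "eff_dom \<phi>1" "dom_dist \<phi>1" "gradient_flow_solutions \<phi>1 D\<phi>2" E
    by (rule solutions_lyapunov_semiflow)
  show ?thesis
    using generalized_semiflow global_attractor_exists global_attractor_least global_attractor_Lyapunov_stable
    by (metis subset_antisym)
qed

end
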